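(* Fix an integer $d\ge 1$ and a real $\rho>0$. For each integer $n\ge 3$ put $\ell_n=\left(\frac{d\log n}{\log\log n}\right)^{1/d}$, and let $f=f^{(n)}$ be the $\ell_n$-threshold strategy for the $d$-thinning of $\lfloor \rho n\rfloor$ balls into $n$ bins. Then: (1) $f$ is asymptotically optimal: for every $\epsilon>0$ and every choice, for each $n$, of a $d$-thinning strategy $g=g^{(n)}$ for $n$ bins, $$\lim_{n\to\infty}\mathbb{P}\left(\mathrm{MaxLoad}^{f}(\lfloor\rho n\rfloor)\le (1+\epsilon)\,\mathrm{MaxLoad}^{g}(\lfloor\rho n\rfloor)\right)=1;$$ (2) with high probability $\mathrm{MaxLoad}^{f}(\lfloor\rho n\rfloor)=(d+o(1))\left(\frac{d\log n}{\log\log n}\right)^{1/d}$, i.e. for every $\epsilon>0$, $$\lim_{n\to\infty}\mathbb{P}\left((d-\epsilon)\,\ell_n\le \mathrm{MaxLoad}^{f}(\lfloor\rho n\rfloor)\le (d+\epsilon)\,\ell_n\right)=1.$$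
   Context: Write $[n]=\{1,\dots,n\}$, $\mathbb{N}=\{1,2,\dots\}$; $\log$ is the natural logarithm. Setting. There are $n$ bins. Let $\{Z_1(r)\}_{r\in\mathbb{N}},\dots,\{Z_d(r)\}_{r\in\mathbb{N}}$ be $d$ sequences of random variables, all mutually independent and uniform on $[n]$; $\{Z_i(r)\}_r$ is the pool of $i$-ary allocations. Elements of each pool are drawn one by one, in order, as needed. A $d$-thinning strategy $f$ is a family of functions $f_{t,i}:[n]^t\to\{0,1\}$, $t\in\mathbb{N}$, $i\in[d-1]$, taking the final allocations of the first $t-1$ balls and the $i$-ary allocation suggested for the $t$-th ball, and returning $0$ if this $i$-ary allocation is accepted and $1$ if it is rejected. The functions $f_{t,i}$ may also depend on external, possibly random, data, as long as this data is independent of all future allocations (pool elements not yet drawn). Set $f_{t,d}\equiv 0$ (a $d$-ary allocation cannot be rejected). The process: let $r_1(t)=t$ and, for $2\le i\le d$, let $r_i(t)=\sum_{k=1}^t\prod_{j=1}^{i-1}f_{k,j}(Z(1),\dots,Z(k-1),Z_j(r_j(k)))$, the number of the first $t$ balls whose first $i-1$ suggested allocations were all rejected. Let $\mathrm{Chosen}(t)=\min\{i\in[d]: f_{t,i}(Z(1),\dots,Z(t-1),Z_i(r_i(t)))=0\}$. The final allocation of the $t$-th ball is $Z(t)=Z_{\mathrm{Chosen}(t)}(r_{\mathrm{Chosen}(t)}(t))$. Loads: $L^f_m(t)=|\{1\le k\le t: Z(k)=m\}|$ and $\mathrm{MaxLoad}^f(t)=\max_{m\in[n]}L^f_m(t)$.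 The $\ell$-threshold strategy (for real $\ell>0$): for $i\in[d-1]$, when bin $m$ is suggested as the $i$-ary allocation of the $t$-th ball, it is rejected if and only if accepting it would make the number of balls having accepted bin $m$ as their $i$-ary allocation exceed $\ell$, i.e. if and only if $1+|\{1\le k\le t-1:\mathrm{Chosen}(k)=i,\ Z(k)=m\}|>\ell$. (The $d$-ary allocation is always accepted.) When two strategies are compared, both are run on a common probability space. *)

theory Defs
  imports "HOL-Probability.Probability"
begin

text \<open>
  Bins are the numbers \<open>1, \<dots>, n\<close>; balls, levels and pool positions are counted from 1.
  \<open>Z i r\<close> is the \<open>r\<close>-th element of the pool of \<open>i\<close>-ary allocations.
\<close>

locale allocation_pools = prob_space M for M :: "'a measure" +
  fixes n d :: nat and Z :: "nat \<Rightarrow> nat \<Rightarrow> 'a \<Rightarrow> nat"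
  assumes indep_pools:
      "indep_vars (\<lambda>_. count_space {1..n}) (\<lambda>(i, r). Z i r) ({1..d} \<times> {1..})"
    and uniform_pools:
      "\<And>i r. i \<in> {1..d} \<Longrightarrow> r \<ge> 1 \<Longrightarrow>
         distr M (count_space {1..n}) (Z i r) = uniform_count_measure {1..n}"

text \<open>
  \<open>f t i \<omega> h m\<close> says that bin \<open>m\<close>, suggested as the \<open>i\<close>-ary allocation of ball \<open>t\<close>, is rejected.
  The list \<open>h\<close> contains the pairs (Chosen(k), Z(k)) for \<open>k = 1, \<dots>, t - 1\<close>. The levels Chosen(k)
  are past data, which a strategy may use (the threshold strategy does); all other external
  data enter through the sample point \<open>\<omega>\<close>. Which dependence on \<open>\<omega>\<close> is allowed is the content of
  \<open>thinning_strategy\<close> below.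
\<close>

type_synonym 'a decisions = "nat \<Rightarrow> nat \<Rightarrow> 'a \<Rightarrow> (nat \<times> nat) list \<Rightarrow> nat \<Rightarrow> bool"

text \<open>
  The first \<open>i - 1\<close> suggestions for ball \<open>k\<close> are all rejected iff Chosen(k) is at least \<open>i\<close>, so
  for the history \<open>h\<close> of the first \<open>t\<close> balls \<open>reached h i\<close> is the number \<open>r\<^sub>i(t)\<close>.
\<close>

definition reached :: "(nat \<times> nat) list \<Rightarrow> nat \<Rightarrow> nat" where
  "reached h i = length (filter (\<lambda>(c, m). i \<le> c) h)"

text \<open>
  If the ball following the history \<open>h\<close> gets as far as level \<open>i\<close>, it is offered the next unused
  element of pool \<open>i\<close>. At levels beyond the one at which the ball is accepted, this value
  is never used.
\<close>

definition suggested :: "(nat \<Rightarrow> nat \<Rightarrow> 'a \<Rightarrow> nat) \<Rightarrow> 'a \<Rightarrow> (nat \<times> nat) list \<Rightarrow> nat \<Rightarrow> nat" where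
  "suggested Z \<omega> h i = Z i (Suc (reached h i)) \<omega>"

definition next_level ::
  "nat \<Rightarrow> 'a decisions \<Rightarrow> (nat \<Rightarrow> nat \<Rightarrow> 'a \<Rightarrow> nat) \<Rightarrow> 'a \<Rightarrow> (nat \<times> nat) list \<Rightarrow> nat" where
  "next_level d f Z \<omega> h =
     (LEAST i. i \<in> {1..d} \<and> (i = d \<or> \<not> f (Suc (length h)) i \<omega> h (suggested Z \<omega> h i)))"

primrec history ::
  "nat \<Rightarrow> 'a decisions \<Rightarrow> (nat \<Rightarrow> nat \<Rightarrow> 'a \<Rightarrow> nat) \<Rightarrow> 'a \<Rightarrow> nat \<Rightarrow> (nat \<times> nat) list" where
  "history d f Z \<omega> 0 = []"
| "history d f Z \<omega> (Suc t) =
     (let h = history d f Z \<omega> t; c = next_level d f Z \<omega> h in h @ [(c, suggested Z \<omega> h c)])"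

definition chosen ::
  "nat \<Rightarrow> 'a decisions \<Rightarrow> (nat \<Rightarrow> nat \<Rightarrow> 'a \<Rightarrow> nat) \<Rightarrow> 'a \<Rightarrow> nat \<Rightarrow> nat" where
  "chosen d f Z \<omega> t = fst (last (history d f Z \<omega> t))"

definition allocation ::
  "nat \<Rightarrow> 'a decisions \<Rightarrow> (nat \<Rightarrow> nat \<Rightarrow> 'a \<Rightarrow> nat) \<Rightarrow> 'a \<Rightarrow> nat \<Rightarrow> nat" where
  "allocation d f Z \<omega> t = snd (last (history d f Z \<omega> t))"

definition load ::
  "nat \<Rightarrow> 'a decisions \<Rightarrow> (nat \<Rightarrow> nat \<Rightarrow> 'a \<Rightarrow> nat) \<Rightarrow> nat \<Rightarrow> nat \<Rightarrow> 'a \<Rightarrow> nat" where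
  "load d f Z m t \<omega> = card {k \<in> {1..t}. allocation d f Z \<omega> k = m}"

definition max_load ::
  "nat \<Rightarrow> nat \<Rightarrow> 'a decisions \<Rightarrow> (nat \<Rightarrow> nat \<Rightarrow> 'a \<Rightarrow> nat) \<Rightarrow> nat \<Rightarrow> 'a \<Rightarrow> nat" where
  "max_load n d f Z t \<omega> = Max ((\<lambda>m. load d f Z m t \<omega>) ` {1..n})"

text \<open>
  \<open>drawn d f Z t i j \<omega>\<close> is the number of elements drawn from pool \<open>j\<close> when the \<open>i\<close>-ary
  allocation of ball \<open>t\<close> is up for decision. That allocation itself has been drawn.
\<close>

definition drawn ::
  "nat \<Rightarrow> 'a decisions \<Rightarrow> (nat \<Rightarrow> nat \<Rightarrow> 'a \<Rightarrow> nat) \<Rightarrow> nat \<Rightarrow> nat \<Rightarrow> nat \<Rightarrow> 'a \<Rightarrow> nat" where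
  "drawn d f Z t i j \<omega> = reached (history d f Z \<omega> (if j \<le> i then t else t - 1)) j"

text \<open>
  What is known at that moment: the data entering the decision (that is, the random function
  \<open>f t i \<omega>\<close>), the history of the previous balls, and the pool elements drawn so far.
\<close>

definition past_events ::
  "'a measure \<Rightarrow> nat \<Rightarrow> nat \<Rightarrow> 'a decisions \<Rightarrow> (nat \<Rightarrow> nat \<Rightarrow> 'a \<Rightarrow> nat) \<Rightarrow> nat \<Rightarrow> nat \<Rightarrow> 'a set set"
  where
  "past_events M n d f Z t i = sigma_sets (space M)
     ({{\<omega> \<in> space M. f t i \<omega> h m} | h m.
         length h = t - 1 \<and> set h \<subseteq> {1..d} \<times> {1..n} \<and> m \<in> {1..n}} \<union>
      {{\<omega> \<in> space M. history d f Z \<omega> (t - 1) = h} | h. True} \<union>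
      {{\<omega> \<in> space M. r \<le> drawn d f Z t i j \<omega> \<and> Z j r \<omega> = m} | j r m.
         j \<in> {1..d} \<and> 1 \<le> r \<and> m \<in> {1..n}})"

definition future_events ::
  "'a measure \<Rightarrow> nat \<Rightarrow> nat \<Rightarrow> 'a decisions \<Rightarrow> (nat \<Rightarrow> nat \<Rightarrow> 'a \<Rightarrow> nat) \<Rightarrow> nat \<Rightarrow> nat \<Rightarrow> 'a set set"
  where
  "future_events M n d f Z t i = sigma_sets (space M)
     {{\<omega> \<in> space M. Z j (drawn d f Z t i j \<omega> + s) \<omega> = m} | j s m.
        j \<in> {1..d} \<and> 1 \<le> s \<and> m \<in> {1..n}}"

text \<open>
  The external data must be independent of the pool elements not yet drawn. This has to be
  required jointly with the known past: the sum modulo \<open>n\<close> of a past and a future pool element is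
  by itself independent of the future, but together with the past it reveals the future element.
\<close>

definition thinning_strategy ::
  "'a measure \<Rightarrow> nat \<Rightarrow> nat \<Rightarrow> (nat \<Rightarrow> nat \<Rightarrow> 'a \<Rightarrow> nat) \<Rightarrow> 'a decisions \<Rightarrow> bool" where
  "thinning_strategy M n d Z f \<longleftrightarrow>
     (\<forall>t \<ge> 1. \<forall>i \<in> {1..d - 1}.
        prob_space.indep_set M (past_events M n d f Z t i) (future_events M n d f Z t i))"

definition threshold_strategy :: "real \<Rightarrow> 'a decisions" where
  "threshold_strategy l t i \<omega> h m \<longleftrightarrow> real (1 + count_list h (i, m)) > l"

definition threshold :: "nat \<Rightarrow> nat \<Rightarrow> real" where
  "threshold d n = (real d * ln (real n) / ln (ln (real n))) powr (1 / real d)"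

end

theory Submission
  imports Defs "HOL-Real_Asymp.Real_Asymp"
begin

text \<open>
  Write \<open>l\<close> for the threshold; it satisfies \<open>l^d ln l \<sim> ln n\<close>.

  Upper bound. Levels below \<open>d\<close> contribute at most \<open>l\<close> balls each to a bin. A ball rejected at level
  \<open>i\<close> witnesses more than \<open>l\<close> offers of the same bin from pool \<open>i\<close>, so by first moments the number of
  balls reaching level \<open>i + 1\<close> is at most \<open>n exp (- (1 - o(1)) l^i ln l)\<close>; the balls reaching level \<open>d\<close>
  are then too few to offer any bin more than \<open>(1 + o(1)) l\<close> times.

  Lower bound, for any strategy. Split the balls into a large constant number of phases and record
  for each phase the exponents \<open>b i\<close> for which about \<open>n exp (- b i l^i ln l)\<close> balls are rejected at level \<open>i\<close>,
  rounded to a finite grid. By pigeonhole \<open>d\<close> phases have the same exponents. In the \<open>i\<close>-th of these,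
  about \<open>n exp (- b i l^i ln l)\<close> of the bins that are already high are offered \<open>(b i / b (i - 1)) l\<close> times
  from level \<open>i\<close>, and the rejections do not suffice to protect all of them. With \<open>b 0 = b d = 1\<close> the gains
  add up to at least \<open>d l\<close>, because a sum of \<open>d\<close> positive ratios with product 1 is at least \<open>d\<close>.
  Within one phase the offers are independent of the past, which determines the high bins; this is
  the only place where the strategy being nonanticipating enters.
\<close>

text \<open>Why the gain at level \<open>i\<close> is \<open>(b i / b (i - 1)) l\<close>: about
  \<open>n exp (- b (i - 1) l^(i - 1) ln l)\<close> balls arrive there, so a given bin is offered
  \<open>x\<close> times with probability about \<open>exp (- x b (i - 1) l^(i - 1) ln l)\<close>,
  and for this \<open>x\<close> the exponent is \<open>b i l^i ln l\<close>. Rejections are as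
  frequent on this scale and each saves at most one bin, so a slightly smaller \<open>x\<close>
  leaves more bins offered than saved. The bins that are high beforehand may be as few as
  \<open>n exp (- G l^(i - 1) ln l)\<close> for a constant \<open>G\<close>; this loss is smaller by
  a factor of order \<open>l\<close>, which is why gains of successive phases add up.

  \<open>b 0 = 1\<close> because the balls of a phase provide about \<open>l\<close> rounds of
  \<open>n / l\<close> offers, and \<open>b d = 1\<close> because \<open>n exp (- l^d ln l)\<close>
  is about one bin. The gains are collected in different phases because the high bins must be fixed
  before the offers that raise them. A strategy may change its behaviour over time, hence the
  pigeonhole. An exponent at the end of the grid means almost no rejections, so later levels need
  not receive balls; but then the ratios up to that level are large enough already.\<close>

section \<open>The process: levels reached, histories and loads\<close>

lemma length_history [simp]: "length (history d f Z \<omega> t) = t"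
  by (induction t) (simp_all add: Let_def)

lemma reached_Nil [simp]: "reached [] i = 0"
  by (simp add: reached_def)

lemma reached_snoc [simp]:
  "reached (h @ [(c, m)]) i = (if i \<le> c then Suc (reached h i) else reached h i)"
  by (simp add: reached_def)

lemma
  assumes "d \<ge> 1"
  shows next_level_ge_1: "1 \<le> next_level d f Z \<omega> h"
    and next_level_le: "next_level d f Z \<omega> h \<le> d"
    and next_level_accepts: "next_level d f Z \<omega> h \<noteq> d \<Longrightarrow>
      \<not> f (Suc (length h)) (next_level d f Z \<omega> h) \<omega> h (suggested Z \<omega> h (next_level d f Z \<omega> h))"
proof -
  have "next_level d f Z \<omega> h \<in> {1..d} \<and> (next_level d f Z \<omega> h = d \<or>
      \<not> f (Suc (length h)) (next_level d f Z \<omega> h) \<omega> h (suggested Z \<omega> h (next_level d f Z \<omega> h)))"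
    unfolding next_level_def by (rule LeastI[of _ d]) (use assms in auto)
  then show "1 \<le> next_level d f Z \<omega> h" "next_level d f Z \<omega> h \<le> d"
    "next_level d f Z \<omega> h \<noteq> d \<Longrightarrow>
      \<not> f (Suc (length h)) (next_level d f Z \<omega> h) \<omega> h (suggested Z \<omega> h (next_level d f Z \<omega> h))"
    by auto
qed

lemma next_level_rejects:
  assumes "1 \<le> i" "i < next_level d f Z \<omega> h" "d \<ge> 1"
  shows "f (Suc (length h)) i \<omega> h (suggested Z \<omega> h i)"
proof -
  have "\<not> (i \<in> {1..d} \<and> (i = d \<or> \<not> f (Suc (length h)) i \<omega> h (suggested Z \<omega> h i)))"
    using assms(2) unfolding next_level_def by (rule not_less_Least)
  then show ?thesis
    using assms next_level_le[OF assms(3), of f Z \<omega> h] by auto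
qed

lemma Suc_le_next_level_iff:
  assumes "1 \<le> i" "i < d"
  shows "Suc i \<le> next_level d f Z \<omega> h \<longleftrightarrow>
    i \<le> next_level d f Z \<omega> h \<and> f (Suc (length h)) i \<omega> h (suggested Z \<omega> h i)"
proof -
  have d: "d \<ge> 1" using assms by simp
  show ?thesis
    using next_level_rejects[of i d f Z \<omega> h] next_level_accepts[OF d, of f Z \<omega> h] assms d
    by (cases "i = next_level d f Z \<omega> h") auto
qed

lemma history_Suc:
  "history d f Z \<omega> (Suc t) = history d f Z \<omega> t @
    [(next_level d f Z \<omega> (history d f Z \<omega> t),
      suggested Z \<omega> (history d f Z \<omega> t) (next_level d f Z \<omega> (history d f Z \<omega> t)))]"
  by (simp add: Let_def)

declare history.simps(2) [simp del]

lemma reached_history_Suc: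
  "reached (history d f Z \<omega> (Suc t)) i = reached (history d f Z \<omega> t) i +
     (if i \<le> next_level d f Z \<omega> (history d f Z \<omega> t) then 1 else 0)"
  by (simp add: history_Suc)

lemma reached_history_1 [simp]:
  "d \<ge> 1 \<Longrightarrow> reached (history d f Z \<omega> t) (Suc 0) = t"
  by (induction t) (use next_level_ge_1[of d] in \<open>simp_all add: reached_history_Suc\<close>)

text \<open>Rejections at level \<open>i\<close> are counted as \<open>reached h (Suc i)\<close>. At
  \<open>i = d\<close> this count has to vanish, so that counting arguments treat the last level
  like the others.\<close>

lemma reached_history_beyond [simp]:
  "d \<ge> 1 \<Longrightarrow> reached (history d f Z \<omega> t) (Suc d) = 0"
  by (induction t)
    (use next_level_le[of d] in \<open>simp_all add: reached_history_Suc Suc_le_eq not_less\<close>)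

lemma reached_history_mono:
  "s \<le> t \<Longrightarrow> reached (history d f Z \<omega> s) i \<le> reached (history d f Z \<omega> t) i"
  by (induction t rule: dec_induct) (auto simp: reached_history_Suc)

lemma reached_history_diff_le:
  "s \<le> t \<Longrightarrow> reached (history d f Z \<omega> t) i \<le> reached (history d f Z \<omega> s) i + (t - s)"
  by (induction t rule: dec_induct) (auto simp: reached_history_Suc)

text \<open>Loads depend on the sample point only through the history. Induction over balls and
  measurability of the maximal load both rest on this form.\<close>

lemma load_conv_count_list:
  "load d f Z m t \<omega> = count_list (map snd (history d f Z \<omega> t)) m"
proof (induction t)
  case 0
  show ?case by (simp add: load_def)
next
  case (Suc t)
  have "{k \<in> {1..Suc t}. allocation d f Z \<omega> k = m} =
      {k \<in> {1..t}. allocation d f Z \<omega> k = m} \<union>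
      (if allocation d f Z \<omega> (Suc t) = m then {Suc t} else {})"
    by (auto simp: le_Suc_eq)
  then show ?case
    using Suc by (auto simp: load_def allocation_def history_Suc)
qed

lemma load_mono: "s \<le> t \<Longrightarrow> load d f Z m s \<omega> \<le> load d f Z m t \<omega>"
  by (induction t rule: dec_induct) (auto simp: load_conv_count_list history_Suc)

lemma le_max_load: "m \<in> {1..n} \<Longrightarrow> load d f Z m t \<omega> \<le> max_load n d f Z t \<omega>"
  by (simp add: max_load_def)

lemma greaterThanAtMost_Suc_filter:
  "a \<le> b \<Longrightarrow> card {r \<in> {a<..Suc b}. P r} = card {r \<in> {a<..b}. P r} + (if P (Suc b) then 1 else 0)"
proof -
  assume "a \<le> b"
  then have "{r \<in> {a<..Suc b}. P r} = {r \<in> {a<..b}. P r} \<union> (if P (Suc b) then {Suc b} else {})"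
    by (auto simp: le_Suc_eq)
  then show ?thesis by simp
qed

text \<open>An offer from pool \<open>i\<close> fails to raise the load of its bin only if it is
  rejected, so each rejection spoils at most one bin. \<open>B\<close> collects the spoiled bins;
  its size is compared additively to avoid truncated subtraction.\<close>

lemma load_ge_offers:
  assumes d: "d \<ge> 1" and i: "1 \<le> i" "i \<le> d" and "s \<le> t"
  shows "\<exists>B. finite B \<and>
    card B + reached (history d f Z \<omega> s) (Suc i) \<le> reached (history d f Z \<omega> t) (Suc i) \<and>
    (\<forall>m. m \<notin> B \<longrightarrow> load d f Z m s \<omega> +
      card {r \<in> {reached (history d f Z \<omega> s) i<..reached (history d f Z \<omega> t) i}. Z i r \<omega> = m}
      \<le> load d f Z m t \<omega>)"
  using \<open>s \<le> t\<close>
proof (induction t rule: dec_induct)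
  case base
  show ?case by (intro exI[of _ "{}"]) auto
next
  case (step t)
  let ?h = "history d f Z \<omega> t" and ?g = "history d f Z \<omega> s"
  let ?c = "next_level d f Z \<omega> ?h"
  obtain B where B: "finite B" "card B + reached ?g (Suc i) \<le> reached ?h (Suc i)"
    "\<And>m. m \<notin> B \<Longrightarrow> load d f Z m s \<omega> + card {r \<in> {reached ?g i<..reached ?h i}. Z i r \<omega> = m}
      \<le> load d f Z m t \<omega>"
    using step.IH by auto
  have mono: "load d f Z m t \<omega> \<le> load d f Z m (Suc t) \<omega>" for m
    by (rule load_mono) simp
  have le: "reached ?g i \<le> reached ?h i"
    by (rule reached_history_mono) (rule step.hyps)
  have new: "load d f Z m (Suc t) \<omega> = load d f Z m t \<omega> + (if suggested Z \<omega> ?h ?c = m then 1 else 0)"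
    for m by (simp add: load_conv_count_list history_Suc)
  \<comment> \<open>The ball stops before pool \<open>i\<close>, accepts its offer, or rejects it.
    Only a rejection enlarges \<open>B\<close>, and it also raises the rejection count by
    one.\<close>
  consider "?c < i" | "?c = i" | "i < ?c" by linarith
  then show ?case
  proof cases
    case 1
    then have "reached (history d f Z \<omega> (Suc t)) i = reached ?h i"
      "reached (history d f Z \<omega> (Suc t)) (Suc i) = reached ?h (Suc i)"
      by (simp_all add: reached_history_Suc)
    then show ?thesis
      by (intro exI[of _ B]) (auto intro: B(1) B(2) le_trans[OF B(3) mono] simp del: greaterThanAtMost_iff)
  next
    case 2
    then have *: "reached (history d f Z \<omega> (Suc t)) i = Suc (reached ?h i)"
      "reached (history d f Z \<omega> (Suc t)) (Suc i) = reached ?h (Suc i)"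
      by (simp_all add: reached_history_Suc)
    have "load d f Z m s \<omega> +
        card {r \<in> {reached ?g i<..Suc (reached ?h i)}. Z i r \<omega> = m} \<le> load d f Z m (Suc t) \<omega>"
      if "m \<notin> B" for m
      using B(3)[OF that] 2 by (simp only: greaterThanAtMost_Suc_filter[OF le] new) (auto simp: suggested_def)
    with * B show ?thesis
      by (intro exI[of _ B]) (simp only: *, simp)
  next
    case 3
    then have *: "reached (history d f Z \<omega> (Suc t)) i = Suc (reached ?h i)"
      "reached (history d f Z \<omega> (Suc t)) (Suc i) = Suc (reached ?h (Suc i))"
      by (simp_all add: reached_history_Suc)
    have "load d f Z m s \<omega> +
        card {r \<in> {reached ?g i<..Suc (reached ?h i)}. Z i r \<omega> = m} \<le> load d f Z m (Suc t) \<omega>"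
      if "m \<notin> insert (Z i (Suc (reached ?h i)) \<omega>) B" for m
      using B(3)[of m] that mono[of m]
      by (simp only: greaterThanAtMost_Suc_filter[OF le]) auto
    moreover have "card (insert (Z i (Suc (reached ?h i)) \<omega>) B) \<le> Suc (card B)"
      by (rule card_insert_le_m1) auto
    ultimately show ?thesis
      unfolding * using B(1,2)
      by (intro exI[of _ "insert (Z i (Suc (reached ?h i)) \<omega>) B"] conjI allI impI) auto
  qed
qed

section \<open>The threshold strategy\<close>

definition offers :: "(nat \<Rightarrow> nat \<Rightarrow> 'a \<Rightarrow> nat) \<Rightarrow> 'a \<Rightarrow> nat \<Rightarrow> nat \<Rightarrow> nat \<Rightarrow> nat" where
  "offers Z \<omega> i r m = card {s \<in> {0<..r}. Z i s \<omega> = m}"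

lemma offers_0 [simp]: "offers Z \<omega> i 0 m = 0"
  by (simp add: offers_def)

lemma offers_Suc:
  "offers Z \<omega> i (Suc r) m = offers Z \<omega> i r m + (if Z i (Suc r) \<omega> = m then 1 else 0)"
  unfolding offers_def by (rule greaterThanAtMost_Suc_filter) simp

lemma offers_mono: "r \<le> r' \<Longrightarrow> offers Z \<omega> i r m \<le> offers Z \<omega> i r' m"
  unfolding offers_def by (rule card_mono) auto

text \<open>Each bin has a quota of \<open>nat \<lfloor>l\<rfloor>\<close> acceptances per level:
  offers are accepted until it is used up and rejected from then on. What happens at other levels
  matters only through the number of offers.\<close>

lemma count_list_threshold:
  fixes Z :: "nat \<Rightarrow> nat \<Rightarrow> 'a \<Rightarrow> nat" and \<omega> :: 'a
  assumes "1 \<le> i" "i < d" "l \<ge> 0"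
  defines "h \<equiv> \<lambda>t. history d (threshold_strategy l) Z \<omega> t"
  shows "count_list (h t) (i, m) = min (nat \<lfloor>l\<rfloor>) (offers Z \<omega> i (reached (h t) i) m)"
proof (induction t)
  case 0
  show ?case by (simp add: h_def)
next
  case (Suc t)
  have d: "d \<ge> 1" using assms by simp
  let ?c = "next_level d (threshold_strategy l) Z \<omega> (h t)"
  have *: "h (Suc t) = h t @ [(?c, suggested Z \<omega> (h t) ?c)]"
    by (simp add: h_def history_Suc)
  have r: "reached (h (Suc t)) i = reached (h t) i + (if i \<le> ?c then 1 else 0)"
    by (simp add: *)
  have iff: "Suc i \<le> ?c \<longleftrightarrow> i \<le> ?c \<and> nat \<lfloor>l\<rfloor> \<le> count_list (h t) (i, suggested Z \<omega> (h t) i)"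
    using Suc_le_next_level_iff[of i d "threshold_strategy l" Z \<omega> "h t"] assms(1-3)
    by (simp add: threshold_strategy_def) linarith
  consider "?c < i" | "?c = i" | "i < ?c" by linarith
  then show ?case
  proof cases
    case 1
    with Suc r show ?thesis by (simp add: *)
  next
    case 2
    with iff have "count_list (h t) (i, suggested Z \<omega> (h t) i) < nat \<lfloor>l\<rfloor>" by auto
    with 2 Suc r show ?thesis by (auto simp: * offers_Suc suggested_def)
  next
    case 3
    with iff have "nat \<lfloor>l\<rfloor> \<le> count_list (h t) (i, suggested Z \<omega> (h t) i)" by auto
    with 3 Suc r show ?thesis by (auto simp: * offers_Suc suggested_def)
  qed
qed

text \<open>Only offers beyond the quota of their bin are rejected, and the truncated differences
  count exactly these. This makes the number of balls at level \<open>i + 1\<close> a function of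
  the contents of pool \<open>i\<close>.\<close>

lemma reached_Suc_threshold_le:
  fixes Z :: "nat \<Rightarrow> nat \<Rightarrow> 'a \<Rightarrow> nat" and \<omega> :: 'a
  assumes "1 \<le> i" "i < d" "l \<ge> 0" and Z: "\<And>r. r \<ge> 1 \<Longrightarrow> Z i r \<omega> \<in> {1..n}"
  defines "h \<equiv> \<lambda>t. history d (threshold_strategy l) Z \<omega> t"
  shows "reached (h t) (Suc i) \<le> (\<Sum>m\<in>{1..n}. offers Z \<omega> i (reached (h t) i) m - nat \<lfloor>l\<rfloor>)"
proof (induction t)
  case 0
  show ?case by (simp add: h_def)
next
  case (Suc t)
  let ?c = "next_level d (threshold_strategy l) Z \<omega> (h t)"
  let ?m = "Z i (Suc (reached (h t) i)) \<omega>"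
  have r: "reached (h (Suc t)) j = reached (h t) j + (if j \<le> ?c then 1 else 0)" for j
    by (simp add: h_def history_Suc)
  show ?case
  proof (cases "Suc i \<le> ?c")
    case True
    then have "nat \<lfloor>l\<rfloor> \<le> count_list (h t) (i, ?m)"
      using Suc_le_next_level_iff[of i d "threshold_strategy l" Z \<omega> "h t"] assms(1-3)
      by (simp add: threshold_strategy_def suggested_def) linarith
    also have "\<dots> \<le> offers Z \<omega> i (reached (h t) i) ?m"
      unfolding h_def count_list_threshold[OF assms(1-3)] by simp
    finally have ge: "nat \<lfloor>l\<rfloor> \<le> offers Z \<omega> i (reached (h t) i) ?m" .
    have m: "?m \<in> {1..n}" by (rule Z) simp
    \<comment> \<open>Truncation does no harm: the quota of \<open>?m\<close> is already used up, so
      the new offer counts in full.\<close>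
    have "offers Z \<omega> i (Suc (reached (h t) i)) m - nat \<lfloor>l\<rfloor> =
        (offers Z \<omega> i (reached (h t) i) m - nat \<lfloor>l\<rfloor>) + (if m = ?m then 1 else 0)" for m
      using ge by (auto simp: offers_Suc)
    then have "(\<Sum>m\<in>{1..n}. offers Z \<omega> i (Suc (reached (h t) i)) m - nat \<lfloor>l\<rfloor>) =
        (\<Sum>m\<in>{1..n}. offers Z \<omega> i (reached (h t) i) m - nat \<lfloor>l\<rfloor>) + 1"
      using m by (simp add: sum.distrib)
    with True Suc r show ?thesis by simp
  next
    case False
    have "(\<Sum>m\<in>{1..n}. offers Z \<omega> i (reached (h t) i) m - nat \<lfloor>l\<rfloor>)
        \<le> (\<Sum>m\<in>{1..n}. offers Z \<omega> i (reached (h (Suc t)) i) m - nat \<lfloor>l\<rfloor>)"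
      by (intro sum_mono diff_le_mono offers_mono) (simp add: r)
    with False Suc r show ?thesis by simp
  qed
qed

lemma count_list_le_offers:
  "count_list (history d f Z \<omega> t) (i, m) \<le> offers Z \<omega> i (reached (history d f Z \<omega> t) i) m"
  by (induction t) (auto simp: history_Suc offers_Suc suggested_def)

lemma load_conv_sum:
  assumes "d \<ge> 1"
  shows "load d f Z m t \<omega> = (\<Sum>i\<in>{1..d}. count_list (history d f Z \<omega> t) (i, m))"
proof (induction t)
  case 0
  show ?case by (simp add: load_def)
next
  case (Suc t)
  let ?c = "next_level d f Z \<omega> (history d f Z \<omega> t)"
  have "?c \<in> {1..d}"
    by (simp add: next_level_ge_1[OF assms, simplified] next_level_le[OF assms])
  moreover have "count_list (history d f Z \<omega> (Suc t)) (i, m) = count_list (history d f Z \<omega> t) (i, m) +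
      (if i = ?c then if suggested Z \<omega> (history d f Z \<omega> t) ?c = m then 1 else 0 else 0)" for i
    by (simp add: history_Suc)
  ultimately show ?case
    using Suc by (simp add: load_conv_count_list sum.distrib) (simp add: history_Suc)
qed

text \<open>The quota caps all levels but the last, where acceptance is forced and only the number
  of offers limits the load.\<close>

lemma load_threshold_le:
  fixes Z :: "nat \<Rightarrow> nat \<Rightarrow> 'a \<Rightarrow> nat" and \<omega> :: 'a
  assumes "d \<ge> 1" "l \<ge> 0"
  defines "h \<equiv> \<lambda>t. history d (threshold_strategy l) Z \<omega> t"
  shows "load d (threshold_strategy l) Z m t \<omega>
    \<le> (d - 1) * nat \<lfloor>l\<rfloor> + offers Z \<omega> d (reached (h t) d) m"
proof -
  have "{1..d} = insert d {1..d - 1}" using assms by auto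
  then have "load d (threshold_strategy l) Z m t \<omega> =
      count_list (h t) (d, m) + (\<Sum>i\<in>{1..d-1}. count_list (h t) (i, m))"
    using assms by (subst load_conv_sum) auto
  also have "(\<Sum>i\<in>{1..d-1}. count_list (h t) (i, m)) \<le> (\<Sum>i\<in>{1..d-1}. nat \<lfloor>l\<rfloor>)"
    by (intro sum_mono) (auto simp: h_def count_list_threshold assms(2))
  also have "count_list (h t) (d, m) \<le> offers Z \<omega> d (reached (h t) d) m"
    unfolding h_def by (rule count_list_le_offers)
  finally show ?thesis by simp
qed

section \<open>Cylinder events\<close>

context allocation_pools
begin

lemma pool_measurable:
  assumes "i \<in> {1..d}" "r \<ge> 1"
  shows "Z i r \<in> measurable M (count_space {1..n})"
  using indep_pools assms unfolding indep_vars_def by force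

lemma pool_in:
  assumes "i \<in> {1..d}" "r \<ge> 1" "\<omega> \<in> space M"
  shows "Z i r \<omega> \<in> {1..n}"
  using measurable_space[OF pool_measurable[OF assms(1,2)] assms(3)] by simp

lemma pool_event [measurable]:
  assumes "i \<in> {1..d}" "r \<ge> 1"
  shows "{\<omega> \<in> space M. Z i r \<omega> = v} \<in> events"
proof (cases "v \<in> {1..n}")
  case True
  have "Z i r -` {v} \<inter> space M \<in> events"
    by (rule measurable_sets[OF pool_measurable[OF assms]]) (use True in auto)
  moreover have "Z i r -` {v} \<inter> space M = {\<omega> \<in> space M. Z i r \<omega> = v}" by auto
  ultimately show ?thesis by simp
next
  case False
  then have "{\<omega> \<in> space M. Z i r \<omega> = v} = {}" using pool_in[OF assms] by auto
  then show ?thesis by (simp only: sets.empty_sets)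
qed

lemma prob_pool:
  assumes "i \<in> {1..d}" "r \<ge> 1" "v \<in> {1..n}"
  shows "prob {\<omega> \<in> space M. Z i r \<omega> = v} = 1 / n"
proof -
  have "measure (distr M (count_space {1..n}) (Z i r)) {v} = 1 / n"
    using assms uniform_pools[OF assms(1,2)] by (simp add: measure_uniform_count_measure)
  moreover have "measure (distr M (count_space {1..n}) (Z i r)) {v} = prob (Z i r -` {v} \<inter> space M)"
    by (rule measure_distr[OF pool_measurable]) (use assms in auto)
  moreover have "Z i r -` {v} \<inter> space M = {\<omega> \<in> space M. Z i r \<omega> = v}" by auto
  ultimately show ?thesis by simp
qed

lemma cylinder_event:
  assumes "finite J" "J \<subseteq> {1..d} \<times> {1..}"
  shows "{\<omega> \<in> space M. \<forall>(i, r)\<in>J. Z i r \<omega> = v (i, r)} \<in> events"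
proof -
  have "{\<omega> \<in> space M. \<forall>p\<in>J. Z (fst p) (snd p) \<omega> = v p} \<in> events"
    using assms by (intro sets.sets_Collect_finite_All pool_event) auto
  then show ?thesis by (simp add: case_prod_beta)
qed

lemma prob_cylinder:
  assumes "finite J" "J \<subseteq> {1..d} \<times> {1..}" "\<And>p. p \<in> J \<Longrightarrow> v p \<in> {1..n}"
  shows "prob {\<omega> \<in> space M. \<forall>(i, r)\<in>J. Z i r \<omega> = v (i, r)} = 1 / n ^ card J"
proof (cases "J = {}")
  case True
  then show ?thesis by (simp add: prob_space)
next
  case False
  have eq: "(case p of (i, r) \<Rightarrow> Z i r) -` {v p} \<inter> space M = {\<omega> \<in> space M. Z (fst p) (snd p) \<omega> = v p}"
    for p by (auto split: prod.splits)
  have "{\<omega> \<in> space M. \<forall>(i, r)\<in>J. Z i r \<omega> = v (i, r)} =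
      (\<Inter>p\<in>J. (case p of (i, r) \<Rightarrow> Z i r) -` {v p} \<inter> space M)"
    using False by (auto split: prod.splits)
  also have "prob \<dots> = (\<Prod>p\<in>J. prob ((case p of (i, r) \<Rightarrow> Z i r) -` {v p} \<inter> space M))"
    by (rule indep_varsD[OF indep_pools False assms(1,2)]) (use assms(3) in auto)
  also have "\<dots> = (\<Prod>p\<in>J. 1 / n)"
    unfolding eq using assms by (intro prod.cong refl prob_pool) auto
  finally show ?thesis by (simp add: power_divide)
qed

lemma n_pos: "d \<ge> 1 \<Longrightarrow> n \<ge> 1"
  using pool_in[of 1 1] not_empty by fastforce

text \<open>First moments of the number of \<open>k\<close>-fold collisions control both the number of rejections
  and the maximal number of offers.\<close>

lemma prob_collisions:
  assumes i: "i \<in> {1..d}" and y: "y > 0"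
  shows "{\<omega> \<in> space M. y \<le> real (\<Sum>m\<in>{1..n}. offers Z \<omega> i R m choose k)} \<in> events"
    and "prob {\<omega> \<in> space M. y \<le> real (\<Sum>m\<in>{1..n}. offers Z \<omega> i R m choose k)}
      \<le> n * real (R choose k) / n ^ k / y"
proof -
  define \<S> where "\<S> = {S. S \<subseteq> {0<..R} \<and> card S = k}"
  define E where "E = (\<lambda>m S. {\<omega> \<in> space M. \<forall>(i, r)\<in>{i} \<times> S. Z i r \<omega> = m})"
  have fin: "finite \<S>" unfolding \<S>_def by simp
  have E: "E m S \<in> events" "m \<in> {1..n} \<Longrightarrow> prob (E m S) = 1 / n ^ k" if "S \<in> \<S>" for m S
  proof -
    have S: "finite S" "{i} \<times> S \<subseteq> {1..d} \<times> {1..}" "card S = k"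
      using that i by (auto simp: \<S>_def intro: finite_subset)
    show "E m S \<in> events"
      unfolding E_def by (rule cylinder_event) (use S in auto)
    show "prob (E m S) = 1 / n ^ k" if "m \<in> {1..n}"
      unfolding E_def using S that
      by (subst prob_cylinder) (auto simp: card_cartesian_product_singleton)
  qed
  \<comment> \<open>The binomial coefficient counts the \<open>k\<close>-sets of pool positions that
    all show \<open>m\<close>. This makes it a sum of indicators of cylinder events, whose
    expectation needs no independence between bins.\<close>
  have choose: "real (\<Sum>m\<in>{1..n}. offers Z \<omega> i R m choose k) = (\<Sum>m\<in>{1..n}. \<Sum>S\<in>\<S>. indicator (E m S) \<omega>)"
    if "\<omega> \<in> space M" for \<omega>
  proof -
    have "offers Z \<omega> i R m choose k = card {S. S \<subseteq> {s \<in> {0<..R}. Z i s \<omega> = m} \<and> card S = k}" for m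
      unfolding offers_def by (subst n_subsets) auto
    moreover have "{S. S \<subseteq> {s \<in> {0<..R}. Z i s \<omega> = m} \<and> card S = k} = {S \<in> \<S>. \<omega> \<in> E m S}" for m
      using that by (auto simp: \<S>_def E_def)
    moreover have "real (card {S \<in> \<S>. \<omega> \<in> E m S}) = (\<Sum>S\<in>\<S>. indicator (E m S) \<omega>)" for m
      using fin by (simp add: indicator_def sum.If_cases Int_def)
    ultimately show ?thesis by simp
  qed
  define X where "X = (\<lambda>\<omega>. \<Sum>m\<in>{1..n}. \<Sum>S\<in>\<S>. indicator (E m S) \<omega> :: real)"
  have int: "integrable M X"
    unfolding X_def by (intro Bochner_Integration.integrable_sum integrable_real_indicator E)
      (auto simp: less_top[symmetric])
  have eq: "{\<omega> \<in> space M. y \<le> real (\<Sum>m\<in>{1..n}. offers Z \<omega> i R m choose k)} = {\<omega> \<in> space M. y \<le> X \<omega>}"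
    unfolding X_def using choose by auto
  show "{\<omega> \<in> space M. y \<le> real (\<Sum>m\<in>{1..n}. offers Z \<omega> i R m choose k)} \<in> events"
    unfolding eq using borel_measurable_integrable[OF int] by measurable
  have "expectation X = (\<Sum>m\<in>{1..n}. \<Sum>S\<in>\<S>. prob (E m S))"
    unfolding X_def using E
    by (subst Bochner_Integration.integral_sum, (auto intro!: Bochner_Integration.integrable_sum simp: less_top[symmetric])[1])
      (auto intro!: sum.cong simp: less_top[symmetric] Bochner_Integration.integral_sum)
  also have "\<dots> = (\<Sum>m\<in>{1..n}. \<Sum>S\<in>\<S>. 1 / n ^ k)"
    by (intro sum.cong refl E) auto
  also have "\<dots> = n * real (R choose k) / n ^ k"
    unfolding \<S>_def by (simp add: n_subsets)
  finally have "expectation X = n * real (R choose k) / n ^ k" .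
  then show "prob {\<omega> \<in> space M. y \<le> real (\<Sum>m\<in>{1..n}. offers Z \<omega> i R m choose k)}
      \<le> n * real (R choose k) / n ^ k / y"
    unfolding eq using integral_Markov_inequality_measure[OF int, of "space M" y] y
    by (auto simp: X_def sum_nonneg)
qed

end

section \<open>Strategies that do not foresee the pools\<close>

text \<open>The offset 2 leaves out the element of pool 1 that is drawn for ball \<open>t + 1\<close>: by the time
  the decisions about this ball are made, it belongs to the past.\<close>

definition (in allocation_pools) nonanticipating :: "'a decisions \<Rightarrow> bool" where
  "nonanticipating f \<longleftrightarrow>
     (\<forall>t h. {\<omega> \<in> space M. history d f Z \<omega> t = h} \<in> events) \<and>
     (\<forall>t h i R v. i \<in> {1..d} \<longrightarrow> (\<forall>s<R. v s \<in> {1..n}) \<longrightarrow>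
        prob {\<omega> \<in> space M. history d f Z \<omega> t = h \<and> (\<forall>s<R. Z i (reached h i + 2 + s) \<omega> = v s)}
          = prob {\<omega> \<in> space M. history d f Z \<omega> t = h} / n ^ R)"

text \<open>A ball that stops at level \<open>c\<close> consults one new element of each of the
  pools 1 to \<open>c\<close>, and \<open>reached\<close> of the extended history counts all of
  them. A history is thus determined by the pool prefixes that it has itself used up.\<close>

lemma history_cong_pools:
  assumes "d \<ge> 1" and f: "\<And>t i h m. f t i \<omega> h m = f t i \<omega>' h m"
    and "history d f Z \<omega> t = h"
    and "\<And>i r. i \<in> {1..d} \<Longrightarrow> r \<in> {1..reached h i} \<Longrightarrow> Z i r \<omega> = Z i r \<omega>'"
  shows "history d f Z \<omega>' t = h"
  using assms(3,4)
proof (induction t arbitrary: h)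
  case 0
  then show ?case by simp
next
  case (Suc t)
  let ?h = "history d f Z \<omega> t"
  let ?c = "next_level d f Z \<omega> ?h"
  have h: "h = ?h @ [(?c, suggested Z \<omega> ?h ?c)]"
    using Suc.prems(1) by (simp add: history_Suc)
  have IH: "history d f Z \<omega>' t = ?h"
    by (rule Suc.IH[OF refl], rule Suc.prems(2)) (auto simp: h)
  have c: "1 \<le> ?c" "?c \<le> d"
    using next_level_ge_1[OF assms(1)] next_level_le[OF assms(1)] by auto
  \<comment> \<open>Beyond level \<open>?c\<close> the suggestions at the two sample points may
    differ, but they are never consulted.\<close>
  have eq: "suggested Z \<omega> ?h i = suggested Z \<omega>' ?h i" if "i \<in> {1..?c}" for i
    unfolding suggested_def by (rule Suc.prems(2)) (use that c in \<open>auto simp: h\<close>)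
  have "next_level d f Z \<omega>' ?h = ?c"
    unfolding next_level_def[of d f Z \<omega>']
  proof (rule Least_equality)
    show "?c \<in> {1..d} \<and> (?c = d \<or> \<not> f (Suc (length ?h)) ?c \<omega>' ?h (suggested Z \<omega>' ?h ?c))"
      using c next_level_accepts[OF assms(1), of f Z \<omega> ?h] eq[of ?c] f by auto
    show "?c \<le> i" if "i \<in> {1..d} \<and> (i = d \<or> \<not> f (Suc (length ?h)) i \<omega>' ?h (suggested Z \<omega>' ?h i))" for i
    proof (rule ccontr)
      assume "\<not> ?c \<le> i"
      then have "i < ?c" by simp
      with that c next_level_rejects[of i d f Z \<omega> ?h] eq[of i] f assms(1) show False by auto
    qed
  qed
  with IH eq[of ?c] c h show ?case by (simp add: history_Suc)
qed

context allocation_pools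
begin

text \<open>By \<open>history_cong_pools\<close> the event of a given history is a finite disjoint
  union of cylinders over the positions it has used. The future block lies outside these positions,
  so intersecting with it multiplies the probability of each cylinder by
  \<open>1 / n ^ R\<close>.\<close>

lemma nonanticipating_deterministic:
  assumes d: "d \<ge> 1" and f: "\<And>t i \<omega> \<omega>' h m. f t i \<omega> h m = f t i \<omega>' h m"
  shows "nonanticipating f"
proof -
  \<comment> \<open>The contents of the used positions that lead to \<open>h\<close>. One sample
    point with this history suffices as witness, since all sample points with these contents share
    it.\<close>
  define V where "V = (\<lambda>t h. {v \<in> (SIGMA i:{1..d}. {1..reached h i}) \<rightarrow>\<^sub>E {1..n}.
    \<exists>\<omega>\<in>space M. history d f Z \<omega> t = h \<and> (\<forall>(i, r)\<in>(SIGMA i:{1..d}. {1..reached h i}). Z i r \<omega> = v (i, r))})"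
  define J where "J = (\<lambda>h. SIGMA i:{1..d}. {1..reached h i})"
  have finJ: "finite (J h)" and subJ: "J h \<subseteq> {1..d} \<times> {1..}" for h by (auto simp: J_def)
  have finV: "finite (V t h)" for t h
    unfolding V_def by (rule finite_subset[of _ "J h \<rightarrow>\<^sub>E {1..n}"]) (auto simp: J_def intro!: finite_PiE)
  have hist: "{\<omega> \<in> space M. history d f Z \<omega> t = h} =
      (\<Union>v\<in>V t h. {\<omega> \<in> space M. \<forall>(i, r)\<in>J h. Z i r \<omega> = v (i, r)})" (is "?L = ?R") for t h
  proof (intro equalityI subsetI)
    fix \<omega> assume *: "\<omega> \<in> ?L"
    let ?v = "restrict (\<lambda>(i, r). Z i r \<omega>) (J h)"
    have "?v \<in> J h \<rightarrow>\<^sub>E {1..n}"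
    proof (rule restrict_PiE_iff[THEN iffD2], safe)
      fix i r assume "(i, r) \<in> J h"
      then show "Z i r \<omega> \<in> {1..n}" using * pool_in[of i r \<omega>] by (auto simp: J_def)
    qed
    with * have "?v \<in> V t h" by (auto simp: V_def J_def intro!: bexI[of _ \<omega>])
    then show "\<omega> \<in> ?R" using * by (intro UN_I[of ?v]) auto
  next
    fix \<omega> assume "\<omega> \<in> ?R"
    then obtain v \<omega>' where *: "\<omega> \<in> space M" "\<And>i r. (i, r) \<in> J h \<Longrightarrow> Z i r \<omega> = v (i, r)"
      "history d f Z \<omega>' t = h" "\<And>i r. (i, r) \<in> J h \<Longrightarrow> Z i r \<omega>' = v (i, r)"
      by (fastforce simp: V_def J_def)
    have "history d f Z \<omega> t = h"
      by (rule history_cong_pools[OF d f *(3)]) (use *(2,4) in \<open>auto simp: J_def\<close>)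
    with * show "\<omega> \<in> ?L" by simp
  qed
  have disj: "disjoint_family_on (\<lambda>v. {\<omega> \<in> space M. \<forall>(i, r)\<in>J h. Z i r \<omega> = v (i, r)}) (V t h)" for t h
  proof (unfold disjoint_family_on_def, safe)
    fix v v' \<omega> assume "v \<in> V t h" "v' \<in> V t h" "v \<noteq> v'"
      and *: "\<forall>(i, r)\<in>J h. Z i r \<omega> = v (i, r)" "\<forall>(i, r)\<in>J h. Z i r \<omega> = v' (i, r)"
    then have "v \<in> J h \<rightarrow>\<^sub>E {1..n}" "v' \<in> J h \<rightarrow>\<^sub>E {1..n}" by (auto simp: V_def J_def)
    then have "v = v'"
    proof (rule PiE_ext)
      show "v p = v' p" if "p \<in> J h" for p
        using * that by (cases p) fastforce
    qed
    with \<open>v \<noteq> v'\<close> show "\<omega> \<in> {}" by simp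
  qed
  have ev: "{\<omega> \<in> space M. history d f Z \<omega> t = h} \<in> events" for t h
    unfolding hist by (intro sets.finite_UN finV cylinder_event finJ subJ)
  have V_in: "v p \<in> {1..n}" if "v \<in> V t h" "p \<in> J h" for v t h p
    using that by (auto simp: V_def J_def)
  have "prob {\<omega> \<in> space M. history d f Z \<omega> t = h \<and> (\<forall>s<R. Z i (reached h i + 2 + s) \<omega> = u s)}
          = prob {\<omega> \<in> space M. history d f Z \<omega> t = h} / n ^ R" (is "prob ?A = _")
    if i: "i \<in> {1..d}" and u: "\<forall>s<R. u s \<in> {1..n}" for t h i R u
  proof -
    \<comment> \<open>The positions of the future block; \<open>w\<close> prescribes the values on
      both parts at once.\<close>
    define K where "K = {i} \<times> {reached h i + 2..<reached h i + 2 + R}"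
    define w where "w = (\<lambda>v p. if p \<in> J h then v p else u (snd p - (reached h i + 2)) :: nat)"
    have JK: "J h \<inter> K = {}" and K: "finite K" "K \<subseteq> {1..d} \<times> {1..}" "card K = R"
      using i by (auto simp: J_def K_def card_cartesian_product_singleton)
    have eq: "(\<forall>(j, r)\<in>J h \<union> K. Z j r \<omega> = w v (j, r)) \<longleftrightarrow>
        (\<forall>(j, r)\<in>J h. Z j r \<omega> = v (j, r)) \<and> (\<forall>s<R. Z i (reached h i + 2 + s) \<omega> = u s)" for v \<omega>
    proof -
      have "(\<forall>p\<in>K. Z (fst p) (snd p) \<omega> = w v p) \<longleftrightarrow> (\<forall>s<R. Z i (reached h i + 2 + s) \<omega> = u s)"
      proof safe
        fix s assume *: "\<forall>p\<in>K. Z (fst p) (snd p) \<omega> = w v p" "s < R"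
        then have "(i, reached h i + 2 + s) \<in> K" by (auto simp: K_def)
        with *(1) JK show "Z i (reached h i + 2 + s) \<omega> = u s" by (fastforce simp: w_def)
      next
        fix j r assume *: "\<forall>s<R. Z i (reached h i + 2 + s) \<omega> = u s" "(j, r) \<in> K"
        then have "j = i" "r = reached h i + 2 + (r - (reached h i + 2))" "r - (reached h i + 2) < R"
          by (auto simp: K_def)
        with * JK show "Z (fst (j, r)) (snd (j, r)) \<omega> = w v (j, r)"
          unfolding w_def by (metis (no_types, lifting) IntI empty_iff fst_conv snd_conv)
      qed
      moreover have "(\<forall>p\<in>J h. Z (fst p) (snd p) \<omega> = w v p) \<longleftrightarrow> (\<forall>p\<in>J h. Z (fst p) (snd p) \<omega> = v p)"
        by (auto simp: w_def)
      ultimately show ?thesis by (simp add: case_prod_beta ball_Un)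
    qed
    have "?A = {\<omega> \<in> space M. history d f Z \<omega> t = h} \<inter> {\<omega> \<in> space M. \<forall>s<R. Z i (reached h i + 2 + s) \<omega> = u s}"
      by auto
    also have "\<dots> = (\<Union>v\<in>V t h. {\<omega> \<in> space M. \<forall>(j, r)\<in>J h \<union> K. Z j r \<omega> = w v (j, r)})"
      unfolding hist eq by auto
    also have "prob \<dots> = (\<Sum>v\<in>V t h. prob {\<omega> \<in> space M. \<forall>(j, r)\<in>J h \<union> K. Z j r \<omega> = w v (j, r)})"
    proof (rule finite_measure_finite_Union[OF finV])
      show "(\<lambda>v. {\<omega> \<in> space M. \<forall>(j, r)\<in>J h \<union> K. Z j r \<omega> = w v (j, r)}) ` V t h \<subseteq> events"
        by (intro image_subsetI cylinder_event finite_UnI Un_least finJ subJ K)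
      show "disjoint_family_on (\<lambda>v. {\<omega> \<in> space M. \<forall>(j, r)\<in>J h \<union> K. Z j r \<omega> = w v (j, r)}) (V t h)"
        by (rule disjoint_family_on_bisimulation[OF disj]) (unfold eq, auto)
    qed
    also have "\<dots> = (\<Sum>v\<in>V t h. 1 / n ^ (card (J h) + R))"
    proof (rule sum.cong[OF refl])
      fix v assume v: "v \<in> V t h"
      have "w v p \<in> {1..n}" if "p \<in> J h \<union> K" for p
        using that V_in[OF v] u JK by (fastforce simp: w_def K_def)
      then show "prob {\<omega> \<in> space M. \<forall>(j, r)\<in>J h \<union> K. Z j r \<omega> = w v (j, r)} = 1 / n ^ (card (J h) + R)"
        using finJ subJ K JK by (subst prob_cylinder) (auto simp: card_Un_disjoint)
    qed
    also have "\<dots> = (\<Sum>v\<in>V t h. prob {\<omega> \<in> space M. \<forall>(j, r)\<in>J h. Z j r \<omega> = v (j, r)}) / n ^ R"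
      unfolding sum_divide_distrib
      by (intro sum.cong refl) (subst prob_cylinder[OF finJ subJ], auto simp: power_add dest: V_in)
    also have "(\<Sum>v\<in>V t h. prob {\<omega> \<in> space M. \<forall>(j, r)\<in>J h. Z j r \<omega> = v (j, r)}) =
        prob {\<omega> \<in> space M. history d f Z \<omega> t = h}"
      unfolding hist
      by (rule finite_measure_finite_Union[symmetric, OF finV _ disj])
        (intro image_subsetI cylinder_event finJ subJ)
    finally show ?thesis .
  qed
  with ev show ?thesis unfolding nonanticipating_def by blast
qed

text \<open>With a single level no decision is ever made, so every strategy has the history of a
  deterministic one, for which nonanticipation is already known.\<close>

lemma history_1_cong:
  "d = 1 \<Longrightarrow> history d f Z \<omega> t = history d g Z \<omega> t"
proof (induction t)
  case (Suc t)
  then have "next_level d f Z \<omega> h = next_level d g Z \<omega> h" for h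
    using next_level_ge_1[of d f] next_level_le[of d f] next_level_ge_1[of d g] next_level_le[of d g]
    by (metis le_antisym order_refl)
  with Suc show ?case by (simp add: history_Suc)
qed simp

end

section \<open>Nonanticipation of general thinning strategies\<close>

definition histories :: "nat \<Rightarrow> nat \<Rightarrow> nat \<Rightarrow> (nat \<times> nat) list set" where
  "histories n d t = {h. set h \<subseteq> {1..d} \<times> {1..n} \<and> length h = t}"

lemma finite_histories: "finite (histories n d t)"
  unfolding histories_def by (rule finite_lists_length_eq) auto

lemma (in allocation_pools) history_in_histories:
  assumes "d \<ge> 1" "\<omega> \<in> space M"
  shows "history d f Z \<omega> t \<in> histories n d t"
proof (induction t)
  case 0
  show ?case by (simp add: histories_def)
next
  case (Suc t)
  have c: "next_level d f Z \<omega> (history d f Z \<omega> t) \<in> {1..d}"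
    by (simp add: next_level_ge_1[OF assms(1), simplified] next_level_le[OF assms(1)])
  moreover have "suggested Z \<omega> (history d f Z \<omega> t) (next_level d f Z \<omega> (history d f Z \<omega> t)) \<in> {1..n}"
    unfolding suggested_def using c assms(2) by (intro pool_in) auto
  ultimately show ?case using Suc by (simp add: histories_def history_Suc)
qed

lemma sigma_algebra_past_events: "sigma_algebra (space M) (past_events M n d f Z t i)"
  unfolding past_events_def by (rule sigma_algebra_sigma_sets) auto

lemma sigma_algebra_future_events: "sigma_algebra (space M) (future_events M n d f Z t i)"
  unfolding future_events_def by (rule sigma_algebra_sigma_sets) auto

lemma history_in_past_events:
  "{\<omega> \<in> space M. history d f Z \<omega> t = h} \<in> past_events M n d f Z (Suc t) i"
  unfolding past_events_def by (rule sigma_sets.Basic) auto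

lemma cylinder_in_future_events:
  assumes "finite S" "S \<subseteq> {1..}" "j \<in> {1..d}" "\<And>s. s \<in> S \<Longrightarrow> v s \<in> {1..n}"
  shows "{\<omega> \<in> space M. \<forall>s\<in>S. Z j (drawn d f Z t i j \<omega> + s) \<omega> = v s} \<in> future_events M n d f Z t i"
proof -
  interpret F: sigma_algebra "space M" "future_events M n d f Z t i"
    by (rule sigma_algebra_future_events)
  have "{\<omega> \<in> space M. Z j (drawn d f Z t i j \<omega> + s) \<omega> = v s} \<in> future_events M n d f Z t i"
    if "s \<in> S" for s
    unfolding future_events_def
    by (rule sigma_sets.Basic, unfold mem_Collect_eq,
        rule exI[of _ j], rule exI[of _ s], rule exI[of _ "v s"])
      (use assms that in auto)
  then show ?thesis
    using \<open>finite S\<close> by (intro F.sets_Collect_finite_All)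
qed

text \<open>When ball \<open>t + 1\<close> is decided upon at level \<open>i\<close>, its history,
  its current offer and the decision function are all known. The event is split according to the
  finitely many histories and offers, since \<open>past_events\<close> provides decisions only for
  fixed arguments.\<close>

lemma (in allocation_pools) rejection_in_past_events:
  assumes "1 \<le> i" "i < d"
  shows "{\<omega> \<in> space M. Suc i \<le> next_level d f Z \<omega> (history d f Z \<omega> t)}
    \<in> past_events M n d f Z (Suc t) i"
proof -
  interpret P: sigma_algebra "space M" "past_events M n d f Z (Suc t) i"
    by (rule sigma_algebra_past_events)
  have d: "d \<ge> 1" using assms by simp
  \<comment> \<open>The middle event says that the next element of pool \<open>i\<close> has been
    drawn, that is, the ball gets as far as level \<open>i\<close>, and that it shows
    \<open>m\<close>.\<close>
  define G where "G = (\<lambda>h m. {\<omega> \<in> space M. history d f Z \<omega> t = h} \<inter>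
    {\<omega> \<in> space M. Suc (reached h i) \<le> drawn d f Z (Suc t) i i \<omega> \<and> Z i (Suc (reached h i)) \<omega> = m} \<inter>
    {\<omega> \<in> space M. f (Suc t) i \<omega> h m})"
  have "G h m \<in> past_events M n d f Z (Suc t) i" if "h \<in> histories n d t" "m \<in> {1..n}" for h m
  proof -
    have "{\<omega> \<in> space M. Suc (reached h i) \<le> drawn d f Z (Suc t) i i \<omega> \<and> Z i (Suc (reached h i)) \<omega> = m}
        \<in> past_events M n d f Z (Suc t) i"
      unfolding past_events_def
      by (rule sigma_sets.Basic, rule UnI2, unfold mem_Collect_eq,
          rule exI[of _ i], rule exI[of _ "Suc (reached h i)"], rule exI[of _ m])
        (use assms that in simp)
    moreover have "{\<omega> \<in> space M. f (Suc t) i \<omega> h m} \<in> past_events M n d f Z (Suc t) i"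
      unfolding past_events_def
      by (rule sigma_sets.Basic, rule UnI1, rule UnI1, unfold mem_Collect_eq,
          rule exI[of _ h], rule exI[of _ m])
        (use that in \<open>simp add: histories_def\<close>)
    ultimately show ?thesis
      unfolding G_def by (intro P.Int history_in_past_events)
  qed
  then have "(\<Union>h\<in>histories n d t. \<Union>m\<in>{1..n}. G h m) \<in> past_events M n d f Z (Suc t) i"
    by (intro P.finite_UN finite_histories finite_atLeastAtMost) auto
  also have "(\<Union>h\<in>histories n d t. \<Union>m\<in>{1..n}. G h m) =
      {\<omega> \<in> space M. Suc i \<le> next_level d f Z \<omega> (history d f Z \<omega> t)}"
  proof -
    have "(\<exists>h\<in>histories n d t. \<exists>m\<in>{1..n}. \<omega> \<in> G h m) \<longleftrightarrow>
        Suc i \<le> next_level d f Z \<omega> (history d f Z \<omega> t)" if \<omega>: "\<omega> \<in> space M" for \<omega>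
    proof -
      let ?h = "history d f Z \<omega> t"
      have "Z i (Suc (reached ?h i)) \<omega> \<in> {1..n}"
        using assms \<omega> by (intro pool_in) auto
      moreover have "\<omega> \<in> G h m \<longleftrightarrow> h = ?h \<and> i \<le> next_level d f Z \<omega> ?h \<and>
          m = suggested Z \<omega> ?h i \<and> f (Suc t) i \<omega> h m" for h m
        using \<omega> by (cases "h = ?h") (auto simp: G_def drawn_def suggested_def reached_history_Suc)
      ultimately have "(\<exists>h\<in>histories n d t. \<exists>m\<in>{1..n}. \<omega> \<in> G h m) \<longleftrightarrow>
          i \<le> next_level d f Z \<omega> ?h \<and> f (Suc t) i \<omega> ?h (suggested Z \<omega> ?h i)"
        using history_in_histories[OF d \<omega>, of f t] by (auto simp: suggested_def)
      then show ?thesis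
        using Suc_le_next_level_iff[OF assms, of f Z \<omega> ?h] by simp
    qed
    note eq = this
    have "\<omega> \<in> space M" if "\<omega> \<in> G h m" for \<omega> h m
      using that by (simp add: G_def)
    then show ?thesis
      using eq by (intro set_eqI) (simp only: UN_iff mem_Collect_eq, metis)
  qed
  finally show ?thesis .
qed

context allocation_pools
begin

text \<open>The starting position is random and could bias the elements behind it. It does not:
  whether ball \<open>t + 1\<close> draws from pool \<open>i\<close> is settled at level
  \<open>i - 1\<close>, before the draw, so this event is independent of what lies behind the
  current position. Whether the position moves or stays, the elements remain uniform.\<close>

lemma prob_future_pool:
  assumes f: "thinning_strategy M n d Z f" and i: "1 < i" "i \<le> d"
    and "finite S" "S \<subseteq> {1..}" "\<And>s. s \<in> S \<Longrightarrow> v s \<in> {1..n}"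
  shows "prob {\<omega> \<in> space M. \<forall>s\<in>S. Z i (reached (history d f Z \<omega> t) i + s) \<omega> = v s} = 1 / n ^ card S"
  using assms(4-6)
proof (induction t arbitrary: S v)
  case 0
  have "prob {\<omega> \<in> space M. \<forall>(j, s)\<in>{i} \<times> S. Z j s \<omega> = v (snd (j, s))} = 1 / n ^ card ({i} \<times> S)"
    by (rule prob_cylinder) (use 0 i in auto)
  then show ?case by (simp add: card_cartesian_product_singleton)
next
  case (Suc t)
  define B where "B = {\<omega> \<in> space M. i \<le> next_level d f Z \<omega> (history d f Z \<omega> t)}"
  define C where "C = (\<lambda>S v. {\<omega> \<in> space M. \<forall>s\<in>S. Z i (reached (history d f Z \<omega> t) i + s) \<omega> = v s})"
  have ind: "indep_set (past_events M n d f Z (Suc t) (i - 1)) (future_events M n d f Z (Suc t) (i - 1))"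
    by (rule f[unfolded thinning_strategy_def, rule_format]) (use i in auto)
  have B: "B \<in> past_events M n d f Z (Suc t) (i - 1)"
    using rejection_in_past_events[of "i - 1" f t] i by (simp add: B_def)
  interpret P: sigma_algebra "space M" "past_events M n d f Z (Suc t) (i - 1)"
    by (rule sigma_algebra_past_events)
  have B': "space M - B \<in> past_events M n d f Z (Suc t) (i - 1)"
    by (rule P.compl_sets[OF B])
  have C: "C S v \<in> future_events M n d f Z (Suc t) (i - 1)"
    if "finite S" "S \<subseteq> {1..}" "\<And>s. s \<in> S \<Longrightarrow> v s \<in> {1..n}" for S v
  proof -
    have "\<not> i \<le> i - 1" using i by simp
    then show ?thesis
      using cylinder_in_future_events[where M = M and f = f and Z = Z and t = "Suc t" and i = "i - 1"
          and j = i and d = d and v = v and n = n, OF that(1,2)] that i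
      by (simp add: C_def drawn_def del: One_nat_def)
  qed
  have "prob (D \<inter> C S v) = prob D / n ^ card S"
    if D: "D \<in> past_events M n d f Z (Suc t) (i - 1)"
      and "finite S" "S \<subseteq> {1..}" "\<And>s. s \<in> S \<Longrightarrow> v s \<in> {1..n}" for D S v
    using indep_setD[OF ind D C[OF that(2-4)]] Suc.IH[OF that(2-4)] by (simp add: C_def)
  note indep = this
  \<comment> \<open>If the ball draws from pool \<open>i\<close>, the position advances by one, so
    relative to the old position the prescribed pattern is shifted by one.\<close>
  define S' v' where "S' = Suc ` S" and "v' = (\<lambda>s. v (s - 1) :: nat)"
  have S': "finite S'" "S' \<subseteq> {1..}" "\<And>s. s \<in> S' \<Longrightarrow> v' s \<in> {1..n}" "card S' = card S"
    using Suc.prems by (auto simp: S'_def v'_def card_image)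
  have ev: "B \<inter> C S' v' \<in> events" "(space M - B) \<inter> C S v \<in> events"
    by (intro sets.Int subsetD[OF indep_setD_ev1[OF ind] B] subsetD[OF indep_setD_ev1[OF ind] B']
        subsetD[OF indep_setD_ev2[OF ind]] C S'(1-3) Suc.prems; assumption)+
  have "{\<omega> \<in> space M. \<forall>s\<in>S. Z i (reached (history d f Z \<omega> (Suc t)) i + s) \<omega> = v s} =
      (B \<inter> C S' v') \<union> ((space M - B) \<inter> C S v)"
    by (auto simp: B_def C_def S'_def v'_def reached_history_Suc split: if_splits)
  also have "prob \<dots> = prob (B \<inter> C S' v') + prob ((space M - B) \<inter> C S v)"
    using ev by (intro finite_measure_Union) auto
  also have "\<dots> = (prob B + prob (space M - B)) / n ^ card S"
    using indep[OF B S'(1-3)] indep[OF B' Suc.prems] S'(4) by (simp add: add_divide_distrib)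
  also have "prob B + prob (space M - B) = 1"
    using indep_setD_ev1[OF ind] B prob_compl[of B] by auto
  finally show ?case .
qed

text \<open>The hypothesis speaks only at decisions, so the history of \<open>t\<close> balls is
  separated from the future at the first decision about ball \<open>t + 1\<close>. Independence
  factors the probability; the future block is uniform by \<open>prob_future_pool\<close>, or, in
  pool 1, because its position is deterministic.\<close>

lemma nonanticipating_thinning:
  assumes f: "thinning_strategy M n d Z f" and d: "d \<ge> 2"
  shows "nonanticipating f"
  unfolding nonanticipating_def
proof (intro conjI allI impI)
  have ind: "indep_set (past_events M n d f Z (Suc t) 1) (future_events M n d f Z (Suc t) 1)" for t
    using f d unfolding thinning_strategy_def by auto
  show "{\<omega> \<in> space M. history d f Z \<omega> t = h} \<in> events" for t h
    using indep_setD_ev1[OF ind] history_in_past_events[of M d f Z t h n 1] by blast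
  fix t h i R and v :: "nat \<Rightarrow> nat"
  assume i: "i \<in> {1..d}" and v: "\<forall>s<R. v s \<in> {1..n}"
  define S where "S = {2..<R + 2}"
  define w where "w = (\<lambda>s. v (s - 2))"
  have S: "finite S" "S \<subseteq> {1..}" "\<And>s. s \<in> S \<Longrightarrow> w s \<in> {1..n}" "card S = R"
    using v by (auto simp: S_def w_def)
  have S_iff: "(\<forall>s\<in>S. Z i (r + s) \<omega> = w s) \<longleftrightarrow> (\<forall>s<R. Z i (r + 2 + s) \<omega> = v s)" for r \<omega>
  proof safe
    fix s assume "\<forall>s\<in>S. Z i (r + s) \<omega> = w s" "s < R"
    then show "Z i (r + 2 + s) \<omega> = v s"
      by (auto simp: S_def w_def dest!: bspec[of _ _ "s + 2"] simp: ac_simps)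
  next
    fix s assume *: "\<forall>s<R. Z i (r + 2 + s) \<omega> = v s" "s \<in> S"
    then have "s = 2 + (s - 2)" "s - 2 < R" by (auto simp: S_def)
    with *(1) show "Z i (r + s) \<omega> = w s" by (metis add.assoc w_def)
  qed
  define C where "C = {\<omega> \<in> space M. \<forall>s\<in>S. Z i (reached (history d f Z \<omega> t) i + s) \<omega> = w s}"
  have "C \<in> future_events M n d f Z (Suc t) 1 \<and> prob C = 1 / n ^ R"
  proof (cases "i = 1")
    case True
    \<comment> \<open>Pool 1 has by now lost \<open>t + 1\<close> elements, so the offsets drop by
      one; they started at 2 and stay positive.\<close>
    define S' w' where "S' = (\<lambda>s. s - 1) ` S" and "w' = (\<lambda>s. w (Suc s))"
    have S': "finite S'" "S' \<subseteq> {1..}" "\<And>s. s \<in> S' \<Longrightarrow> w' s \<in> {1..n}"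
      using S v by (auto simp: S'_def w'_def w_def S_def)
    have "C = {\<omega> \<in> space M. \<forall>s\<in>S'. Z i (drawn d f Z (Suc t) 1 i \<omega> + s) \<omega> = w' s}"
      using d by (auto simp: C_def S'_def w'_def drawn_def True S_def)
    then have "C \<in> future_events M n d f Z (Suc t) 1"
      using cylinder_in_future_events[OF S'(1,2) i S'(3)] by simp
    moreover have "C = {\<omega> \<in> space M. \<forall>(j, s)\<in>{1} \<times> (+) t ` S. Z j s \<omega> = w (snd (j, s) - t)}"
      using d by (auto simp: C_def True)
    moreover have "prob \<dots> = 1 / n ^ card ({1::nat} \<times> (+) t ` S)"
      by (rule prob_cylinder) (use S d in auto)
    ultimately show ?thesis
      using S by (simp add: card_cartesian_product_singleton card_image)
  next
    case False
    then have "prob C = 1 / n ^ R"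
      unfolding C_def using prob_future_pool[where i = i and t = t, OF f _ _ S(1-3)] S(4) i by auto
    moreover have "C \<in> future_events M n d f Z (Suc t) 1"
      using cylinder_in_future_events[where M = M and f = f and Z = Z and t = "Suc t" and i = 1, OF S(1,2) i S(3)] False i
      by (simp add: C_def drawn_def)
    ultimately show ?thesis by simp
  qed
  then have "prob ({\<omega> \<in> space M. history d f Z \<omega> t = h} \<inter> C) =
      prob {\<omega> \<in> space M. history d f Z \<omega> t = h} / n ^ R"
    using indep_setD[OF ind history_in_past_events] by simp
  moreover have "{\<omega> \<in> space M. history d f Z \<omega> t = h} \<inter> C =
    {\<omega> \<in> space M. history d f Z \<omega> t = h \<and> (\<forall>s<R. Z i (reached h i + 2 + s) \<omega> = v s)}"
    by (auto simp: C_def S_iff)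
  ultimately show "prob {\<omega> \<in> space M. history d f Z \<omega> t = h \<and> (\<forall>s<R. Z i (reached h i + 2 + s) \<omega> = v s)} =
      prob {\<omega> \<in> space M. history d f Z \<omega> t = h} / n ^ R" by simp
qed

end

section \<open>Bins hit in every one of several rounds\<close>

text \<open>The probability that \<open>u\<close> uniform offers hit a given bin. Asking for a hit
  in each of \<open>x\<close> rounds instead of \<open>x\<close> hits in total yields products over
  rounds, which makes the first two moments elementary.\<close>

definition hit_prob :: "nat \<Rightarrow> nat \<Rightarrow> real" where
  "hit_prob n u = 1 - (1 - 1 / real n) ^ u"

lemma hit_prob_nonneg: "n \<ge> 1 \<Longrightarrow> 0 \<le> hit_prob n u"
  by (simp add: hit_prob_def power_le_one)

text \<open>The lost factor 2 is harmless: it costs \<open>ln 2\<close> per round in the exponent,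
  which is small against \<open>ln l\<close>.\<close>

lemma hit_prob_ge:
  assumes "n \<ge> 1" "u \<le> n"
  shows "real u / (2 * real n) \<le> hit_prob n u"
proof -
  have n: "real n > 0" using assms by simp
  define y where "y = real u / real n"
  have y: "0 \<le> y" "y \<le> 1" using assms by (auto simp: y_def divide_simps)
  have "(1 - 1 / real n) ^ u \<le> exp (- 1 / real n) ^ u"
    using exp_ge_add_one_self[of "- 1 / real n"] n assms(1)
    by (intro power_mono) (auto simp: divide_simps)
  also have "\<dots> = exp (- y)"
    by (simp add: y_def exp_of_nat_mult[symmetric])
  also have "\<dots> \<le> 1 / (1 + y)"
    using exp_ge_add_one_self[of y] y by (simp add: exp_minus field_simps)
  also have "\<dots> \<le> 1 - y / 2"
  proof -
    have "y * y \<le> y * 1" using y by (intro mult_left_mono) auto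
    then show ?thesis using y by (simp add: field_simps)
  qed
  finally show ?thesis by (simp add: hit_prob_def y_def)
qed

text \<open>Inclusion-exclusion over the functions \<open>F S\<close> that avoid the bins in
  \<open>S\<close>. Negative correlation comes down to
  \<open>(n - 2) n \<le> (n - 1)^2\<close>.\<close>

lemma
  fixes n m u :: nat
  assumes "n \<ge> 1" "m \<in> {1..n}"
  defines "H \<equiv> \<lambda>m. {v \<in> {..<u} \<rightarrow>\<^sub>E {1..n}. \<exists>s<u. v s = m}"
  shows card_hit: "real (card (H m)) = hit_prob n u * real n ^ u"
    and card_hit_both: "m' \<in> {1..n} \<Longrightarrow> m \<noteq> m' \<Longrightarrow>
      real (card (H m \<inter> H m')) \<le> (hit_prob n u)\<^sup>2 * real n ^ u"
proof -
  define F where "F = (\<lambda>S. {..<u} \<rightarrow>\<^sub>E ({1..n} - S) :: (nat \<Rightarrow> nat) set)"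
  have fin: "finite (F S)" for S unfolding F_def by (intro finite_PiE) auto
  have card_F: "card (F S) = card ({1..n} - S) ^ u" for S
    unfolding F_def by (simp add: card_PiE)
  have H: "H m = F {} - F {m}" for m
    by (rule set_eqI, unfold H_def F_def Diff_empty Diff_iff mem_Collect_eq PiE_iff) blast
  have sub: "F S \<subseteq> F {}" for S
    unfolding F_def by (intro PiE_mono) auto
  have n1: "1 - 1 / real n = (real n - 1) / real n" using assms(1) by (simp add: field_simps)
  have p1: "(1 - 1 / real n) ^ u * real n ^ u = (real n - 1) ^ u"
    using assms(1) unfolding n1 by (simp add: power_divide)
  have card1: "real (card (F {m})) = (real n - 1) ^ u" if "m \<in> {1..n}" for m
    using that assms(1) by (simp add: card_F of_nat_diff)
  have "real (card (H m)) = real n ^ u - (real n - 1) ^ u"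
    unfolding H using card1[OF assms(2)] card_mono[OF fin sub[of "{m}"]]
    by (simp add: card_Diff_subset[OF fin sub] of_nat_diff card_F[of "{}"])
  then show "real (card (H m)) = hit_prob n u * real n ^ u"
    by (simp add: hit_prob_def left_diff_distrib p1)
  assume m': "m' \<in> {1..n}" "m \<noteq> m'"
  then have n2: "n \<ge> 2" using assms(2) by auto
  have cap: "F {m} \<inter> F {m'} = F {m, m'}" by (auto simp: F_def PiE_iff)
  have card2: "real (card (F {m, m'})) = (real n - 2) ^ u"
    using m' assms(2) n2 by (simp add: card_F of_nat_diff)
  have "H m \<inter> H m' = F {} - (F {m} \<union> F {m'})" unfolding H by auto
  then have "real (card (H m \<inter> H m')) = real (card (F {})) - real (card (F {m} \<union> F {m'}))"
    using fin sub card_mono[OF fin, of "F {m} \<union> F {m'}" "{}"]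
    by (simp add: card_Diff_subset of_nat_diff)
  also have "real (card (F {m} \<union> F {m'})) = 2 * (real n - 1) ^ u - (real n - 2) ^ u"
    using card_Un_Int[OF fin fin, of "{m}" "{m'}"] card1[OF assms(2)] card1[OF m'(1)] card2
    unfolding cap by linarith
  also have "real (card (F {})) - (2 * (real n - 1) ^ u - (real n - 2) ^ u) =
      real n ^ u - 2 * (real n - 1) ^ u + (real n - 2) ^ u"
    by (simp add: card_F)
  finally have eq: "real (card (H m \<inter> H m')) = real n ^ u - 2 * (real n - 1) ^ u + (real n - 2) ^ u" .
  have "(real n - 2) ^ u * real n ^ u = ((real n - 2) * real n) ^ u"
    by (simp add: power_mult_distrib)
  also have "\<dots> \<le> ((real n - 1)\<^sup>2) ^ u"
    using n2 by (intro power_mono) (auto simp: power2_eq_square algebra_simps)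
  also have "\<dots> = ((real n - 1) ^ u)\<^sup>2"
    by (simp add: power_mult[symmetric] mult.commute)
  finally have le: "(real n - 2) ^ u \<le> ((real n - 1) ^ u)\<^sup>2 / real n ^ u"
    using assms(1) by (simp add: field_simps)
  have "(hit_prob n u)\<^sup>2 * real n ^ u =
      real n ^ u - 2 * (real n - 1) ^ u + ((real n - 1) ^ u)\<^sup>2 / real n ^ u"
    using assms(1) p1 unfolding hit_prob_def
    by (simp add: power2_eq_square field_simps)
  with eq le show "real (card (H m \<inter> H m')) \<le> (hit_prob n u)\<^sup>2 * real n ^ u" by simp
qed

text \<open>Chebyshev's inequality by counting: the hitting events of different bins are negatively
  correlated, so the variance is at most the mean.\<close>

lemma card_few_hit:
  fixes n u x :: nat
  assumes n: "n \<ge> 1" and A: "A \<subseteq> {1..n}"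
  defines "\<Omega> \<equiv> {..<x} \<rightarrow>\<^sub>E ({..<u} \<rightarrow>\<^sub>E {1..n})"
    and "X \<equiv> \<lambda>w. card {m \<in> A. \<forall>j<x. \<exists>s<u. w j s = m}"
    and "\<mu> \<equiv> real (card A) * hit_prob n u ^ x"
  shows "real (card {w \<in> \<Omega>. 2 * real (X w) < \<mu>}) * \<mu> \<le> 4 * (real n ^ u) ^ x"
proof (cases "\<mu> = 0")
  case False
  have "finite A" using A by (rule finite_subset) simp
  define H where "H = (\<lambda>m. {v \<in> {..<u} \<rightarrow>\<^sub>E {1..n}. \<exists>s<u. v s = m})"
  define I where "I = (\<lambda>m. {..<x} \<rightarrow>\<^sub>E H m)"
  define P where "P = (real n ^ u) ^ x"
  have fin\<Omega>: "finite \<Omega>" unfolding \<Omega>_def by (intro finite_PiE) auto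
  have card\<Omega>: "real (card \<Omega>) = P" by (simp add: \<Omega>_def P_def card_PiE)
  have I_sub: "I m \<subseteq> \<Omega>" for m
    unfolding I_def \<Omega>_def H_def by (intro PiE_mono) auto
  have I_iff: "w \<in> I m \<longleftrightarrow> (\<forall>j<x. \<exists>s<u. w j s = m)" if "w \<in> \<Omega>" for w m
    using that by (auto simp: I_def H_def \<Omega>_def PiE_iff)
  have card1: "real (card (I m)) = hit_prob n u ^ x * P" if "m \<in> A" for m
    using that A card_hit[OF n, of m u] unfolding I_def H_def P_def
    by (auto simp: card_PiE power_mult_distrib)
  have card2: "real (card (I m \<inter> I m')) \<le> (hit_prob n u ^ x)\<^sup>2 * P"
    if "m \<in> A" "m' \<in> A" "m \<noteq> m'" for m m'
  proof -
    have "I m \<inter> I m' = {..<x} \<rightarrow>\<^sub>E (H m \<inter> H m')" unfolding I_def by (rule PiE_Int)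
    then have "real (card (I m \<inter> I m')) = real (card (H m \<inter> H m')) ^ x" by (simp add: card_PiE)
    also have "\<dots> \<le> ((hit_prob n u)\<^sup>2 * real n ^ u) ^ x"
      unfolding H_def by (intro power_mono card_hit_both n) (use that A in auto)
    also have "\<dots> = (hit_prob n u ^ x)\<^sup>2 * P"
      by (simp add: P_def power_mult_distrib power_mult[symmetric] mult.commute)
    finally show ?thesis .
  qed
  have X: "real (X w) = (\<Sum>m\<in>A. indicator (I m) w)" if "w \<in> \<Omega>" for w
    using \<open>finite A\<close> I_iff[OF that] by (simp add: X_def indicator_def sum.If_cases Int_def)
  have sum_ind: "(\<Sum>w\<in>\<Omega>. indicator S w) = real (card S)" if "S \<subseteq> \<Omega>" for S
    using that fin\<Omega> by (simp add: indicator_def sum.If_cases Int_absorb1)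
  have mean: "(\<Sum>w\<in>\<Omega>. real (X w)) = \<mu> * P"
  proof -
    have "(\<Sum>w\<in>\<Omega>. real (X w)) = (\<Sum>m\<in>A. \<Sum>w\<in>\<Omega>. indicator (I m) w)"
      by (subst sum.swap) (simp add: X)
    also have "\<dots> = (\<Sum>m\<in>A. hit_prob n u ^ x * P)"
      by (intro sum.cong refl) (simp add: sum_ind I_sub card1)
    finally show ?thesis by (simp add: \<mu>_def)
  qed
  have P0: "P \<ge> 0" by (simp add: P_def)
  have second: "(\<Sum>w\<in>\<Omega>. (real (X w))\<^sup>2) \<le> \<mu> * P + \<mu>\<^sup>2 * P"
  proof -
    have "(\<Sum>w\<in>\<Omega>. (real (X w))\<^sup>2) = (\<Sum>w\<in>\<Omega>. \<Sum>m\<in>A. \<Sum>m'\<in>A. indicator (I m \<inter> I m') w)"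
      by (intro sum.cong refl) (simp add: X power2_eq_square sum_product indicator_inter_arith)
    also have "\<dots> = (\<Sum>m\<in>A. \<Sum>m'\<in>A. \<Sum>w\<in>\<Omega>. indicator (I m \<inter> I m') w)"
      by (subst sum.swap) (intro sum.cong refl sum.swap)
    also have "\<dots> = (\<Sum>m\<in>A. \<Sum>m'\<in>A. real (card (I m \<inter> I m')))"
      by (intro sum.cong refl sum_ind) (use I_sub in auto)
    also have "\<dots> \<le> (\<Sum>m\<in>A. \<Sum>m'\<in>A. (if m' = m then hit_prob n u ^ x * P else 0) + (hit_prob n u ^ x)\<^sup>2 * P)"
      using card1 card2 P0 by (intro sum_mono) auto
    also have "\<dots> = \<mu> * P + \<mu>\<^sup>2 * P"
      using \<open>finite A\<close> by (simp add: sum.distrib \<mu>_def power2_eq_square algebra_simps)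
    finally show ?thesis .
  qed
  \<comment> \<open>Every bad \<open>w\<close> deviates from the mean by at least half of
    it.\<close>
  have "real (card {w \<in> \<Omega>. 2 * real (X w) < \<mu>}) * (\<mu>\<^sup>2 / 4) = (\<Sum>w\<in>{w \<in> \<Omega>. 2 * real (X w) < \<mu>}. \<mu>\<^sup>2 / 4)"
    by simp
  also have "\<dots> \<le> (\<Sum>w\<in>{w \<in> \<Omega>. 2 * real (X w) < \<mu>}. (\<mu> - real (X w))\<^sup>2)"
  proof (rule sum_mono)
    fix w assume "w \<in> {w \<in> \<Omega>. 2 * real (X w) < \<mu>}"
    then have "\<mu> / 2 \<le> \<mu> - real (X w)" "\<mu> \<ge> 0" by auto
    then have "(\<mu> / 2)\<^sup>2 \<le> (\<mu> - real (X w))\<^sup>2" by (intro power_mono) auto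
    then show "\<mu>\<^sup>2 / 4 \<le> (\<mu> - real (X w))\<^sup>2" by (simp add: power_divide)
  qed
  also have "\<dots> \<le> (\<Sum>w\<in>\<Omega>. (\<mu> - real (X w))\<^sup>2)"
    using fin\<Omega> by (intro sum_mono2) auto
  also have "\<dots> = \<mu>\<^sup>2 * P - 2 * \<mu> * (\<Sum>w\<in>\<Omega>. real (X w)) + (\<Sum>w\<in>\<Omega>. (real (X w))\<^sup>2)"
    using card\<Omega> by (simp add: power2_diff sum.distrib sum_subtractf sum_distrib_left algebra_simps)
  also have "\<dots> \<le> \<mu> * P"
    using second by (simp add: mean power2_eq_square algebra_simps)
  finally have "\<mu> * (real (card {w \<in> \<Omega>. 2 * real (X w) < \<mu>}) * \<mu>) \<le> \<mu> * (4 * P)"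
    by (simp add: power2_eq_square algebra_simps)
  moreover have "\<mu> \<ge> 0"
    by (simp add: \<mu>_def hit_prob_nonneg[OF n])
  with False have "\<mu> > 0" by simp
  ultimately show ?thesis by (simp add: P_def)
qed auto

context allocation_pools
begin

text \<open>Given the history, the set \<open>A h\<close> is fixed and the next \<open>x * u\<close>
  offers are uniform, so the counting bound of \<open>card_few_hit\<close> applies. Demanding at
  least \<open>a\<close> bins makes this bound the same for all histories, which can then be
  summed.\<close>

lemma prob_few_hit:
  fixes u x t :: nat
  assumes f: "nonanticipating f" and i: "i \<in> {1..d}" and A: "\<And>h. A h \<subseteq> {1..n}"
    and a: "a > 0" and hp: "hit_prob n u > 0"
  defines "h \<equiv> \<lambda>\<omega>. history d f Z \<omega> t"
  defines "B \<equiv> {\<omega> \<in> space M. a \<le> real (card (A (h \<omega>))) \<and>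
      2 * real (card {m \<in> A (h \<omega>). \<forall>j<x. \<exists>s<u. Z i (reached (h \<omega>) i + 2 + (j * u + s)) \<omega> = m})
        < real (card (A (h \<omega>))) * hit_prob n u ^ x}"
  shows "B \<in> events" and "prob B \<le> 4 / (a * hit_prob n u ^ x)"
proof -
  have d: "d \<ge> 1" using i by simp
  define \<Omega> where "\<Omega> = {..<x} \<rightarrow>\<^sub>E ({..<u} \<rightarrow>\<^sub>E {1..n})"
  define bad where "bad = (\<lambda>A. {w \<in> \<Omega>. 2 * real (card {m \<in> A. \<forall>j<x. \<exists>s<u. w j s = m})
      < real (card A) * hit_prob n u ^ x})"
  define Hs where "Hs = {h \<in> histories n d t. a \<le> real (card (A h))}"
  \<comment> \<open>The flat block of offers is read in rounds: offer \<open>s\<close> is number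
    \<open>s mod u\<close> of round \<open>s div u\<close>.\<close>
  define E where "E = (\<lambda>g w. {\<omega> \<in> space M. h \<omega> = g \<and>
      (\<forall>s<x * u. Z i (reached g i + 2 + s) \<omega> = w (s div u) (s mod u))})"
  have fin: "finite Hs" "finite (bad S)" for S
    using finite_subset[OF _ finite_histories[of n d t], of Hs]
    by (auto simp: Hs_def bad_def \<Omega>_def intro!: finite_PiE)
  have idx: "j * u + s < x * u" "(j * u + s) div u = j" "(j * u + s) mod u = s" if "j < x" "s < u" for j s
  proof -
    have "j * u + s < Suc j * u" using that by simp
    also have "\<dots> \<le> x * u" using that by (intro mult_right_mono) auto
    finally show "j * u + s < x * u" .
    show "(j * u + s) div u = j" "(j * u + s) mod u = s" using that by auto
  qed
  have idx': "s div u < x" "s mod u < u" if "s < x * u" for s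
    using that by (auto simp: less_mult_imp_div_less intro!: mod_less_divisor gr0I)
  have pool: "Z i (reached g i + 2 + s) \<omega> \<in> {1..n}" if "\<omega> \<in> space M" for g s \<omega>
    using that i by (intro pool_in) auto
  have B_eq: "B = (\<Union>g\<in>Hs. \<Union>w\<in>bad (A g). E g w)"
  proof (intro equalityI subsetI)
    fix \<omega> assume \<omega>: "\<omega> \<in> B"
    let ?w = "\<lambda>j\<in>{..<x}. \<lambda>s\<in>{..<u}. Z i (reached (h \<omega>) i + 2 + (j * u + s)) \<omega>"
    have sp: "\<omega> \<in> space M" using \<omega> by (simp add: B_def)
    have "h \<omega> \<in> Hs"
      using \<omega> history_in_histories[OF d sp] by (simp add: Hs_def B_def h_def)
    moreover have "?w \<in> \<Omega>"
      unfolding \<Omega>_def using pool[OF sp] by (auto simp: PiE_iff extensional_def)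
    then have "?w \<in> bad (A (h \<omega>))"
      using \<omega> by (simp add: bad_def B_def cong: conj_cong)
    moreover have "\<omega> \<in> E (h \<omega>) ?w"
      using sp idx' by (simp add: E_def)
    ultimately show "\<omega> \<in> (\<Union>g\<in>Hs. \<Union>w\<in>bad (A g). E g w)" by blast
  next
    fix \<omega> assume "\<omega> \<in> (\<Union>g\<in>Hs. \<Union>w\<in>bad (A g). E g w)"
    then obtain w where w: "h \<omega> \<in> Hs" "w \<in> bad (A (h \<omega>))" "\<omega> \<in> E (h \<omega>) w"
      by (auto simp: E_def)
    have "Z i (reached (h \<omega>) i + 2 + (j * u + s)) \<omega> = w j s" if "j < x" "s < u" for j s
      using w(3) idx[OF that] by (auto simp: E_def)
    then have "{m \<in> A (h \<omega>). \<forall>j<x. \<exists>s<u. Z i (reached (h \<omega>) i + 2 + (j * u + s)) \<omega> = m} =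
        {m \<in> A (h \<omega>). \<forall>j<x. \<exists>s<u. w j s = m}" by (metis (no_types, lifting))
    with w show "\<omega> \<in> B" by (simp add: B_def Hs_def bad_def E_def)
  qed
  have hist: "{\<omega> \<in> space M. h \<omega> = g} \<in> events" for g
    using f unfolding nonanticipating_def h_def by blast
  have E: "E g w \<in> events" "w \<in> \<Omega> \<Longrightarrow> prob (E g w) = prob {\<omega> \<in> space M. h \<omega> = g} / (real n ^ u) ^ x" for g w
  proof -
    have ev: "{\<omega> \<in> space M. \<forall>(j, r)\<in>{i} \<times> {reached g i + 2..<reached g i + 2 + x * u}.
        Z j r \<omega> = w ((r - (reached g i + 2)) div u) ((r - (reached g i + 2)) mod u)} \<in> events"
      using cylinder_event[of "{i} \<times> {reached g i + 2..<reached g i + 2 + x * u}"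
          "\<lambda>(j, r). w ((r - (reached g i + 2)) div u) ((r - (reached g i + 2)) mod u)"] i by auto
    have iff: "(\<forall>(j, r)\<in>{i} \<times> {reached g i + 2..<reached g i + 2 + x * u}.
        Z j r \<omega> = w ((r - (reached g i + 2)) div u) ((r - (reached g i + 2)) mod u)) \<longleftrightarrow>
        (\<forall>s<x * u. Z i (reached g i + 2 + s) \<omega> = w (s div u) (s mod u))" for \<omega>
    proof safe
      fix s assume *: "\<forall>(j, r)\<in>{i} \<times> {reached g i + 2..<reached g i + 2 + x * u}.
        Z j r \<omega> = w ((r - (reached g i + 2)) div u) ((r - (reached g i + 2)) mod u)" "s < x * u"
      then have "(i, reached g i + 2 + s) \<in> {i} \<times> {reached g i + 2..<reached g i + 2 + x * u}" by auto
      from bspec[OF *(1) this] show "Z i (reached g i + 2 + s) \<omega> = w (s div u) (s mod u)" by simp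
    next
      fix r assume *: "\<forall>s<x * u. Z i (reached g i + 2 + s) \<omega> = w (s div u) (s mod u)"
        "r \<in> {reached g i + 2..<reached g i + 2 + x * u}"
      then have "r - (reached g i + 2) < x * u" "reached g i + 2 + (r - (reached g i + 2)) = r" by auto
      with *(1) show "Z i r \<omega> = w ((r - (reached g i + 2)) div u) ((r - (reached g i + 2)) mod u)"
        by metis
    qed
    have "E g w = {\<omega> \<in> space M. h \<omega> = g} \<inter>
        {\<omega> \<in> space M. \<forall>s<x * u. Z i (reached g i + 2 + s) \<omega> = w (s div u) (s mod u)}"
      unfolding E_def by blast
    then show "E g w \<in> events"
      using sets.Int[OF hist ev[unfolded iff], of g] by (simp only:)
    assume "w \<in> \<Omega>"
    then have "\<forall>s<x * u. w (s div u) (s mod u) \<in> {1..n}"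
      using idx' by (auto simp: \<Omega>_def PiE_iff)
    then show "prob (E g w) = prob {\<omega> \<in> space M. h \<omega> = g} / (real n ^ u) ^ x"
      using f i unfolding nonanticipating_def E_def h_def
      by (simp add: power_mult[symmetric] mult.commute)
  qed
  have inner: "(\<Union>w\<in>bad (A g). E g w) \<in> events" for g
    by (intro sets.finite_UN fin E)
  show "B \<in> events"
    unfolding B_eq by (intro sets.finite_UN fin inner)
  have "prob B \<le> (\<Sum>g\<in>Hs. prob (\<Union>w\<in>bad (A g). E g w))"
    unfolding B_eq by (intro finite_measure_subadditive_finite fin image_subsetI inner)
  also have "\<dots> \<le> (\<Sum>g\<in>Hs. prob {\<omega> \<in> space M. h \<omega> = g} * (4 / (a * hit_prob n u ^ x)))"
  proof (rule sum_mono)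
    fix g assume g: "g \<in> Hs"
    have n: "n \<ge> 1" using n_pos[OF d] .
    have pos: "(real n ^ u) ^ x > 0" "hit_prob n u ^ x > 0" using n hp by auto
    have ge: "a * hit_prob n u ^ x \<le> real (card (A g)) * hit_prob n u ^ x"
      using g pos by (simp add: Hs_def)
    have "prob (\<Union>w\<in>bad (A g). E g w) \<le> (\<Sum>w\<in>bad (A g). prob (E g w))"
      by (intro finite_measure_subadditive_finite fin image_subsetI E)
    also have "\<dots> = (\<Sum>w\<in>bad (A g). prob {\<omega> \<in> space M. h \<omega> = g} / (real n ^ u) ^ x)"
      by (intro sum.cong refl E) (simp add: bad_def)
    also have "\<dots> = prob {\<omega> \<in> space M. h \<omega> = g} * (real (card (bad (A g))) / (real n ^ u) ^ x)"
      by simp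
    also have "real (card (bad (A g))) / (real n ^ u) ^ x \<le> 4 / (a * hit_prob n u ^ x)"
    proof -
      have "real (card (bad (A g))) * (a * hit_prob n u ^ x) \<le>
          real (card (bad (A g))) * (real (card (A g)) * hit_prob n u ^ x)"
        using ge by (intro mult_left_mono) auto
      also have "\<dots> \<le> 4 * (real n ^ u) ^ x"
        using card_few_hit[OF n A, of x u g] unfolding bad_def \<Omega>_def .
      finally show ?thesis using pos a by (simp add: field_simps)
    qed
    finally show "prob (\<Union>w\<in>bad (A g). E g w) \<le> prob {\<omega> \<in> space M. h \<omega> = g} * (4 / (a * hit_prob n u ^ x))"
      by (simp add: mult_left_mono)
  qed
  also have "\<dots> = prob (\<Union>g\<in>Hs. {\<omega> \<in> space M. h \<omega> = g}) * (4 / (a * hit_prob n u ^ x))"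
    unfolding sum_distrib_right[symmetric]
    by (subst finite_measure_finite_Union) (use fin hist in \<open>auto simp: disjoint_family_on_def\<close>)
  also have "\<dots> \<le> 1 * (4 / (a * hit_prob n u ^ x))"
    using a hp by (intro mult_right_mono prob_le_1) auto
  finally show "prob B \<le> 4 / (a * hit_prob n u ^ x)" by simp
qed

end

section \<open>Lower bound for a fixed number of bins\<close>

lemma (in allocation_pools) measurable_max_load:
  assumes "nonanticipating f"
  shows "max_load n d f Z t \<in> measurable M (count_space UNIV)"
proof -
  have "(\<lambda>\<omega>. history d f Z \<omega> t) \<in> measurable M (count_space UNIV)"
  proof (subst measurable_count_space_eq2_countable, intro conjI ballI)
    show "(\<lambda>\<omega>. history d f Z \<omega> t) -` {h} \<inter> space M \<in> events" for h
    proof -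
      have "(\<lambda>\<omega>. history d f Z \<omega> t) -` {h} \<inter> space M = {\<omega> \<in> space M. history d f Z \<omega> t = h}"
        by auto
      then show ?thesis using assms by (simp add: nonanticipating_def)
    qed
  qed auto
  then have "(\<lambda>\<omega>. Max ((\<lambda>m. count_list (map snd (history d f Z \<omega> t)) m) ` {1..n}))
      \<in> measurable M (count_space UNIV)"
    by (rule measurable_compose) simp
  then show ?thesis
    by (simp add: max_load_def load_conv_count_list cong: measurable_cong)
qed

text \<open>Puts the phases found by the pigeonhole principle into their order in time.\<close>

lemma strict_enumeration:
  fixes S :: "nat set"
  assumes "finite S" "d \<le> card S"
  obtains e where "\<And>i. i < d \<Longrightarrow> e i \<in> S" "\<And>i j. i < j \<Longrightarrow> j < d \<Longrightarrow> e i < e j"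
proof
  let ?e = "\<lambda>i. sorted_list_of_set S ! i"
  show "?e i \<in> S" if "i < d" for i
    using that assms nth_mem[of i "sorted_list_of_set S"] by simp
  show "?e i < ?e j" if "i < j" "j < d" for i j
    using that assms by (intro sorted_wrt_nth_less[OF strict_sorted_list_of_set]) auto
qed

text \<open>\<open>\<kappa> i / q\<close> plays the role of the exponent \<open>b i\<close>. The
  ends, where no rejections are measured, get the grid point just below the value 1 that they should
  have.\<close>

definition profiles :: "nat \<Rightarrow> nat \<Rightarrow> nat \<Rightarrow> (nat \<Rightarrow> nat) set" where
  "profiles d q G = {\<kappa> \<in> {0..d} \<rightarrow>\<^sub>E {0..G}. \<kappa> 0 = q - 1 \<and> \<kappa> d = q - 1}"

lemma finite_profiles: "finite (profiles d q G)"
  unfolding profiles_def by (rule finite_subset[of _ "{0..d} \<rightarrow>\<^sub>E {0..G}"]) (auto intro!: finite_PiE)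

text \<open>A bin hit in each of \<open>x\<close> rounds receives \<open>x\<close> offers between
  \<open>s\<close> and \<open>t\<close>, and \<open>load_ge_offers\<close> turns these into load
  unless a rejection spoils the bin. The extra 1 in the number of draws pays for the position
  skipped at the start of the block.\<close>

lemma (in allocation_pools) load_gain:
  assumes d: "d \<ge> 1" and i: "1 \<le> i" "i \<le> d" and "s \<le> t" and \<omega>: "\<omega> \<in> space M"
    and R: "reached (history d f Z \<omega> s) i + x * u + 1 \<le> reached (history d f Z \<omega> t) i"
    and "A \<subseteq> {1..n}"
  defines "H \<equiv> {m \<in> A. \<forall>j<x. \<exists>r<u. Z i (reached (history d f Z \<omega> s) i + 2 + (j * u + r)) \<omega> = m}"
  shows "card H + reached (history d f Z \<omega> s) (Suc i) \<le>
    card {m \<in> A. load d f Z m s \<omega> + x \<le> load d f Z m t \<omega>} + reached (history d f Z \<omega> t) (Suc i)"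
proof -
  let ?r = "reached (history d f Z \<omega> s) i"
  let ?L = "{m \<in> A. load d f Z m s \<omega> + x \<le> load d f Z m t \<omega>}"
  obtain B where B: "finite B"
      "card B + reached (history d f Z \<omega> s) (Suc i) \<le> reached (history d f Z \<omega> t) (Suc i)"
      "\<And>m. m \<notin> B \<Longrightarrow> load d f Z m s \<omega> +
        card {r \<in> {?r<..reached (history d f Z \<omega> t) i}. Z i r \<omega> = m} \<le> load d f Z m t \<omega>"
    using load_ge_offers[OF d i \<open>s \<le> t\<close>, of f Z \<omega>] by blast
  have finA: "finite A" using assms(7) by (rule finite_subset) simp
  have "x \<le> card {r \<in> {?r<..reached (history d f Z \<omega> t) i}. Z i r \<omega> = m}" if m: "m \<in> H" for m
  proof -
    have "\<forall>j. \<exists>r. j < x \<longrightarrow> r < u \<and> Z i (?r + 2 + (j * u + r)) \<omega> = m"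
      using m unfolding H_def by blast
    then obtain r where r: "\<And>j. j < x \<Longrightarrow> r j < u" "\<And>j. j < x \<Longrightarrow> Z i (?r + 2 + (j * u + r j)) \<omega> = m"
      by metis
    define g where "g = (\<lambda>j. ?r + 2 + (j * u + r j))"
    \<comment> \<open>Division by \<open>u\<close> recovers the round, so hits of different rounds
      occupy different pool positions.\<close>
    have "inj_on g {..<x}"
    proof (rule inj_onI)
      fix j k assume *: "j \<in> {..<x}" "k \<in> {..<x}" "g j = g k"
      then have "(j * u + r j) div u = (k * u + r k) div u" by (simp add: g_def)
      with * r(1)[of j] r(1)[of k] show "j = k" by simp
    qed
    moreover have "g ` {..<x} \<subseteq> {r \<in> {?r<..reached (history d f Z \<omega> t) i}. Z i r \<omega> = m}"
    proof safe
      fix j assume j: "j < x"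
      have "j * u + r j < Suc j * u" using r(1)[OF j] by simp
      also have "\<dots> \<le> x * u" using j by (intro mult_right_mono) auto
      finally show "g j \<in> {?r<..reached (history d f Z \<omega> t) i}" using R by (simp add: g_def)
      show "Z i (g j) \<omega> = m" using r(2)[OF j] by (simp add: g_def)
    qed
    ultimately have "card {..<x} \<le> card {r \<in> {?r<..reached (history d f Z \<omega> t) i}. Z i r \<omega> = m}"
      by (intro card_inj_on_le) auto
    then show ?thesis by simp
  qed
  then have "H \<subseteq> ?L \<union> B"
    using B(3) unfolding H_def by fastforce
  then have "card H \<le> card (?L \<union> B)" using finA B(1) by (intro card_mono) auto
  also have "\<dots> \<le> card ?L + card B" by (rule card_Un_le)
  finally show ?thesis using B(2) by linarith
qed

text \<open>
  The balls are thrown in \<open>K\<close> phases of \<open>\<tau>\<close> balls. The profile of a phase records, for each level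
  \<open>i\<close>, the finest of the bounds \<open>thr i k\<close>, \<open>k \<le> G\<close>, on the number of rejections at that level.
  Among many phases \<open>d\<close> have the same profile \<open>\<kappa>\<close>, and in the \<open>i\<close>-th of them the bins that are
  already high gain \<open>x (\<kappa> (i - 1)) (\<kappa> i)\<close> balls from level \<open>i\<close>: enough balls reach level \<open>i\<close> for
  the gain and too few are rejected there to prevent it.
\<close>

lemma (in allocation_pools) prob_max_load_less:
  fixes x :: "nat \<Rightarrow> nat \<Rightarrow> nat" and u :: "nat \<Rightarrow> nat \<Rightarrow> nat" and a :: "nat \<Rightarrow> real"
    and thr :: "nat \<Rightarrow> nat \<Rightarrow> real" and y \<delta> :: real
  assumes f: "nonanticipating f" and d: "d \<ge> 1" and q: "2 \<le> q" "q - 1 \<le> G"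
    and K: "d * card (profiles d q G) \<le> K" "K \<ge> 1" and N: "K * \<tau> \<le> N"
    and x0: "\<And>j. x j 0 = 0"
    and thr0: "\<And>i. 1 \<le> i \<Longrightarrow> i < d \<Longrightarrow> real \<tau> \<le> thr i 0"
    and a0: "a 0 \<le> n" and a_pos: "\<And>i. i \<le> d \<Longrightarrow> 0 < a i"
    and a_dec: "\<And>i. Suc i < d \<Longrightarrow> a (Suc i) \<le> a i"
    and u_first: "\<And>k. 1 \<le> k \<Longrightarrow> k \<le> G \<Longrightarrow> x (q - 1) k * u 0 (q - 1) + 1 \<le> \<tau>"
    and u_later: "\<And>i j k. 1 \<le> i \<Longrightarrow> i < d \<Longrightarrow> j < G \<Longrightarrow> 1 \<le> k \<Longrightarrow> k \<le> G \<Longrightarrow>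
        real (x j k * u i j + 1) \<le> thr i (Suc j)"
    and u_bounds: "\<And>i j. i < d \<Longrightarrow> j \<le> G \<Longrightarrow> 1 \<le> u i j \<and> u i j \<le> n"
    and gain: "\<And>i j k. i < d \<Longrightarrow> j \<le> G \<Longrightarrow> 1 \<le> k \<Longrightarrow> k \<le> G \<Longrightarrow> (Suc i = d \<Longrightarrow> k = q - 1) \<Longrightarrow>
        a (Suc i) + (if Suc i = d then 0 else thr (Suc i) k)
          \<le> a i * (real (u i j) / (2 * real n)) ^ x j k / 2"
    and \<delta>: "\<And>i. 1 \<le> i \<Longrightarrow> i \<le> d \<Longrightarrow> 1 / a i \<le> \<delta>"
    and thr_nonneg: "\<And>i k. 0 \<le> thr i k"
    and y: "\<And>\<kappa> j. \<kappa> \<in> profiles d q G \<Longrightarrow> 1 \<le> j \<Longrightarrow> j \<le> d \<Longrightarrow> j = d \<or> \<kappa> j = G \<Longrightarrow>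
        y \<le> real (\<Sum>i<j. x (\<kappa> i) (\<kappa> (Suc i)))"
  shows "prob {\<omega> \<in> space M. real (max_load n d f Z N \<omega>) < y} \<le>
    real (K * d * card (profiles d q G)) * (2 * \<delta>)"
proof -
  have n: "n \<ge> 1" by (rule n_pos[OF d])
  \<comment> \<open>The load promised after the first \<open>i\<close> selected phases;
    \<open>A \<kappa> i\<close> consists of the bins that have attained it.\<close>
  define S where "S = (\<lambda>\<kappa> i. \<Sum>j<i. x (\<kappa> j) (\<kappa> (Suc j)))"
  define A where "A = (\<lambda>\<kappa> i (h :: (nat \<times> nat) list). {m \<in> {1..n}. S \<kappa> i \<le> count_list (map snd h) m})"
  \<comment> \<open>The common profile and its phases are known only afterwards, so concentration is
    demanded beforehand for every phase, level and profile with a positive gain to prove.\<close>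
  define bad where "bad = (\<lambda>(c, i, \<kappa>). {\<omega> \<in> space M.
      a i \<le> real (card (A \<kappa> i (history d f Z \<omega> (c * \<tau>)))) \<and>
      2 * real (card {m \<in> A \<kappa> i (history d f Z \<omega> (c * \<tau>)). \<forall>j<x (\<kappa> i) (\<kappa> (Suc i)). \<exists>s<u i (\<kappa> i).
        Z (Suc i) (reached (history d f Z \<omega> (c * \<tau>)) (Suc i) + 2 + (j * u i (\<kappa> i) + s)) \<omega> = m})
      < real (card (A \<kappa> i (history d f Z \<omega> (c * \<tau>)))) * hit_prob n (u i (\<kappa> i)) ^ x (\<kappa> i) (\<kappa> (Suc i))})"
  define I where "I = {(c, i, \<kappa>). c < K \<and> i < d \<and> \<kappa> \<in> profiles d q G \<and> 1 \<le> \<kappa> (Suc i)}"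
  have I_sub: "I \<subseteq> {..<K} \<times> {..<d} \<times> profiles d q G" by (auto simp: I_def)
  have finI: "finite I"
    by (rule finite_subset[OF I_sub]) (simp add: finite_profiles)
  have hp: "real (u i j) / (2 * real n) \<le> hit_prob n (u i j)" "0 < real (u i j) / (2 * real n)"
    if "i < d" "j \<le> G" for i j
    using hit_prob_ge[OF n] u_bounds[OF that] n by auto
  have profile: "\<kappa> i \<le> G" "\<kappa> 0 = q - 1" "\<kappa> d = q - 1" if "\<kappa> \<in> profiles d q G" "i \<le> d" for \<kappa> i
    using that by (auto simp: profiles_def PiE_iff)
  have gain': "a (Suc i) + (if Suc i = d then 0 else thr (Suc i) (\<kappa> (Suc i)))
      \<le> a i * hit_prob n (u i (\<kappa> i)) ^ x (\<kappa> i) (\<kappa> (Suc i)) / 2"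
    if "i < d" "\<kappa> \<in> profiles d q G" "1 \<le> \<kappa> (Suc i)" for i \<kappa>
  proof -
    have "a (Suc i) + (if Suc i = d then 0 else thr (Suc i) (\<kappa> (Suc i)))
        \<le> a i * (real (u i (\<kappa> i)) / (2 * real n)) ^ x (\<kappa> i) (\<kappa> (Suc i)) / 2"
      by (rule gain) (use that profile[OF that(2)] in auto)
    also have "\<dots> \<le> a i * hit_prob n (u i (\<kappa> i)) ^ x (\<kappa> i) (\<kappa> (Suc i)) / 2"
      using that hp[of i "\<kappa> i"] profile[OF that(2), of i] a_pos[of i]
      by (intro divide_right_mono mult_left_mono power_mono) auto
    finally show ?thesis .
  qed
  have bad: "bad p \<in> events \<and> prob (bad p) \<le> 2 * \<delta>" if pI: "p \<in> I" for p
  proof -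
    obtain c i \<kappa> where p: "p = (c, i, \<kappa>)" "i < d" "\<kappa> \<in> profiles d q G" "1 \<le> \<kappa> (Suc i)"
      using pI by (auto simp: I_def)
    have hp': "hit_prob n (u i (\<kappa> i)) > 0"
      using hp[of i "\<kappa> i"] profile[OF p(3), of i] p(2) by linarith
    have ai: "a i > 0" "a (Suc i) > 0" using a_pos p(2) by auto
    have i: "Suc i \<in> {1..d}" using p(2) by auto
    have AA: "\<And>h. A \<kappa> i h \<subseteq> {1..n}" by (auto simp: A_def)
    note few = prob_few_hit[where A = "A \<kappa> i" and t = "c * \<tau>" and x = "x (\<kappa> i) (\<kappa> (Suc i))",
        OF f i AA ai(1) hp']
    have "prob (bad p) \<le> 4 / (a i * hit_prob n (u i (\<kappa> i)) ^ x (\<kappa> i) (\<kappa> (Suc i)))"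
      using few(2) unfolding bad_def p(1) by simp
    also have "\<dots> \<le> 4 / (2 * a (Suc i))"
      using gain'[OF p(2-4)] thr_nonneg[of "Suc i" "\<kappa> (Suc i)"] ai
      by (intro divide_left_mono) (auto split: if_splits intro!: mult_pos_pos zero_less_power hp')
    also have "\<dots> = 2 * (1 / a (Suc i))" by simp
    also have "\<dots> \<le> 2 * \<delta>"
      using \<delta>[of "Suc i"] p(2) by (intro mult_left_mono) auto
    finally show ?thesis using few(1) unfolding bad_def p(1) by simp
  qed
  have good: "y \<le> real (max_load n d f Z N \<omega>)"
    if \<omega>: "\<omega> \<in> space M" and nbad: "\<And>p. p \<in> I \<Longrightarrow> \<omega> \<notin> bad p" for \<omega>
  proof -
    let ?h = "\<lambda>t. history d f Z \<omega> t"
    define rej where "rej = (\<lambda>c i. reached (?h (Suc c * \<tau>)) (Suc i) - reached (?h (c * \<tau>)) (Suc i))"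
    have mono: "reached (?h (c * \<tau>)) i \<le> reached (?h (Suc c * \<tau>)) i" for c i
      by (rule reached_history_mono) simp
    have rej_le: "rej c i \<le> \<tau>" for c i
      using reached_history_diff_le[of "c * \<tau>" "Suc c * \<tau>" d f Z \<omega> "Suc i"] by (simp add: rej_def)
    define P where "P = (\<lambda>c i k. k \<le> G \<and> real (rej c i) \<le> thr i k)"
    \<comment> \<open>Taking the largest \<open>k\<close> makes the next bound fail unless
      \<open>k = G\<close>. This failure is the lower bound on the rejections that supply the next
      level with offers.\<close>
    define \<kappa>c where "\<kappa>c = (\<lambda>c. \<lambda>i\<in>{0..d}. if i = 0 \<or> i = d then q - 1 else Max {k. P c i k})"
    have Max_P: "P c i (Max {k. P c i k})" "Max {k. P c i k} < G \<Longrightarrow> thr i (Suc (Max {k. P c i k})) < rej c i"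
      if "1 \<le> i" "i < d" for c i
    proof -
      have fin: "finite {k. P c i k}" by (rule finite_subset[of _ "{..G}"]) (auto simp: P_def)
      have "P c i 0"
        using rej_le[of c i] thr0[OF that] by (simp add: P_def)
      then have "Max {k. P c i k} \<in> {k. P c i k}" using fin by (intro Max_in) auto
      then show "P c i (Max {k. P c i k})" by simp
      assume lt: "Max {k. P c i k} < G"
      have "\<not> P c i (Suc (Max {k. P c i k}))"
        using Max_ge[OF fin, of "Suc (Max {k. P c i k})"] by auto
      with lt show "thr i (Suc (Max {k. P c i k})) < rej c i" by (auto simp: P_def)
    qed
    have \<kappa>c: "\<kappa>c c \<in> profiles d q G" for c
      using Max_P(1) q by (fastforce simp: profiles_def \<kappa>c_def P_def PiE_iff)
    have \<kappa>c_rej: "real (rej c i) \<le> thr i (\<kappa>c c i)" "\<kappa>c c i < G \<Longrightarrow> thr i (Suc (\<kappa>c c i)) < rej c i"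
      if "1 \<le> i" "i < d" for c i
      using Max_P[OF that, of c] that by (auto simp: \<kappa>c_def P_def)
    obtain \<kappa> where \<kappa>: "\<kappa> \<in> profiles d q G" "d \<le> card {c. c < K \<and> \<kappa>c c = \<kappa>}"
    proof (rule ccontr)
      assume "\<not> thesis"
      then have less: "card {c. c < K \<and> \<kappa>c c = \<kappa>} \<le> d - 1" if "\<kappa> \<in> profiles d q G" for \<kappa>
        using \<open>\<And>\<kappa>. \<kappa> \<in> profiles d q G \<Longrightarrow> d \<le> card {c. c < K \<and> \<kappa>c c = \<kappa>} \<Longrightarrow> thesis\<close> that d
        by fastforce
      have "{..<K} = (\<Union>\<kappa>\<in>profiles d q G. {c. c < K \<and> \<kappa>c c = \<kappa>})" using \<kappa>c by auto
      then have "K = card (\<Union>\<kappa>\<in>profiles d q G. {c. c < K \<and> \<kappa>c c = \<kappa>})" by (metis card_lessThan)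
      also have "\<dots> \<le> (\<Sum>\<kappa>\<in>profiles d q G. card {c. c < K \<and> \<kappa>c c = \<kappa>})"
        by (rule card_UN_le[OF finite_profiles])
      also have "\<dots> \<le> (\<Sum>\<kappa>\<in>profiles d q G. d - 1)" by (rule sum_mono) (rule less)
      also have "\<dots> = card (profiles d q G) * (d - 1)" by simp
      also have "\<dots> < card (profiles d q G) * d"
        using \<kappa>c[of 0] finite_profiles[of d q G] d by (auto simp: card_gt_0_iff)
      also have "\<dots> \<le> K" using K by (simp add: mult.commute)
      finally show False by simp
    qed
    obtain e where e: "\<And>i. i < d \<Longrightarrow> e i \<in> {c. c < K \<and> \<kappa>c c = \<kappa>}"
        "\<And>i j. i < j \<Longrightarrow> j < d \<Longrightarrow> e i < e j"
      using strict_enumeration[OF _ \<kappa>(2)] by auto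
    \<comment> \<open>At the first level with entry \<open>G\<close> the argument stops: there is no
      lower bound on the balls passing it, and \<open>y\<close> is already attained.\<close>
    define j where "j = (LEAST j. 1 \<le> j \<and> (j = d \<or> \<kappa> j = G))"
    have j: "1 \<le> j" "j = d \<or> \<kappa> j = G"
      using LeastI[of "\<lambda>j. 1 \<le> j \<and> (j = d \<or> \<kappa> j = G)" d] d by (auto simp: j_def)
    have j_le: "j \<le> d" unfolding j_def by (rule Least_le) (use d in auto)
    have before: "\<kappa> i < G" if "1 \<le> i" "i < j" for i
      using not_less_Least[of i "\<lambda>j. 1 \<le> j \<and> (j = d \<or> \<kappa> j = G)"] that j_le profile(1)[OF \<kappa>(1), of i]
      unfolding j_def by fastforce
    define T where "T = (\<lambda>i. case i of 0 \<Rightarrow> 0 | Suc i \<Rightarrow> Suc (e i) * \<tau>)"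
    have T_le: "T i \<le> e i * \<tau>" if "i < d" for i
    proof (cases i)
      case (Suc i')
      then have "Suc (e i') \<le> e i" using e(2)[of i' i] that by simp
      then show ?thesis using Suc by (simp add: T_def del: mult_Suc)
    qed (simp add: T_def)
    \<comment> \<open>Stated for every \<open>t\<close> from \<open>T i\<close> on, because loads
      never decrease and unselected phases may lie in between.\<close>
    have claim: "a i \<le> real (card (A \<kappa> i (?h t)))" if "i \<le> j" "T i \<le> t" for i t
      using that
    proof (induction i arbitrary: t)
      case 0
      have "A \<kappa> 0 (?h t) = {1..n}" by (auto simp: A_def S_def)
      then show ?case using a0 by simp
    next
      case (Suc i)
      then have id: "i < d" using j_le by simp
      define s where "s = e i * \<tau>"
      have T: "T (Suc i) = s + \<tau>" "T i \<le> s" using T_le[OF id] by (simp_all add: T_def s_def)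
      have IH: "a i \<le> real (card (A \<kappa> i (?h s)))" by (rule Suc.IH) (use Suc.prems T in auto)
      have ei: "e i < K" "\<kappa>c (e i) = \<kappa>" using e(1)[OF id] by auto
      have "a (Suc i) \<le> real (card (A \<kappa> (Suc i) (?h (s + \<tau>))))"
      \<comment> \<open>Entry 0 gives no useful bound on the rejections, but it also promises no
        gain.\<close>
      proof (cases "\<kappa> (Suc i) = 0")
        case True
        then have "Suc i < d" using id profile(3)[OF \<kappa>(1)] q by (cases "Suc i = d") auto
        then have "a (Suc i) \<le> a i" by (rule a_dec)
        also have "A \<kappa> i (?h s) \<subseteq> A \<kappa> (Suc i) (?h (s + \<tau>))"
          using load_mono[of s "s + \<tau>" d f Z _ \<omega>] True
          by (auto simp: A_def S_def x0 load_conv_count_list intro: le_trans)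
        then have "real (card (A \<kappa> i (?h s))) \<le> real (card (A \<kappa> (Suc i) (?h (s + \<tau>))))"
          by (intro of_nat_mono card_mono) (auto simp: A_def)
        with IH have "a i \<le> real (card (A \<kappa> (Suc i) (?h (s + \<tau>))))" by linarith
        finally show ?thesis .
      next
        case False
        then have k1: "1 \<le> \<kappa> (Suc i)" by simp
        let ?x = "x (\<kappa> i) (\<kappa> (Suc i))" and ?u = "u i (\<kappa> i)"
        define H where "H = {m \<in> A \<kappa> i (?h s). \<forall>j<?x. \<exists>r<?u.
          Z (Suc i) (reached (?h s) (Suc i) + 2 + (j * ?u + r)) \<omega> = m}"
        have "(e i, i, \<kappa>) \<in> I" using ei id \<kappa>(1) k1 by (simp add: I_def)
        from nbad[OF this] have "real (card (A \<kappa> i (?h s))) * hit_prob n ?u ^ ?x \<le> 2 * real (card H)"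
          using \<omega> IH by (simp add: bad_def s_def H_def not_less)
        moreover have "a i * hit_prob n ?u ^ ?x \<le> real (card (A \<kappa> i (?h s))) * hit_prob n ?u ^ ?x"
          using IH hit_prob_nonneg[OF n] by (intro mult_right_mono) auto
        ultimately have cardH: "a (Suc i) + (if Suc i = d then 0 else thr (Suc i) (\<kappa> (Suc i))) \<le> real (card H)"
          using gain'[OF id \<kappa>(1) k1] by linarith
        \<comment> \<open>Level 1 is offered to all \<open>\<tau>\<close> balls; a later level is
          offered to those rejected one level below in the same phase.\<close>
        have "reached (?h s) (Suc i) + ?x * ?u + 1 \<le> reached (?h (s + \<tau>)) (Suc i)"
        proof (cases "i = 0")
          case True
          then show ?thesis
            using u_first[OF k1] profile[OF \<kappa>(1)] id d by simp
        next
          case False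
          have "real (?x * ?u + 1) \<le> thr i (Suc (\<kappa> i))"
            by (rule u_later) (use False id before[of i] Suc.prems k1 profile(1)[OF \<kappa>(1), of "Suc i"] in auto)
          also have "\<dots> < rej (e i) i"
            using \<kappa>c_rej(2)[of i "e i"] False id before[of i] Suc.prems ei by simp
          finally have "?x * ?u + 1 < rej (e i) i" by (simp only: of_nat_less_iff)
          then show ?thesis by (simp add: rej_def s_def ac_simps)
        qed
        moreover have "A \<kappa> i (?h s) \<subseteq> {1..n}" by (auto simp: A_def)
        ultimately have "card H + reached (?h s) (Suc (Suc i)) \<le>
            card {m \<in> A \<kappa> i (?h s). load d f Z m s \<omega> + ?x \<le> load d f Z m (s + \<tau>) \<omega>} +
            reached (?h (s + \<tau>)) (Suc (Suc i))"
          unfolding H_def using id by (intro load_gain[OF d _ _ _ \<omega>]) auto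
        moreover have "{m \<in> A \<kappa> i (?h s). load d f Z m s \<omega> + ?x \<le> load d f Z m (s + \<tau>) \<omega>}
            \<subseteq> A \<kappa> (Suc i) (?h (s + \<tau>))"
          by (auto simp: A_def S_def load_conv_count_list)
        then have "card {m \<in> A \<kappa> i (?h s). load d f Z m s \<omega> + ?x \<le> load d f Z m (s + \<tau>) \<omega>}
            \<le> card (A \<kappa> (Suc i) (?h (s + \<tau>)))"
          by (rule card_mono[rotated]) (simp add: A_def)
        moreover have "rej (e i) (Suc i) = reached (?h (s + \<tau>)) (Suc (Suc i)) - reached (?h s) (Suc (Suc i))"
          by (simp add: rej_def s_def ac_simps)
        ultimately have H_le: "card H \<le> card (A \<kappa> (Suc i) (?h (s + \<tau>))) + rej (e i) (Suc i)"
          by linarith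
        have "real (rej (e i) (Suc i)) \<le> (if Suc i = d then 0 else thr (Suc i) (\<kappa> (Suc i)))"
          using \<kappa>c_rej(1)[of "Suc i" "e i"] ei id d by (auto simp: rej_def)
        with H_le cardH show ?thesis by linarith
      qed
      also have "A \<kappa> (Suc i) (?h (s + \<tau>)) \<subseteq> A \<kappa> (Suc i) (?h t)"
        using load_mono[of "s + \<tau>" t d f Z _ \<omega>] Suc.prems T
        by (auto simp: A_def load_conv_count_list intro: le_trans)
      then have "real (card (A \<kappa> (Suc i) (?h (s + \<tau>)))) \<le> real (card (A \<kappa> (Suc i) (?h t)))"
        by (intro of_nat_mono card_mono) (auto simp: A_def)
      finally show ?case .
    qed
    have "T j \<le> K * \<tau>"
    proof -
      obtain j' where j': "j = Suc j'" using j(1) by (cases j) auto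
      then have "Suc (e j') \<le> K" using e(1)[of j'] j_le by auto
      then show ?thesis by (simp add: T_def j' del: mult_Suc)
    qed
    then have "a j \<le> real (card (A \<kappa> j (?h N)))"
      using N by (intro claim) auto
    with a_pos[OF j_le] have "A \<kappa> j (?h N) \<noteq> {}" by auto
    then obtain m where m: "m \<in> {1..n}" "S \<kappa> j \<le> load d f Z m N \<omega>"
      by (auto simp: A_def load_conv_count_list)
    have "y \<le> real (S \<kappa> j)" unfolding S_def by (rule y[OF \<kappa>(1) j(1) j_le j(2)])
    also have "S \<kappa> j \<le> max_load n d f Z N \<omega>"
      using m le_max_load[OF m(1), of d f Z N \<omega>] by linarith
    finally show ?thesis by simp
  qed
  have "{\<omega> \<in> space M. real (max_load n d f Z N \<omega>) < y} \<subseteq> (\<Union>p\<in>I. bad p)"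
    using good by force
  then have "prob {\<omega> \<in> space M. real (max_load n d f Z N \<omega>) < y} \<le> prob (\<Union>p\<in>I. bad p)"
    using bad finI by (intro finite_measure_mono sets.finite_UN) auto
  also have "\<dots> \<le> (\<Sum>p\<in>I. prob (bad p))"
    using bad finI by (intro finite_measure_subadditive_finite) auto
  also have "\<dots> \<le> (\<Sum>p\<in>I. 2 * \<delta>)" by (rule sum_mono) (use bad in auto)
  also have "\<dots> = real (card I) * (2 * \<delta>)" by simp
  also have "\<dots> \<le> real (K * d * card (profiles d q G)) * (2 * \<delta>)"
  proof (rule mult_right_mono)
    have "card I \<le> card ({..<K} \<times> {..<d} \<times> profiles d q G)"
      by (rule card_mono[OF _ I_sub]) (simp add: finite_profiles)
    then show "real (card I) \<le> real (K * d * card (profiles d q G))"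
      by (simp only: of_nat_le_iff) (simp add: card_cartesian_product mult.assoc)
    have "0 < 1 / a d" using a_pos[of d] by simp
    then show "0 \<le> 2 * \<delta>" using \<delta>[of d] d by linarith
  qed
  finally show ?thesis .
qed

section \<open>Upper bound for a fixed number of bins\<close>

text \<open>Replaces the excess over the quota by a collision count, which
  \<open>prob_collisions\<close> controls. In Pascal's rule each further step adds at least
  1.\<close>

lemma diff_le_choose_Suc: "c - k \<le> c choose Suc k"
proof (induction c)
  case (Suc c)
  show ?case
  proof (cases "k \<le> c")
    case True
    then have "1 \<le> c choose k" by (simp add: Suc_le_eq)
    with Suc True show ?thesis by (simp add: Suc_diff_le)
  qed simp
qed simp

text \<open>As long as at most \<open>r i\<close> balls reach level \<open>i\<close>, only the
  deterministic prefix of length \<open>r i\<close> of pool \<open>i\<close> matters. The failures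
  \<open>E i\<close> and \<open>E'\<close> concern such prefixes only, so a union bound replaces any
  conditioning on the process.\<close>

lemma (in allocation_pools) prob_max_load_threshold_ge:
  fixes R :: "nat \<Rightarrow> real" and l :: real
  assumes d: "d \<ge> 1" and l: "l \<ge> 0" and R1: "real N \<le> R 1" and R: "\<And>i. 0 < R i"
  defines "k \<equiv> nat \<lfloor>l\<rfloor>" and "r \<equiv> \<lambda>i. nat \<lfloor>R i\<rfloor>"
  shows "prob {\<omega> \<in> space M. (d - 1) * k + L \<le> max_load n d (threshold_strategy l) Z N \<omega>} \<le>
    (\<Sum>i\<in>{1..<d}. n * real (r i choose Suc k) / n ^ Suc k / R (Suc i)) + n * real (r d choose L) / n ^ L"
proof -
  let ?h = "\<lambda>\<omega>. history d (threshold_strategy l) Z \<omega> N"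
  define E where "E = (\<lambda>i. {\<omega> \<in> space M. R (Suc i) \<le> real (\<Sum>m\<in>{1..n}. offers Z \<omega> i (r i) m choose Suc k)})"
  define E' where "E' = {\<omega> \<in> space M. 1 \<le> real (\<Sum>m\<in>{1..n}. offers Z \<omega> d (r d) m choose L)}"
  have E: "E i \<in> events" "prob (E i) \<le> n * real (r i choose Suc k) / n ^ Suc k / R (Suc i)"
    if "i \<in> {1..<d}" for i
    using that prob_collisions[of i "R (Suc i)" "r i" "Suc k"] R by (auto simp: E_def)
  have E': "E' \<in> events" "prob E' \<le> n * real (r d choose L) / n ^ L"
    using prob_collisions[of d 1 "r d" L] d by (auto simp: E'_def)
  have sub: "{\<omega> \<in> space M. (d - 1) * k + L \<le> max_load n d (threshold_strategy l) Z N \<omega>} \<subseteq> (\<Union>i\<in>{1..<d}. E i) \<union> E'"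
  proof (rule subsetI, rule ccontr)
    fix \<omega> assume "\<omega> \<in> {\<omega> \<in> space M. (d - 1) * k + L \<le> max_load n d (threshold_strategy l) Z N \<omega>}"
      and nin: "\<omega> \<notin> (\<Union>i\<in>{1..<d}. E i) \<union> E'"
    then have \<omega>: "\<omega> \<in> space M" and ge: "(d - 1) * k + L \<le> max_load n d (threshold_strategy l) Z N \<omega>"
      by auto
    have reached: "reached (?h \<omega>) i \<le> r i" if "1 \<le> i" "i \<le> d" for i
      using that
    proof (induction i rule: dec_induct)
      case base
      then show ?case using d R1 by (simp add: r_def le_nat_iff le_floor_iff)
    next
      case (step i)
      have i: "i \<in> {1..<d}" using step by auto
      have "reached (?h \<omega>) (Suc i) \<le> (\<Sum>m\<in>{1..n}. offers Z \<omega> i (reached (?h \<omega>) i) m - k)"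
        unfolding k_def by (rule reached_Suc_threshold_le) (use step l pool_in \<omega> in auto)
      also have "\<dots> \<le> (\<Sum>m\<in>{1..n}. offers Z \<omega> i (r i) m - k)"
        by (intro sum_mono diff_le_mono offers_mono step.IH) (use step in auto)
      also have "\<dots> \<le> (\<Sum>m\<in>{1..n}. offers Z \<omega> i (r i) m choose Suc k)"
        by (intro sum_mono diff_le_choose_Suc)
      finally have "real (reached (?h \<omega>) (Suc i)) \<le> real (\<Sum>m\<in>{1..n}. offers Z \<omega> i (r i) m choose Suc k)"
        by (simp only: of_nat_le_iff)
      also have "\<omega> \<notin> E i" using nin i by blast
      then have "real (\<Sum>m\<in>{1..n}. offers Z \<omega> i (r i) m choose Suc k) < R (Suc i)"
        using \<omega> unfolding E_def by simp
      finally show ?case by (simp add: r_def le_nat_iff le_floor_iff)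
    qed
    have "\<omega> \<notin> E'" using nin by blast
    then have "real (\<Sum>m\<in>{1..n}. offers Z \<omega> d (r d) m choose L) < 1"
      using \<omega> unfolding E'_def by simp
    then have "(\<Sum>m\<in>{1..n}. offers Z \<omega> d (r d) m choose L) = 0" by linarith
    then have lt: "offers Z \<omega> d (r d) m < L" if "m \<in> {1..n}" for m
      using that by auto
    have "load d (threshold_strategy l) Z m N \<omega> < (d - 1) * k + L" if "m \<in> {1..n}" for m
    proof -
      have "load d (threshold_strategy l) Z m N \<omega> \<le> (d - 1) * k + offers Z \<omega> d (reached (?h \<omega>) d) m"
        unfolding k_def by (rule load_threshold_le[OF d l])
      also have "offers Z \<omega> d (reached (?h \<omega>) d) m \<le> offers Z \<omega> d (r d) m"
        by (intro offers_mono reached) (use d in auto)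
      also have "\<dots> < L" by (rule lt[OF that])
      finally show ?thesis by simp
    qed
    then have "max_load n d (threshold_strategy l) Z N \<omega> < (d - 1) * k + L"
      using n_pos[OF d] by (auto simp: max_load_def)
    with ge show False by simp
  qed
  have "prob {\<omega> \<in> space M. (d - 1) * k + L \<le> max_load n d (threshold_strategy l) Z N \<omega>}
      \<le> prob ((\<Union>i\<in>{1..<d}. E i) \<union> E')"
    using E E' by (intro finite_measure_mono[OF sub]) auto
  also have "\<dots> \<le> prob (\<Union>i\<in>{1..<d}. E i) + prob E'"
    using E E' by (intro measure_Un_le) auto
  also have "prob (\<Union>i\<in>{1..<d}. E i) \<le> (\<Sum>i\<in>{1..<d}. prob (E i))"
    using E by (intro finite_measure_subadditive_finite) auto
  also have "\<dots> \<le> (\<Sum>i\<in>{1..<d}. n * real (r i choose Suc k) / n ^ Suc k / R (Suc i))"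
    by (intro sum_mono E)
  finally show ?thesis using E'(2) by simp
qed

text \<open>This is the estimate \<open>(r choose K) \<le> (e r / K)^K\<close>;
  \<open>K^K / K!\<close> is a single term of the series of \<open>exp K\<close>.\<close>

lemma choose_div_power_le:
  fixes w :: real
  assumes "n \<ge> 1" "real r / real n * exp 1 \<le> w * real K"
  shows "real (r choose K) / real n ^ K \<le> w ^ K"
proof (cases "K = 0")
  case False
  have "real K ^ K / fact K \<le> exp (real K)"
  proof -
    have "(\<Sum>i\<in>{K}. inverse (fact i) *\<^sub>R real K ^ i) \<le> (\<Sum>i. inverse (fact i) *\<^sub>R real K ^ i)"
      by (rule sum_le_suminf[OF summable_exp_generic]) auto
    then show ?thesis by (simp add: exp_def field_simps)
  qed
  then have "real K ^ K \<le> exp 1 ^ K * fact K"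
    by (simp add: field_simps exp_of_nat_mult[symmetric])
  moreover have "real (r choose K) * fact K \<le> real r ^ K"
    using binomial_fact_pow[of r K] by (metis of_nat_fact of_nat_le_iff of_nat_mult of_nat_power)
  ultimately have "real (r choose K) * real K ^ K \<le> real r ^ K * exp 1 ^ K"
    by (smt (verit) mult.assoc mult.commute mult_left_mono mult_right_mono of_nat_0_le_iff zero_le_power exp_gt_zero)
  also have "\<dots> = (real r / real n * exp 1) ^ K * real n ^ K"
    using assms(1) by (simp add: power_mult_distrib power_divide)
  also have "\<dots> \<le> (w * real K) ^ K * real n ^ K"
    using assms by (intro mult_right_mono power_mono) auto
  finally have "real (r choose K) * real K ^ K \<le> (w ^ K * real n ^ K) * real K ^ K"
    by (simp add: power_mult_distrib mult_ac)
  then have "real (r choose K) \<le> w ^ K * real n ^ K"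
    using False by (simp add: mult_le_cancel_right)
  then show ?thesis using assms(1) by (simp add: field_simps)
qed simp

section \<open>Asymptotics\<close>

lemma threshold_at_top:
  assumes "d \<ge> 1"
  shows "filterlim (threshold d) at_top sequentially"
proof -
  define c where "c = real d"
  have "c > 0" "1 / c > 0" using assms by (auto simp: c_def)
  then have "filterlim (\<lambda>x. (c * ln x / ln (ln x)) powr (1 / c)) at_top at_top"
    by real_asymp
  from filterlim_compose[OF this filterlim_real_sequentially] show ?thesis
    by (simp add: threshold_def[abs_def] c_def)
qed

text \<open>\<open>l^d\<close> equals \<open>d ln n / ln ln n\<close>, while
  \<open>d ln l = ln (l^d)\<close> is asymptotic to \<open>ln ln n\<close>.\<close>

lemma threshold_power_ln:
  assumes "d \<ge> 1"
  shows "(\<lambda>n. threshold d n ^ d * ln (threshold d n) / ln (real n)) \<longlonglongrightarrow> 1"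
proof -
  define c where "c = real d"
  have c: "c > 0" using assms by (simp add: c_def)
  have root: "(y powr (1 / c)) ^ d = y" if "y > 0" for y :: real
    using that assms by (simp add: powr_power c_def)
  from c have "((\<lambda>x. ln (c * ln x / ln (ln x)) / ln (ln x)) \<longlongrightarrow> 1) at_top"
    by real_asymp
  then have "(\<lambda>n. ln (c * ln (real n) / ln (ln (real n))) / ln (ln (real n))) \<longlonglongrightarrow> 1"
    by (rule filterlim_compose) (rule filterlim_real_sequentially)
  moreover have "eventually (\<lambda>n. ln (c * ln (real n) / ln (ln (real n))) / ln (ln (real n)) =
      threshold d n ^ d * ln (threshold d n) / ln (real n)) sequentially"
  proof -
    have "eventually (\<lambda>n::nat. ln (real n) > 0 \<and> ln (ln (real n)) > 0) sequentially"
      by (intro eventually_conj; real_asymp)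
    then show ?thesis
    proof eventually_elim
      case (elim n)
      then have pos: "c * ln (real n) / ln (ln (real n)) > 0" using c by simp
      then have "threshold d n ^ d = c * ln (real n) / ln (ln (real n))"
        unfolding threshold_def c_def[symmetric] by (rule root)
      moreover have "ln (threshold d n) = ln (c * ln (real n) / ln (ln (real n))) / c"
        unfolding threshold_def c_def[symmetric] using pos by (simp add: ln_powr)
      ultimately show ?case using elim c by (simp add: field_simps)
    qed
  qed
  ultimately show ?thesis by (rule Lim_transform_eventually)
qed

text \<open>If the exponents \<open>z i\<close> stay away from 0, the telescoping bound \<open>z (i + 1) / z i \<ge> 1 + ln (z (i + 1) / z i)\<close>
  replaces the inequality of arithmetic and geometric means; a small \<open>z i\<close> forces a large later ratio.\<close>

lemma sum_ratios_ge:
  fixes \<epsilon> :: real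
  assumes d: "d \<ge> 1" and \<epsilon>: "\<epsilon> > 0"
  obtains q G :: nat where "2 \<le> q" "q - 1 \<le> G"
    "\<And>\<kappa> j. \<kappa> 0 = q - 1 \<Longrightarrow> 1 \<le> j \<Longrightarrow> j \<le> d \<Longrightarrow> (j = d \<and> \<kappa> d = q - 1) \<or> \<kappa> j = G \<Longrightarrow>
      real d - \<epsilon> \<le> (\<Sum>i<j. real (\<kappa> (Suc i)) / real (\<kappa> i + 3))"
proof -
  \<comment> \<open>\<open>b\<close> is the lower bound wanted for all \<open>z i\<close>: 6 makes
    \<open>z - 3 \<ge> z / 2\<close>, and the other term keeps the total loss \<open>3 d / b\<close>
    below \<open>\<epsilon>\<close>. \<open>q\<close> survives \<open>d\<close> divisions by
    \<open>2 d\<close>, and \<open>G\<close> exceeds \<open>z 0\<close> by the factor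
    \<open>exp d\<close>.\<close>
  define b where "b = max 6 (3 * real d / \<epsilon>)"
  define q where "q = max 2 (nat \<lceil>(2 * real d) ^ d * b\<rceil>)"
  define G where "G = nat \<lceil>real (q + 2) * exp (real d)\<rceil>"
  have q: "2 \<le> q" "(2 * real d) ^ d * b \<le> real q"
    unfolding q_def by (auto simp: le_max_iff_disj) linarith
  have G: "real (q + 2) * exp (real d) \<le> real G" unfolding G_def by linarith
  have "real (q + 2) * 1 \<le> real (q + 2) * exp (real d)" by (intro mult_left_mono) auto
  from order_trans[OF this G] have qG: "q + 2 \<le> G" by simp
  show ?thesis
  proof (rule that[of q G])
    show "2 \<le> q" "q - 1 \<le> G" using q qG by auto
    fix \<kappa> :: "nat \<Rightarrow> nat" and j
    assume \<kappa>: "\<kappa> 0 = q - 1" and j: "1 \<le> j" "j \<le> d" "(j = d \<and> \<kappa> d = q - 1) \<or> \<kappa> j = G"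
    define z where "z = (\<lambda>i. real (\<kappa> i + 3))"
    have z3: "z i \<ge> 3" for i by (simp add: z_def)
    have term_eq: "real (\<kappa> (Suc i)) / real (\<kappa> i + 3) = (z (Suc i) - 3) / z i" for i
      by (simp add: z_def)
    show "real d - \<epsilon> \<le> (\<Sum>i<j. real (\<kappa> (Suc i)) / real (\<kappa> i + 3))"
    \<comment> \<open>A single ratio of size \<open>d\<close> suffices. Otherwise, going back from
      \<open>j\<close>, \<open>z\<close> shrinks at most by the factor \<open>2 d\<close> per step
      and so never becomes small.\<close>
    proof (cases "\<exists>i<j. real d \<le> (z (Suc i) - 3) / z i")
      case True
      then obtain i where i: "i < j" "real d \<le> (z (Suc i) - 3) / z i" by blast
      have "real (\<kappa> (Suc i)) / real (\<kappa> i + 3) \<le> (\<Sum>i<j. real (\<kappa> (Suc i)) / real (\<kappa> i + 3))"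
        by (rule member_le_sum) (use i in auto)
      with i \<epsilon> show ?thesis unfolding term_eq by linarith
    next
      case False
      then have small: "z (Suc i) - 3 < real d * z i" if "i < j" for i
        using that z3[of i] by (simp add: not_le divide_less_eq)
      have zj: "real q \<le> z j" using j qG q by (auto simp: z_def)
      have b: "b \<ge> 6" "3 * real d / \<epsilon> \<le> b" by (auto simp: b_def)
      have chain: "real q / (2 * real d) ^ m \<le> z (j - m)" if "m \<le> j" for m
        using that
      proof (induction m)
        case 0
        then show ?case using zj by simp
      next
        case (Suc m)
        have IH: "real q / (2 * real d) ^ m \<le> z (j - m)" using Suc by simp
        have "(2 * real d) ^ m \<le> (2 * real d) ^ d" using Suc.prems j d by (intro power_increasing) auto
        then have "6 * (2 * real d) ^ m \<le> b * (2 * real d) ^ d" using b by (intro mult_mono) auto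
        also have "\<dots> \<le> real q" using q by (simp add: mult.commute)
        finally have "6 \<le> real q / (2 * real d) ^ m" using d by (simp add: pos_le_divide_eq)
        with IH have "z (j - m) / 2 \<le> z (j - m) - 3" by linarith
        also have "j - m = Suc (j - Suc m)" using Suc.prems by simp
        also have "z (Suc (j - Suc m)) - 3 < real d * z (j - Suc m)" using Suc.prems by (intro small) simp
        finally have "z (j - m) \<le> 2 * real d * z (j - Suc m)" using Suc.prems by (simp add: Suc_diff_Suc)
        with IH have "real q / (2 * real d) ^ m \<le> 2 * real d * z (j - Suc m)" by linarith
        then show ?case using d by (simp add: field_simps)
      qed
      have z_ge: "b \<le> z i" if "i \<le> j" for i
      proof -
        have "b \<le> real q / (2 * real d) ^ d" using q(2) d by (simp add: pos_le_divide_eq mult.commute)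
        also have "\<dots> \<le> real q / (2 * real d) ^ (j - i)"
          using d j by (intro divide_left_mono power_increasing) auto
        also have "\<dots> \<le> z (j - (j - i))" by (rule chain) simp
        finally show ?thesis using that by simp
      qed
      have "real j + (ln (z j) - ln (z 0)) - 3 * real j / b =
          (\<Sum>i<j. 1 + (ln (z (Suc i)) - ln (z i)) - 3 / b)"
        using sum_lessThan_telescope[of "\<lambda>i. ln (z i)" j] by (simp add: sum.distrib sum_subtractf)
      also have "\<dots> \<le> (\<Sum>i<j. real (\<kappa> (Suc i)) / real (\<kappa> i + 3))"
      proof (rule sum_mono)
        fix i assume "i \<in> {..<j}"
        then have "b \<le> z i" by (intro z_ge) auto
        then have "3 / z i \<le> 3 / b" using b by (intro divide_left_mono) auto
        moreover have "ln (z (Suc i) / z i) \<le> z (Suc i) / z i - 1"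
          by (rule ln_le_minus_one) (use z3[of i] z3[of "Suc i"] in \<open>auto intro!: divide_pos_pos\<close>)
        moreover have "ln (z (Suc i) / z i) = ln (z (Suc i)) - ln (z i)"
          using z3[of i] z3[of "Suc i"] by (subst ln_div) auto
        ultimately show "1 + (ln (z (Suc i)) - ln (z i)) - 3 / b \<le> real (\<kappa> (Suc i)) / real (\<kappa> i + 3)"
          unfolding term_eq by (simp add: diff_divide_distrib)
      qed
      finally have main: "real j + (ln (z j) - ln (z 0)) - 3 * real j / b \<le> (\<Sum>i<j. real (\<kappa> (Suc i)) / real (\<kappa> i + 3))" .
      have "3 * real j / b \<le> 3 * real d / b" using j b by (intro divide_right_mono) auto
      also have "\<dots> \<le> \<epsilon>" using b \<epsilon> by (simp add: field_simps)
      finally have err: "3 * real j / b \<le> \<epsilon>" .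
      have z0: "z 0 = real (q + 2)" using \<kappa> q by (simp add: z_def of_nat_diff)
      \<comment> \<open>At \<open>j = d\<close> the logarithms cancel; after an early stop at
        \<open>G\<close> their difference alone is at least \<open>d\<close>.\<close>
      have "real d \<le> real j + (ln (z j) - ln (z 0))"
        using j(3)
      proof
        assume "j = d \<and> \<kappa> d = q - 1"
        then show ?thesis using \<kappa> by (simp add: z_def)
      next
        assume "\<kappa> j = G"
        then have "real (q + 2) * exp (real d) \<le> z j" using G by (simp add: z_def)
        then have "ln (real (q + 2) * exp (real d)) \<le> ln (z j)"
          by (intro ln_mono) auto
        also have "ln (real (q + 2) * exp (real d)) = ln (z 0) + real d"
          unfolding z0 by (subst ln_mult) auto
        finally show ?thesis by simp
      qed
      with main err show ?thesis by linarith
    qed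
  qed
qed

section \<open>Choice of the parameters\<close>

context allocation_pools
begin

text \<open>The bound on the balls reaching level \<open>i\<close> has exponent
  \<open>1 - i \<eta>\<close>: each level gives away \<open>\<eta>\<close> as room for Markov's
  inequality. \<open>\<eta>\<close> solves
  \<open>(1 - d \<eta>) (1 + \<epsilon>) = 1 + \<epsilon> / 2\<close>, so the last exponent still
  beats \<open>ln n\<close>.\<close>

lemma prob_max_load_threshold_greater:
  fixes \<epsilon> \<rho> l :: real
  defines "\<eta> \<equiv> \<epsilon> / (2 * real d * (1 + \<epsilon>))"
  assumes d: "d \<ge> 1" and \<epsilon>: "\<epsilon> > 0" and \<rho>: "\<rho> > 0" and l: "l \<ge> exp 1" "\<rho> * exp 1 \<le> l powr \<eta>"
    and N: "real N \<le> \<rho> * real n"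
  shows "prob {\<omega> \<in> space M. (real d + \<epsilon>) * l < real (max_load n d (threshold_strategy l) Z N \<omega>)}
    \<le> real d * exp (- \<eta> * l) + real n * exp (- ((1 + \<epsilon> / 2) * (l ^ d * ln l)))"
proof -
  have n: "n \<ge> 1" by (rule n_pos[OF d])
  have l1: "l \<ge> 1" "l > 0" "ln l \<ge> 1" "l \<ge> 0"
  proof -
    show "l \<ge> 1" using l(1) exp_ge_add_one_self[of 1] by linarith
    then show "l > 0" "l \<ge> 0" by auto
    then show "ln l \<ge> 1" using l(1) by (simp add: ln_ge_iff)
  qed
  have \<eta>: "\<eta> > 0" "(1 - real d * \<eta>) * (1 + \<epsilon>) = 1 + \<epsilon> / 2" "real d * \<eta> \<le> 1"
  proof -
    have d\<eta>: "real d * \<eta> = \<epsilon> / (2 * (1 + \<epsilon>))" using d by (simp add: \<eta>_def)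
    show "\<eta> > 0" unfolding \<eta>_def using d \<epsilon> by (intro divide_pos_pos mult_pos_pos) auto
    show "(1 - real d * \<eta>) * (1 + \<epsilon>) = 1 + \<epsilon> / 2" "real d * \<eta> \<le> 1"
      unfolding d\<eta> using \<epsilon> by (simp_all add: field_simps)
  qed
  define w where "w = (\<lambda>i. exp (- ((1 - real i * \<eta>) * (l ^ (i - 1) * ln l))))"
  define R where "R = (\<lambda>i. if i = 1 then \<rho> * real n else real n * w i)"
  define k where "k = nat \<lfloor>l\<rfloor>"
  define L where "L = nat \<lceil>(1 + \<epsilon>) * l\<rceil>"
  define r where "r = (\<lambda>i. nat \<lfloor>R i\<rfloor>)"
  have R_pos: "0 < R i" for i using \<rho> n by (simp add: R_def w_def)
  have coef: "0 \<le> 1 - real i * \<eta>" if "i \<le> d" for i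
  proof -
    have "real i * \<eta> \<le> real d * \<eta>" using that \<eta> by (intro mult_right_mono) auto
    with \<eta>(3) show ?thesis by simp
  qed
  \<comment> \<open>A collision of \<open>K \<ge> c l\<close> offers raises \<open>w i\<close> to
    the power \<open>K\<close>, which turns \<open>l^(i - 1)\<close> in the exponent into
    \<open>c l^i\<close>. The factor \<open>e\<close> is absorbed by \<open>l \<ge> e\<close>, and
    at level 1 together with \<open>\<rho>\<close> by \<open>l powr \<eta>\<close>.\<close>
  have collisions: "real (r i choose K) / real n ^ K \<le> exp (- ((1 - real i * \<eta>) * (l ^ i * ln l)) * c)"
    if i: "1 \<le> i" "i \<le> d" and K: "c * l \<le> real K" "c \<ge> 1" for i K c
  proof -
    have "l \<le> c * l" using K(2) l1 by (simp add: mult_le_cancel_right1)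
    then have lK: "l \<le> real K" using K by simp
    have r: "real (r i) \<le> R i" using R_pos[of i] by (simp add: r_def)
    have "real (r i) / real n * exp 1 \<le> R i / real n * exp 1"
      using r n by (intro mult_right_mono divide_right_mono) auto
    also have "\<dots> \<le> w i * l"
    proof (cases "i = 1")
      case True
      have "w 1 * l = l powr (\<eta> - 1) * l"
        using l1 by (simp add: w_def powr_def algebra_simps)
      also have "\<dots> = l powr \<eta>"
        using l1 by (simp add: powr_diff)
      finally show ?thesis using l(2) True n by (simp add: R_def)
    next
      case False
      then show ?thesis using l(1) n by (simp add: R_def w_def)
    qed
    also have "\<dots> \<le> w i * real K" using lK by (intro mult_left_mono) (auto simp: w_def)
    finally have "real (r i choose K) / real n ^ K \<le> w i ^ K" by (rule choose_div_power_le[OF n])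
    also have "\<dots> = exp (- ((1 - real i * \<eta>) * (l ^ (i - 1) * ln l) * real K))"
      by (simp add: w_def exp_of_nat_mult[symmetric] algebra_simps)
    also have "\<dots> \<le> exp (- ((1 - real i * \<eta>) * (l ^ (i - 1) * ln l) * (c * l)))"
      using K coef[OF i(2)] l1 by (simp add: mult_left_mono mult_nonneg_nonneg)
    also have "(1 - real i * \<eta>) * (l ^ (i - 1) * ln l) * (c * l) = (1 - real i * \<eta>) * (l ^ i * ln l) * c"
      using i by (cases i) (auto simp: algebra_simps)
    finally show ?thesis by simp
  qed
  have Suc_k: "1 * l \<le> real (Suc k)" and k_le: "real k \<le> l"
    unfolding k_def using l1 by linarith+
  have L: "(1 + \<epsilon>) * l \<le> real L" "real L < (1 + \<epsilon>) * l + 1"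
    unfolding L_def using l1 \<epsilon> by (auto simp: of_nat_nat intro!: real_nat_ceiling_ge) linarith?
  have step: "n * real (r i choose Suc k) / n ^ Suc k / R (Suc i) \<le> exp (- \<eta> * l)"
    if i: "i \<in> {1..<d}" for i
  proof -
    have "n * real (r i choose Suc k) / n ^ Suc k / R (Suc i) = real (r i choose Suc k) / real n ^ Suc k / w (Suc i)"
      using i n by (simp add: R_def)
    also have "\<dots> \<le> exp (- ((1 - real i * \<eta>) * (l ^ i * ln l)) * 1) / w (Suc i)"
      by (intro divide_right_mono collisions Suc_k) (use i in \<open>auto simp: w_def\<close>)
    also have "\<dots> = exp (- (\<eta> * (l ^ i * ln l)))"
      by (simp add: w_def exp_diff[symmetric] algebra_simps)
    also have "\<dots> \<le> exp (- \<eta> * l)"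
    proof -
      have "l * 1 \<le> l ^ i * ln l"
        using i l1 self_le_power[of l i] by (intro mult_mono) auto
      then show ?thesis using \<eta>(1) by simp
    qed
    finally show ?thesis .
  qed
  have last: "n * real (r d choose L) / n ^ L \<le> real n * exp (- ((1 + \<epsilon> / 2) * (l ^ d * ln l)))"
  proof -
    have "real (r d choose L) / real n ^ L \<le> exp (- ((1 - real d * \<eta>) * (l ^ d * ln l)) * (1 + \<epsilon>))"
      by (intro collisions L) (use d \<epsilon> in auto)
    also have "(1 - real d * \<eta>) * (l ^ d * ln l) * (1 + \<epsilon>) = (1 + \<epsilon> / 2) * (l ^ d * ln l)"
      unfolding \<eta>(2)[symmetric] by (simp add: mult_ac)
    then have "- ((1 - real d * \<eta>) * (l ^ d * ln l)) * (1 + \<epsilon>) = - ((1 + \<epsilon> / 2) * (l ^ d * ln l))"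
      by simp
    finally have "real n * (real (r d choose L) / real n ^ L) \<le> real n * exp (- ((1 + \<epsilon> / 2) * (l ^ d * ln l)))"
      by (intro mult_left_mono) auto
    then show ?thesis by simp
  qed
  have det: "nonanticipating (threshold_strategy l)"
    by (rule nonanticipating_deterministic[OF d]) (simp add: threshold_strategy_def)
  have "prob {\<omega> \<in> space M. (real d + \<epsilon>) * l < real (max_load n d (threshold_strategy l) Z N \<omega>)}
    \<le> prob {\<omega> \<in> space M. (d - 1) * k + L \<le> max_load n d (threshold_strategy l) Z N \<omega>}"
  proof (rule finite_measure_mono)
    show "{\<omega> \<in> space M. (d - 1) * k + L \<le> max_load n d (threshold_strategy l) Z N \<omega>} \<in> events"
      using measurable_max_load[OF det, of N] by measurable
    have "(d - 1) * k + L \<le> X" if "(real d + \<epsilon>) * l < real X" for X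
    proof -
      have "real ((d - 1) * k + L) = (real d - 1) * real k + real L" using d by (simp add: of_nat_diff)
      also have "\<dots> \<le> (real d - 1) * l + real L"
        using d k_le by (intro add_right_mono mult_left_mono) auto
      also have "\<dots> < (real d + \<epsilon>) * l + 1" using L(2) by (simp add: algebra_simps)
      also have "\<dots> < real X + 1" using that by simp
      finally show ?thesis by linarith
    qed
    then show "{\<omega> \<in> space M. (real d + \<epsilon>) * l < real (max_load n d (threshold_strategy l) Z N \<omega>)}
        \<subseteq> {\<omega> \<in> space M. (d - 1) * k + L \<le> max_load n d (threshold_strategy l) Z N \<omega>}" by blast
  qed
  also have "\<dots> \<le> (\<Sum>i\<in>{1..<d}. n * real (r i choose Suc k) / n ^ Suc k / R (Suc i)) + n * real (r d choose L) / n ^ L"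
    unfolding k_def r_def
    by (rule prob_max_load_threshold_ge[OF d l1(4)]) (use R_pos N in \<open>auto simp: R_def\<close>)
  also have "\<dots> \<le> (\<Sum>i\<in>{1..<d}. exp (- \<eta> * l)) + real n * exp (- ((1 + \<epsilon> / 2) * (l ^ d * ln l)))"
    by (intro add_mono sum_mono step last)
  also have "(\<Sum>i\<in>{1..<d}. exp (- \<eta> * l)) \<le> real d * exp (- \<eta> * l)"
    by (simp add: mult_right_mono)
  finally show ?thesis by simp
qed

end

text \<open>All counts are \<open>n\<close> times an exponential, with exponents measured in
  \<open>\<Lambda> i = l^i ln l\<close>. Since \<open>\<Lambda> (i + 1) = l \<Lambda> i\<close>,
  dividing by \<open>\<Lambda> i\<close> turns the gain at every level into the same condition
  \<open>gain_cond\<close>.\<close>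

lemma (in allocation_pools) prob_max_load_nonanticipating_less:
  fixes \<epsilon> \<rho> l :: real and q G K :: nat
  assumes f: "nonanticipating f" and d: "d \<ge> 1" and \<rho>: "\<rho> > 0" and q: "2 \<le> q" "q - 1 \<le> G"
    and ratios: "\<And>\<kappa> j. \<kappa> 0 = q - 1 \<Longrightarrow> 1 \<le> j \<Longrightarrow> j \<le> d \<Longrightarrow> (j = d \<and> \<kappa> d = q - 1) \<or> \<kappa> j = G \<Longrightarrow>
      real d - \<epsilon> \<le> (\<Sum>i<j. real (\<kappa> (Suc i)) / real (\<kappa> i + 3))"
    and K: "d * card (profiles d q G) \<le> K" "K \<ge> 1" "\<rho> \<le> real K"
    and N: "N = nat \<lfloor>\<rho> * real n\<rfloor>"
    and l: "l \<ge> exp 1" "2 * real G \<le> l"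
    and gain_cond: "\<And>j k. j \<le> G \<Longrightarrow> 1 \<le> k \<Longrightarrow> k \<le> G \<Longrightarrow>
      (real k / real (j + 3) * l + 1) * (real (j + 2) / real q + ln 2 / ln l) + real G + ln 4 / ln l
        \<le> real k / real q * l"
    and first_cond: "(real G * l + 1) * (l powr (- (1 + 1 / real q)) + 1 / real n) + 3 / real n \<le> \<rho> / real K"
    and later_cond: "(real G * l + 1) * exp (- l / real q) \<le> 1 / 2"
      "2 * (real G * l + 2) \<le> real n * exp (- ((1 - 1 / real q) * (l ^ d * ln l)))"
  shows "prob {\<omega> \<in> space M. real (max_load n d f Z N \<omega>) < (real d - \<epsilon>) * l} \<le>
    real (K * d * card (profiles d q G)) * (2 * (exp ((1 - 1 / real q) * (l ^ d * ln l)) / real n))"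
proof -
  have n: "n \<ge> 1" by (rule n_pos[OF d])
  have l1: "l \<ge> 1" "l > 0" "ln l \<ge> 1" "l \<ge> 0"
  proof -
    show "l \<ge> 1" using l(1) exp_ge_add_one_self[of 1] by linarith
    then show "l > 0" "l \<ge> 0" by auto
    then show "ln l \<ge> 1" using l(1) by (simp add: ln_ge_iff)
  qed
  have q0: "real q > 0" using q by simp
  define \<Lambda> where "\<Lambda> = (\<lambda>i. l ^ i * ln l)"
  have \<Lambda>_ge: "ln l \<le> \<Lambda> i" for i
    using l1 by (simp add: \<Lambda>_def mult_le_cancel_right1)
  have \<Lambda>_pos: "0 < \<Lambda> i" for i using \<Lambda>_ge[of i] l1 by linarith
  have \<Lambda>_Suc: "\<Lambda> (Suc i) = l * \<Lambda> i" for i by (simp add: \<Lambda>_def)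
  have \<Lambda>_mono: "\<Lambda> i \<le> \<Lambda> j" if "i \<le> j" for i j
    unfolding \<Lambda>_def using that l1 by (intro mult_right_mono power_increasing) auto
  \<comment> \<open>More than \<open>thr i (Suc j)\<close> balls must provide \<open>x j k\<close>
    rounds of \<open>u i j\<close> offers; exponent \<open>j + 2\<close> instead of
    \<open>j + 1\<close> leaves room for order \<open>l\<close> rounds. A round then costs
    \<open>(j + 2) / q\<close>, and the denominator \<open>j + 3\<close> keeps the total strictly
    below \<open>k / q\<close>.\<close>
  define x where "x = (\<lambda>j k. nat \<lceil>real k / real (j + 3) * l\<rceil>)"
  define u where "u = (\<lambda>i j. nat \<lceil>real n * exp (- (real (j + 2) / real q * \<Lambda> i))\<rceil>)"
  define thr where "thr = (\<lambda>i k. real n * exp (- (real k / real q * \<Lambda> i)))"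
  \<comment> \<open>Below \<open>d\<close> the exponent \<open>G\<close> exceeds all
    \<open>k / q\<close>, so keeping \<open>a i\<close> high bins costs no more than the rejections
    do. At \<open>d\<close>, where nothing is rejected, \<open>a d\<close> has the grid exponent of
    \<open>k = q - 1\<close>.\<close>
  define a where "a = (\<lambda>i. real n * exp (- ((if i < d then real G else 1 - 1 / real q) * \<Lambda> i)))"
  define \<tau> where "\<tau> = N div K"
  have Suc_q: "real (q - 1) / real q = 1 - 1 / real q" using q by (simp add: of_nat_diff field_simps)
  have Nn: "real N \<le> \<rho> * real n" unfolding N using \<rho> by simp
  have x_bounds: "real k / real (j + 3) * l \<le> real (x j k)" "real (x j k) \<le> real k / real (j + 3) * l + 1" for j k
  proof -
    have "0 \<le> real k / real (j + 3) * l" using l1 by simp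
    then show "real k / real (j + 3) * l \<le> real (x j k)" "real (x j k) \<le> real k / real (j + 3) * l + 1"
      unfolding x_def by linarith+
  qed
  have x_le: "real (x j k) \<le> real G * l + 1" if "k \<le> G" for j k
  proof -
    have "real k / real (j + 3) \<le> real k / 1" by (intro divide_left_mono) auto
    also have "\<dots> \<le> real G" using that by simp
    finally have "real k / real (j + 3) * l \<le> real G * l" using l1 by (intro mult_right_mono) auto
    with x_bounds(2)[of j k] show ?thesis by linarith
  qed
  have u_ge: "real n * exp (- (real (j + 2) / real q * \<Lambda> i)) \<le> real (u i j)"
    and u_le: "real (u i j) \<le> real n * exp (- (real (j + 2) / real q * \<Lambda> i)) + 1" for i j
  proof -
    have "0 < real n * exp (- (real (j + 2) / real q * \<Lambda> i))" using n by simp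
    then show "real n * exp (- (real (j + 2) / real q * \<Lambda> i)) \<le> real (u i j)"
      "real (u i j) \<le> real n * exp (- (real (j + 2) / real q * \<Lambda> i)) + 1"
      unfolding u_def by linarith+
  qed
  \<comment> \<open>\<open>a d\<close> is the smallest of these counts: \<open>l \<ge> 2 G\<close>
    and \<open>1 - 1 / q \<ge> 1 / 2\<close> make the step from \<open>\<Lambda> (d - 1)\<close> to
    \<open>\<Lambda> d\<close> outweigh \<open>G\<close>.\<close>
  have ad_le: "a d \<le> real n * exp (- (real G * \<Lambda> i))" if "i < d" for i
  proof -
    have "1 / real q \<le> 1 / 2" using q by (intro divide_left_mono) auto
    then have "1 / 2 \<le> 1 - 1 / real q" by simp
    then have "l / 2 \<le> (1 - 1 / real q) * l"
      using mult_right_mono[of "1/2" "1 - 1 / real q" l] l1 by simp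
    with l(2) have "real G \<le> (1 - 1 / real q) * l" by linarith
    then have "real G * \<Lambda> (d - 1) \<le> (1 - 1 / real q) * l * \<Lambda> (d - 1)"
      using \<Lambda>_pos[of "d - 1"] by (intro mult_right_mono) auto
    also have "\<dots> = (1 - 1 / real q) * \<Lambda> d" using \<Lambda>_Suc[of "d - 1"] d by simp
    finally have "real G * \<Lambda> (d - 1) \<le> (1 - 1 / real q) * \<Lambda> d" .
    moreover have "real G * \<Lambda> i \<le> real G * \<Lambda> (d - 1)"
      using that by (intro mult_left_mono \<Lambda>_mono) auto
    ultimately show ?thesis using n by (simp add: a_def)
  qed
  have "prob {\<omega> \<in> space M. real (max_load n d f Z N \<omega>) < (real d - \<epsilon>) * l} \<le>
    real (K * d * card (profiles d q G)) * (2 * (1 / a d))"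
  proof (rule prob_max_load_less[OF f d q K(1,2), where \<tau> = \<tau> and x = x and u = u and a = a and thr = thr])
    show "K * \<tau> \<le> N" by (simp add: \<tau>_def)
    show "x j 0 = 0" for j by (simp add: x_def)
    show "real \<tau> \<le> thr i 0" for i
    proof -
      have "real \<tau> \<le> real N / real K" unfolding \<tau>_def by (rule of_nat_div_le_of_nat)
      also have "\<dots> \<le> \<rho> * real n / real K" using Nn by (intro divide_right_mono) auto
      also have "\<dots> \<le> real n" using K n by (simp add: field_simps mult_right_mono)
      finally show ?thesis by (simp add: thr_def)
    qed
    show "a 0 \<le> real n" using d n \<Lambda>_pos[of 0] by (simp add: a_def)
    show "0 < a i" for i using n by (simp add: a_def)
    show "a (Suc i) \<le> a i" if "Suc i < d" for i
      using that n \<Lambda>_mono[of i "Suc i"] by (simp add: a_def mult_left_mono)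
    show "0 \<le> thr i k" for i k by (simp add: thr_def)
    show "1 \<le> u i j \<and> u i j \<le> n" for i j
    proof -
      have "0 < real n * exp (- (real (j + 2) / real q * \<Lambda> i))" using n by simp
      with u_ge[of j i] have "0 < real (u i j)" by linarith
      moreover have "real n * exp (- (real (j + 2) / real q * \<Lambda> i)) \<le> real n * 1"
        using \<Lambda>_pos[of i] by (intro mult_left_mono) auto
      then have "u i j \<le> n" unfolding u_def by (simp add: ceiling_le_iff nat_le_iff)
      ultimately show ?thesis by simp
    qed
    show "1 / a i \<le> 1 / a d" if "1 \<le> i" "i \<le> d" for i
    proof -
      have "a d \<le> a i" using ad_le[of i] that by (cases "i = d") (auto simp: a_def)
      then show ?thesis using n by (intro divide_left_mono) (auto simp: a_def)
    qed
    show "x (q - 1) k * u 0 (q - 1) + 1 \<le> \<tau>" if "1 \<le> k" "k \<le> G" for k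
    proof -
      have "real (q - 1 + 2) / real q * \<Lambda> 0 = (1 + 1 / real q) * ln l"
        using q by (simp add: \<Lambda>_def of_nat_diff field_simps)
      moreover have "l powr (- (1 + 1 / real q)) = exp (- ((1 + 1 / real q) * ln l))"
        using l1 by (simp add: powr_def algebra_simps)
      ultimately have "exp (- (real (q - 1 + 2) / real q * \<Lambda> 0)) = l powr (- (1 + 1 / real q))"
        by (simp only:)
      with u_le[of 0 "q - 1"] have u: "real (u 0 (q - 1)) \<le> real n * l powr (- (1 + 1 / real q)) + 1"
        by simp
      \<comment> \<open>Of the 3, one is the skipped pool position and two cover the roundings in
        \<open>N\<close> and \<open>N div K\<close>.\<close>
      have "real (x (q - 1) k) * real (u 0 (q - 1)) + 3
          \<le> (real G * l + 1) * (real n * l powr (- (1 + 1 / real q)) + 1) + 3"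
        by (intro add_right_mono mult_mono x_le u) (use that l1 in auto)
      also have "\<dots> = ((real G * l + 1) * (l powr (- (1 + 1 / real q)) + 1 / real n) + 3 / real n) * real n"
        using n by (simp add: algebra_simps)
      also have "\<dots> \<le> \<rho> / real K * real n" by (intro mult_right_mono first_cond) auto
      finally have 1: "real (x (q - 1) k) * real (u 0 (q - 1)) + 3 \<le> \<rho> * real n / real K" by simp
      have "real N / real K - 1 \<le> real \<tau>"
        unfolding \<tau>_def using floor_divide_of_nat_eq[where 'a = real, of N K] by linarith
      moreover have "\<rho> * real n / real K - 1 \<le> real N / real K"
      proof -
        have "\<rho> * real n - 1 \<le> real N" unfolding N by linarith
        then have "(\<rho> * real n - 1) / real K \<le> real N / real K" by (intro divide_right_mono) auto
        moreover have "1 / real K \<le> 1" using K by simp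
        ultimately show ?thesis by (simp add: diff_divide_distrib)
      qed
      ultimately have "real (x (q - 1) k * u 0 (q - 1) + 1) \<le> real \<tau>" using 1 by simp
      then show ?thesis by (simp only: of_nat_le_iff)
    qed
    \<comment> \<open>Half of \<open>thr i (Suc j)\<close> pays for the rounds, as
      \<open>exp (- \<Lambda> i / q)\<close> beats their number; the other half covers the rounding
      of \<open>u\<close> and the extra 1.\<close>
    show "real (x j k * u i j + 1) \<le> thr i (Suc j)" if i: "1 \<le> i" "i < d" and jk: "j < G" "k \<le> G" for i j k
    proof -
      let ?e = "exp (- (real (j + 1) / real q * \<Lambda> i))"
      have eq: "exp (- (real (j + 2) / real q * \<Lambda> i)) = ?e * exp (- \<Lambda> i / real q)"
        by (simp add: exp_add[symmetric] add_divide_distrib algebra_simps)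
      have "l \<le> \<Lambda> i"
        unfolding \<Lambda>_def using mult_mono[of l "l ^ i" 1 "ln l"] self_le_power[of l i] l1 i by simp
      then have "exp (- \<Lambda> i / real q) \<le> exp (- l / real q)" using q0 by (simp add: divide_right_mono)
      then have "(real G * l + 1) * exp (- \<Lambda> i / real q) \<le> (real G * l + 1) * exp (- l / real q)"
        using l1 by (intro mult_left_mono) auto
      with later_cond(1) have half: "(real G * l + 1) * exp (- \<Lambda> i / real q) \<le> 1 / 2" by linarith
      have "real (x j k) * real (u i j) \<le> (real G * l + 1) * (real n * (?e * exp (- \<Lambda> i / real q)) + 1)"
        using u_le[of i j] unfolding eq by (intro mult_mono x_le jk) (use l1 in auto)
      also have "\<dots> = real n * ?e * ((real G * l + 1) * exp (- \<Lambda> i / real q)) + (real G * l + 1)"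
        by (simp add: algebra_simps)
      also have "\<dots> \<le> real n * ?e * (1 / 2) + (real G * l + 1)"
        by (intro add_right_mono mult_left_mono half) auto
      finally have 1: "real (x j k) * real (u i j) + 1 \<le> real n * ?e / 2 + (real G * l + 2)" by simp
      have "2 * (real G * l + 2) \<le> a d" using later_cond(2) by (simp add: a_def \<Lambda>_def)
      also have "\<dots> \<le> real n * exp (- (real G * \<Lambda> i))" by (rule ad_le[OF i(2)])
      also have "\<dots> \<le> real n * ?e"
      proof -
        have "real (j + 1) / real q \<le> real (j + 1) / 1" using q by (intro divide_left_mono) auto
        also have "\<dots> \<le> real G" using jk by simp
        finally have "real (j + 1) / real q * \<Lambda> i \<le> real G * \<Lambda> i"
          using \<Lambda>_pos[of i] by (intro mult_right_mono) auto
        then show ?thesis by (intro mult_left_mono) auto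
      qed
      finally show ?thesis using 1 by (simp add: thr_def)
    qed
    show "a (Suc i) + (if Suc i = d then 0 else thr (Suc i) k)
          \<le> a i * (real (u i j) / (2 * real n)) ^ x j k / 2"
      if i: "i < d" and jk: "j \<le> G" "1 \<le> k" "k \<le> G" and top: "Suc i = d \<Longrightarrow> k = q - 1" for i j k
    proof -
      have "a (Suc i) + (if Suc i = d then 0 else thr (Suc i) k) \<le> 2 * thr (Suc i) k"
      proof (cases "Suc i = d")
        case True
        then have "thr (Suc i) k = a d" unfolding thr_def a_def top[OF True] Suc_q by simp
        moreover have "0 < a d" using n by (simp add: a_def)
        ultimately show ?thesis using True by simp
      next
        case False
        have "real k / real q \<le> real k / 1" using q by (intro divide_left_mono) auto
        also have "\<dots> \<le> real G" using jk by simp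
        finally have "real k / real q * \<Lambda> (Suc i) \<le> real G * \<Lambda> (Suc i)"
          using \<Lambda>_pos[of "Suc i"] by (intro mult_right_mono) auto
        then have "a (Suc i) \<le> thr (Suc i) k" using False i by (simp add: a_def thr_def mult_left_mono)
        then show ?thesis using False by simp
      qed
      \<comment> \<open>One factor 2 comes from adding high bins and rejections, the other from
        keeping only half of the expected number of hit bins.\<close>
      also have "4 * thr (Suc i) k \<le> a i * (real (u i j) / (2 * real n)) ^ x j k"
      proof -
        define y where "y = real (j + 2) / real q * \<Lambda> i + ln 2"
        have y0: "0 \<le> y" using \<Lambda>_pos[of i] by (simp add: y_def)
        have "exp (- y) = exp (- (real (j + 2) / real q * \<Lambda> i)) / 2"
          by (simp add: y_def exp_diff exp_minus field_simps exp_add)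
        also have "\<dots> \<le> real (u i j) / (2 * real n)"
          using u_ge[of j i] n by (simp add: field_simps)
        finally have "exp (- y) ^ x j k \<le> (real (u i j) / (2 * real n)) ^ x j k" by (intro power_mono) auto
        moreover have "exp (- y) ^ x j k = exp (- (real (x j k) * y))" by (simp add: exp_of_nat_mult[symmetric])
        moreover have "exp (- ((real k / real (j + 3) * l + 1) * y)) \<le> exp (- (real (x j k) * y))"
          using mult_right_mono[OF x_bounds(2)[of j k] y0] by simp
        ultimately have pow: "exp (- ((real k / real (j + 3) * l + 1) * y)) \<le> (real (u i j) / (2 * real n)) ^ x j k"
          by linarith
        \<comment> \<open>Additive constants are rewritten as multiples of
          \<open>\<Lambda> i \<ge> ln l\<close>, so that \<open>\<Lambda> i\<close> can be factored
          out.\<close>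
        have ln_ratio: "c \<le> c / ln l * \<Lambda> i" if "c \<ge> 0" for c
        proof -
          have "c / ln l * ln l \<le> c / ln l * \<Lambda> i"
            using that l1 \<Lambda>_ge by (intro mult_left_mono) auto
          moreover have "c / ln l * ln l = c" using l1(3) by auto
          ultimately show ?thesis by linarith
        qed
        have "ln 4 + real G * \<Lambda> i + (real k / real (j + 3) * l + 1) * y
            \<le> ln 4 / ln l * \<Lambda> i + real G * \<Lambda> i + (real k / real (j + 3) * l + 1) * (real (j + 2) / real q * \<Lambda> i + ln 2 / ln l * \<Lambda> i)"
          unfolding y_def using l1 by (intro add_mono mult_left_mono ln_ratio order_refl) auto
        also have "\<dots> = ((real k / real (j + 3) * l + 1) * (real (j + 2) / real q + ln 2 / ln l) + real G + ln 4 / ln l) * \<Lambda> i"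
          by (simp only: algebra_simps)
        also have "\<dots> \<le> real k / real q * l * \<Lambda> i"
          using \<Lambda>_pos[of i] by (intro mult_right_mono gain_cond jk) auto
        finally have "ln 4 + real G * \<Lambda> i + (real k / real (j + 3) * l + 1) * y \<le> real k / real q * \<Lambda> (Suc i)"
          by (simp add: \<Lambda>_Suc)
        then have "exp (ln 4 - real k / real q * \<Lambda> (Suc i)) \<le> exp (- (real G * \<Lambda> i) + - ((real k / real (j + 3) * l + 1) * y))"
          by simp
        then have "4 * exp (- (real k / real q * \<Lambda> (Suc i))) \<le>
            exp (- (real G * \<Lambda> i)) * exp (- ((real k / real (j + 3) * l + 1) * y))"
          unfolding exp_add by (simp add: exp_diff exp_minus field_simps)
        also have "\<dots> \<le> exp (- (real G * \<Lambda> i)) * (real (u i j) / (2 * real n)) ^ x j k"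
          using pow by (intro mult_left_mono) auto
        finally have "real n * (4 * exp (- (real k / real q * \<Lambda> (Suc i)))) \<le>
            real n * (exp (- (real G * \<Lambda> i)) * (real (u i j) / (2 * real n)) ^ x j k)"
          by (intro mult_left_mono) auto
        then show ?thesis using i by (simp add: thr_def a_def mult_ac)
      qed
      then have "2 * thr (Suc i) k \<le> a i * (real (u i j) / (2 * real n)) ^ x j k / 2" by simp
      finally show ?thesis .
    qed
    show "(real d - \<epsilon>) * l \<le> real (\<Sum>i<j. x (\<kappa> i) (\<kappa> (Suc i)))"
      if "\<kappa> \<in> profiles d q G" "1 \<le> j" "j \<le> d" "j = d \<or> \<kappa> j = G" for \<kappa> j
    proof -
      have "(real d - \<epsilon>) * l \<le> (\<Sum>i<j. real (\<kappa> (Suc i)) / real (\<kappa> i + 3)) * l"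
        by (intro mult_right_mono ratios) (use that l1 in \<open>auto simp: profiles_def\<close>)
      also have "\<dots> \<le> (\<Sum>i<j. real (x (\<kappa> i) (\<kappa> (Suc i))))"
        unfolding sum_distrib_right by (intro sum_mono x_bounds)
      finally show ?thesis by simp
    qed
  qed
  also have "1 / a d = exp ((1 - 1 / real q) * (l ^ d * ln l)) / real n"
    by (simp add: a_def \<Lambda>_def exp_minus field_simps)
  finally show ?thesis .
qed

section \<open>Passage to the limit\<close>

lemma max_load_threshold_upper_tail:
  fixes \<epsilon> \<rho> :: real
  assumes d: "d \<ge> 1" and \<rho>: "\<rho> > 0" and \<epsilon>: "\<epsilon> > 0"
    and pools: "\<And>n. n \<ge> 3 \<Longrightarrow> allocation_pools (M n) n d (Z n)"
  shows "(\<lambda>n. measure (M n) {\<omega> \<in> space (M n). (real d + \<epsilon>) * threshold d n <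
    real (max_load n d (threshold_strategy (threshold d n)) (Z n) (nat \<lfloor>\<rho> * real n\<rfloor>) \<omega>)}) \<longlonglongrightarrow> 0"
proof -
  define \<eta> where "\<eta> = \<epsilon> / (2 * real d * (1 + \<epsilon>))"
  have \<eta>: "\<eta> > 0" using d \<epsilon> by (auto simp: \<eta>_def intro!: divide_pos_pos mult_pos_pos)
  \<comment> \<open>Eventually \<open>l^d ln l \<ge> \<theta> ln n\<close>, which leaves
    \<open>n powr (- \<epsilon> / 4)\<close> after the union over \<open>n\<close> bins.\<close>
  define \<theta> where "\<theta> = (1 + \<epsilon> / 4) / (1 + \<epsilon> / 2)"
  have \<theta>: "\<theta> < 1" "(1 + \<epsilon> / 2) * \<theta> = 1 + \<epsilon> / 4" using \<epsilon> by (auto simp: \<theta>_def field_simps)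
  have l_top: "filterlim (threshold d) at_top sequentially" by (rule threshold_at_top[OF d])
  have "((\<lambda>l. real d * exp (- \<eta> * l)) \<longlongrightarrow> 0) at_top" using \<eta> by real_asymp
  from filterlim_compose[OF this l_top]
  have lim1: "(\<lambda>n. real d * exp (- \<eta> * threshold d n)) \<longlonglongrightarrow> 0" .
  have lim2: "(\<lambda>n::nat. real n powr (- \<epsilon> / 4)) \<longlonglongrightarrow> 0" using \<epsilon> by real_asymp
  have ev1: "eventually (\<lambda>l::real. \<rho> * exp 1 \<le> l powr \<eta>) at_top" using \<eta> by real_asymp
  have bound: "eventually (\<lambda>n. measure (M n) {\<omega> \<in> space (M n). (real d + \<epsilon>) * threshold d n <
      real (max_load n d (threshold_strategy (threshold d n)) (Z n) (nat \<lfloor>\<rho> * real n\<rfloor>) \<omega>)}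
      \<le> real d * exp (- \<eta> * threshold d n) + real n powr (- \<epsilon> / 4)) sequentially"
    using eventually_ge_at_top[of 3] eventually_compose_filterlim[OF ev1 l_top]
      eventually_compose_filterlim[OF eventually_ge_at_top[of "exp 1"] l_top]
      order_tendstoD(1)[OF threshold_power_ln[OF d] \<theta>(1)]
  proof eventually_elim
    case (elim n)
    interpret allocation_pools "M n" n d "Z n" using elim pools by simp
    let ?l = "threshold d n"
    have n: "real n > 0" "ln (real n) > 0" using elim by auto
    have "prob {\<omega> \<in> space (M n). (real d + \<epsilon>) * ?l <
        real (max_load n d (threshold_strategy ?l) (Z n) (nat \<lfloor>\<rho> * real n\<rfloor>) \<omega>)}
      \<le> real d * exp (- \<eta> * ?l) + real n * exp (- ((1 + \<epsilon> / 2) * (?l ^ d * ln ?l)))"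
      unfolding \<eta>_def
      by (rule prob_max_load_threshold_greater[OF d \<epsilon> \<rho>]) (use elim \<rho> in \<open>auto simp: \<eta>_def\<close>)
    also have "real n * exp (- ((1 + \<epsilon> / 2) * (?l ^ d * ln ?l))) \<le> real n powr (- \<epsilon> / 4)"
    proof -
      have "\<theta> * ln (real n) \<le> ?l ^ d * ln ?l" using elim n by (simp add: field_simps)
      then have "(1 + \<epsilon> / 2) * (\<theta> * ln (real n)) \<le> (1 + \<epsilon> / 2) * (?l ^ d * ln ?l)"
        using \<epsilon> by (intro mult_left_mono) auto
      also have "(1 + \<epsilon> / 2) * (\<theta> * ln (real n)) = (1 + \<epsilon> / 4) * ln (real n)"
        using \<theta>(2) by (metis mult.assoc)
      finally have "exp (ln (real n) + - ((1 + \<epsilon> / 2) * (?l ^ d * ln ?l))) \<le> exp (- \<epsilon> / 4 * ln (real n))"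
        by (simp add: algebra_simps)
      moreover have "exp (ln (real n) + - ((1 + \<epsilon> / 2) * (?l ^ d * ln ?l))) =
          real n * exp (- ((1 + \<epsilon> / 2) * (?l ^ d * ln ?l)))"
        by (subst exp_add) (use n in simp)
      moreover have "real n powr (- \<epsilon> / 4) = exp (- \<epsilon> / 4 * ln (real n))"
        using n by (simp add: powr_def)
      ultimately show ?thesis by (simp only:)
    qed
    finally show ?case by simp
  qed
  show ?thesis
  proof (rule tendsto_sandwich[where f = "\<lambda>_. 0", OF _ bound])
    show "(\<lambda>n. real d * exp (- \<eta> * threshold d n) + real n powr (- \<epsilon> / 4)) \<longlonglongrightarrow> 0"
      using tendsto_add[OF lim1 lim2] by simp
  qed auto
qed

lemma max_load_lower_tail:
  fixes \<epsilon> \<rho> :: real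
  assumes d: "d \<ge> 1" and \<rho>: "\<rho> > 0" and \<epsilon>: "\<epsilon> > 0"
    and pools: "\<And>n. n \<ge> 3 \<Longrightarrow> allocation_pools (M n) n d (Z n)"
    and f: "\<And>n. n \<ge> 3 \<Longrightarrow> allocation_pools.nonanticipating (M n) n d (Z n) (f n)"
  shows "(\<lambda>n. measure (M n) {\<omega> \<in> space (M n).
    real (max_load n d (f n) (Z n) (nat \<lfloor>\<rho> * real n\<rfloor>) \<omega>) < (real d - \<epsilon>) * threshold d n}) \<longlonglongrightarrow> 0"
proof -
  obtain q G :: nat where q: "2 \<le> q" "q - 1 \<le> G"
    and ratios: "\<And>\<kappa> j. \<kappa> 0 = q - 1 \<Longrightarrow> 1 \<le> j \<Longrightarrow> j \<le> d \<Longrightarrow> (j = d \<and> \<kappa> d = q - 1) \<or> \<kappa> j = G \<Longrightarrow>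
      real d - \<epsilon> \<le> (\<Sum>i<j. real (\<kappa> (Suc i)) / real (\<kappa> i + 3))"
    by (rule sum_ratios_ge[OF d \<epsilon>]) blast
  define K where "K = max (max 1 (d * card (profiles d q G))) (nat \<lceil>\<rho>\<rceil>)"
  have K: "d * card (profiles d q G) \<le> K" "K \<ge> 1" "\<rho> \<le> real K"
    unfolding K_def by (auto simp: le_max_iff_disj) linarith
  define p g where "p = 1 / real q" and "g = real G"
  have p: "0 < p" "p < 1" using q by (auto simp: p_def)
  have g: "0 < g" using q by (auto simp: g_def)
  \<comment> \<open>Eventually \<open>l^d ln l \<le> \<theta> ln n\<close>, so \<open>a d\<close> is
    at least \<open>n powr (p / 2)\<close> and the concentration errors vanish.\<close>
  define \<theta> where "\<theta> = (1 - p / 2) / (1 - p)"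
  have \<theta>: "\<theta> > 1" "(1 - p) * \<theta> = 1 - p / 2" using p by (auto simp: \<theta>_def field_simps)
  have l_top: "filterlim (threshold d) at_top sequentially" by (rule threshold_at_top[OF d])
  \<comment> \<open>To leading order in \<open>l\<close> this is
    \<open>(j + 2) / (j + 3) < 1\<close>; everything else is of lower order.\<close>
  have gain: "eventually (\<lambda>l. (real k / real (j + 3) * l + 1) * (real (j + 2) / real q + ln 2 / ln l) + real G + ln 4 / ln l
      \<le> real k / real q * l) at_top" if "1 \<le> k" for j k
  proof -
    define A B C where "A = real k / real (j + 3)" and "B = real (j + 2) / real q" and "C = real k / real q"
    have pos: "A > 0" "B > 0" using that q by (auto simp: A_def B_def)
    have "A * B = C * (real (j + 2) / real (j + 3))" by (simp add: A_def B_def C_def)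
    also have "\<dots> < C * 1"
      using that q by (intro mult_strict_left_mono) (auto simp: C_def)
    finally have AB: "A * B < C" by simp
    have "((\<lambda>l. ((A * l + 1) * (B + ln 2 / ln l) + g + ln 4 / ln l) / l) \<longlongrightarrow> A * B) at_top"
      using pos g by real_asymp
    from order_tendstoD(2)[OF this AB] eventually_gt_at_top[of 0]
    show ?thesis
    proof eventually_elim
      case (elim l)
      then have "(A * l + 1) * (B + ln 2 / ln l) + g + ln 4 / ln l \<le> C * l"
        by (simp add: pos_divide_less_eq)
      then show ?case by (simp only: A_def B_def C_def g_def)
    qed
  qed
  have "eventually (\<lambda>l. \<forall>(j, k)\<in>{..G} \<times> {1..G}.
      (real k / real (j + 3) * l + 1) * (real (j + 2) / real q + ln 2 / ln l) + real G + ln 4 / ln l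
      \<le> real k / real q * l) at_top"
    by (rule eventually_ball_finite) (use gain in auto)
  note gain_ev = eventually_compose_filterlim[OF this l_top]
  have "((\<lambda>l. (g * l + 1) * l powr (- (1 + p))) \<longlongrightarrow> 0) at_top" using p g by real_asymp
  from order_tendstoD(2)[OF this, of "\<rho> / real K / 2"] \<rho> K
  have "eventually (\<lambda>l. (g * l + 1) * l powr (- (1 + p)) < \<rho> / real K / 2) at_top" by simp
  note first_ev = eventually_compose_filterlim[OF this l_top]
  \<comment> \<open>Where \<open>l\<close> meets \<open>n\<close>, the crude bound
    \<open>l \<le> l^d ln l \<le> 2 ln n\<close> is enough.\<close>
  have "((\<lambda>n::nat. (g * (2 * ln (real n)) + 1) / real n + 3 / real n) \<longlongrightarrow> 0) sequentially" using g by real_asymp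
  from order_tendstoD(2)[OF this, of "\<rho> / real K / 2"] \<rho> K
  have first_ev': "eventually (\<lambda>n::nat. (g * (2 * ln (real n)) + 1) / real n + 3 / real n < \<rho> / real K / 2) sequentially"
    by simp
  have "((\<lambda>l. (g * l + 1) * exp (- (p * l))) \<longlongrightarrow> 0) at_top" using p g by real_asymp
  from order_tendstoD(2)[OF this, of "1 / 2"]
  have "eventually (\<lambda>l. (g * l + 1) * exp (- (p * l)) < 1 / 2) at_top" by simp
  note later_ev = eventually_compose_filterlim[OF this l_top]
  have later_ev': "eventually (\<lambda>n::nat. 2 * (g * (2 * ln (real n)) + 2) \<le> real n powr (p / 2)) sequentially"
    using p g by real_asymp
  define c where "c = real (K * d * card (profiles d q G))"
  have bound: "eventually (\<lambda>n. measure (M n) {\<omega> \<in> space (M n).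
      real (max_load n d (f n) (Z n) (nat \<lfloor>\<rho> * real n\<rfloor>) \<omega>) < (real d - \<epsilon>) * threshold d n}
      \<le> c * (2 * real n powr (- (p / 2)))) sequentially"
    using eventually_ge_at_top[of 3] gain_ev first_ev first_ev' later_ev later_ev'
      eventually_compose_filterlim[OF eventually_ge_at_top[of "max (exp 1) (2 * g)"] l_top]
      order_tendstoD(2)[OF threshold_power_ln[OF d] \<theta>(1)]
      order_tendstoD(2)[OF threshold_power_ln[OF d], of 2, simplified]
  proof eventually_elim
    case (elim n)
    interpret allocation_pools "M n" n d "Z n" using elim pools by simp
    let ?l = "threshold d n"
    have n: "real n > 0" "ln (real n) > 0" using elim by auto
    have l: "?l \<ge> exp 1" "2 * real G \<le> ?l" using elim by (auto simp: g_def)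
    have l1: "?l \<ge> 1" using l(1) exp_ge_add_one_self[of 1] by linarith
    then have lnl: "ln ?l \<ge> 1" using l(1) by (simp add: ln_ge_iff)
    have T: "?l ^ d * ln ?l \<le> \<theta> * ln (real n)" "?l ^ d * ln ?l \<le> 2 * ln (real n)"
      using elim n by (simp_all add: field_simps)
    have "?l * 1 \<le> ?l ^ d * ln ?l"
      using l1 lnl d self_le_power[of ?l d] by (intro mult_mono) auto
    with T have l_le: "?l \<le> 2 * ln (real n)" by linarith
    have T': "(1 - p) * (?l ^ d * ln ?l) \<le> (1 - p / 2) * ln (real n)"
    proof -
      have "(1 - p) * (?l ^ d * ln ?l) \<le> (1 - p) * (\<theta> * ln (real n))"
        using T p by (intro mult_left_mono) auto
      then show ?thesis using \<theta>(2) by (metis mult.assoc)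
    qed
    have "exp (p / 2 * ln (real n)) \<le> exp (ln (real n) + - ((1 - p) * (?l ^ d * ln ?l)))"
      using T' by (simp add: algebra_simps)
    moreover have "exp (ln (real n) + - ((1 - p) * (?l ^ d * ln ?l))) = real n * exp (- ((1 - p) * (?l ^ d * ln ?l)))"
      by (subst exp_add) (use n in simp)
    moreover have "real n powr (p / 2) = exp (p / 2 * ln (real n))" using n by (simp add: powr_def)
    ultimately have a_ge: "real n powr (p / 2) \<le> real n * exp (- ((1 - p) * (?l ^ d * ln ?l)))"
      by (simp only:)
    have "prob {\<omega> \<in> space (M n).
        real (max_load n d (f n) (Z n) (nat \<lfloor>\<rho> * real n\<rfloor>) \<omega>) < (real d - \<epsilon>) * ?l} \<le>
      c * (2 * (exp ((1 - p) * (?l ^ d * ln ?l)) / real n))"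
      unfolding c_def p_def
    proof (rule prob_max_load_nonanticipating_less[OF f d \<rho> q ratios K refl l])
      show "n \<ge> 3" by (rule elim)
      show "(real k / real (j + 3) * ?l + 1) * (real (j + 2) / real q + ln 2 / ln ?l) + real G + ln 4 / ln ?l
          \<le> real k / real q * ?l" if "j \<le> G" "1 \<le> k" "k \<le> G" for j k
        using elim(2) that by (elim ballE[of _ _ "(j, k)"]) auto
      show "(real G * ?l + 1) * exp (- ?l / real q) \<le> 1 / 2"
        using elim by (simp add: g_def p_def)
      have "g * ?l \<le> g * (2 * ln (real n))" using g l_le by (intro mult_left_mono) auto
      then have "2 * (g * ?l + 2) \<le> 2 * (g * (2 * ln (real n)) + 2)"
        and div: "(g * ?l + 1) / real n \<le> (g * (2 * ln (real n)) + 1) / real n"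
        by (auto intro: divide_right_mono)
      then show "2 * (real G * ?l + 2) \<le> real n * exp (- ((1 - 1 / real q) * (?l ^ d * ln ?l)))"
        using elim a_ge by (simp only: g_def p_def)
      have "(g * ?l + 1) * (?l powr (- (1 + p)) + 1 / real n) + 3 / real n =
          (g * ?l + 1) * ?l powr (- (1 + p)) + ((g * ?l + 1) / real n + 3 / real n)"
        by (simp add: distrib_left)
      also have "\<dots> \<le> \<rho> / real K" using elim div by linarith
      finally show "(real G * ?l + 1) * (?l powr (- (1 + 1 / real q)) + 1 / real n) + 3 / real n \<le> \<rho> / real K"
        by (simp only: g_def p_def)
    qed
    also have "\<dots> \<le> c * (2 * real n powr (- (p / 2)))"
    proof -
      have "exp ((1 - p) * (?l ^ d * ln ?l)) / real n \<le> exp ((1 - p / 2) * ln (real n)) / real n"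
        using T' n by (intro divide_right_mono) auto
      also have "\<dots> = exp ((1 - p / 2) * ln (real n) - ln (real n))"
        using n by (simp add: exp_diff)
      also have "\<dots> = real n powr (- (p / 2))"
        using n by (simp add: powr_def left_diff_distrib)
      finally show ?thesis by (intro mult_left_mono) (auto simp: c_def)
    qed
    finally show ?case .
  qed
  show ?thesis
  proof (rule tendsto_sandwich[where f = "\<lambda>_. 0", OF _ bound])
    show "(\<lambda>n. c * (2 * real n powr (- (p / 2)))) \<longlonglongrightarrow> 0" using p by real_asymp
  qed auto
qed

lemma (in allocation_pools) nonanticipating_strategy:
  assumes "d \<ge> 1" "thinning_strategy M n d Z f"
  shows "nonanticipating f"
proof (cases "d = 1")
  case True
  have "nonanticipating (threshold_strategy 0)"
    by (rule nonanticipating_deterministic[OF assms(1)]) (simp add: threshold_strategy_def)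
  then show ?thesis
    unfolding nonanticipating_def history_1_cong[OF True, of f _ _ "threshold_strategy 0"] .
next
  case False
  then show ?thesis using assms by (intro nonanticipating_thinning) auto
qed

theorem theorem1p1:
  fixes d :: nat and \<rho> :: real
    and M :: "nat \<Rightarrow> 'a measure" and Z :: "nat \<Rightarrow> nat \<Rightarrow> nat \<Rightarrow> 'a \<Rightarrow> nat"
  assumes "d \<ge> 1" and "\<rho> > 0"
    and "\<And>n. n \<ge> 3 \<Longrightarrow> allocation_pools (M n) n d (Z n)"
  defines "N \<equiv> \<lambda>n. nat \<lfloor>\<rho> * real n\<rfloor>"
    and "f \<equiv> \<lambda>n. threshold_strategy (threshold d n)"
  shows
    "(\<forall>\<epsilon>>0. \<forall>(g :: nat \<Rightarrow> 'a decisions) Z'.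
        (\<forall>n\<ge>3. allocation_pools (M n) n d (Z' n) \<and> thinning_strategy (M n) n d (Z' n) (g n)) \<longrightarrow>
        (\<lambda>n. measure (M n) {\<omega> \<in> space (M n).
            real (max_load n d (f n) (Z n) (N n) \<omega>)
              \<le> (1 + \<epsilon>) * real (max_load n d (g n) (Z' n) (N n) \<omega>)}) \<longlonglongrightarrow> 1) \<and>
     (\<forall>\<epsilon>>0. (\<lambda>n. measure (M n) {\<omega> \<in> space (M n).
            (real d - \<epsilon>) * threshold d n \<le> real (max_load n d (f n) (Z n) (N n) \<omega>) \<and>
            real (max_load n d (f n) (Z n) (N n) \<omega>) \<le> (real d + \<epsilon>) * threshold d n}) \<longlonglongrightarrow> 1)"
proof -
  define up where "up = (\<lambda>\<epsilon> n. {\<omega> \<in> space (M n).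
    (real d + \<epsilon>) * threshold d n < real (max_load n d (f n) (Z n) (N n) \<omega>)})"
  define low where "low = (\<lambda>(g :: nat \<Rightarrow> 'a decisions) Z' \<epsilon> n. {\<omega> \<in> space (M n).
    real (max_load n d (g n) (Z' n) (N n) \<omega>) < (real d - \<epsilon>) * threshold d n})"
  have f: "allocation_pools.nonanticipating (M n) n d (Z n) (f n)" if "n \<ge> 3" for n
    unfolding f_def
    by (rule allocation_pools.nonanticipating_deterministic[OF assms(3)[OF that] assms(1)])
      (simp add: threshold_strategy_def)
  have up: "(\<lambda>n. measure (M n) (up \<epsilon> n)) \<longlonglongrightarrow> 0" if "\<epsilon> > 0" for \<epsilon>
    unfolding up_def f_def N_def by (rule max_load_threshold_upper_tail[OF assms(1,2) that assms(3)])
  \<comment> \<open>Only the two tails enter, through a union bound, so the joint law of the pools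
    \<open>Z\<close> and \<open>Z'\<close> is irrelevant.\<close>
  have whp: "(\<lambda>n. measure (M n) (good n)) \<longlonglongrightarrow> 1"
    if \<epsilon>: "\<epsilon> > 0" and Z': "\<And>n. n \<ge> 3 \<Longrightarrow> allocation_pools (M n) n d (Z' n)"
      and g: "\<And>n. n \<ge> 3 \<Longrightarrow> allocation_pools.nonanticipating (M n) n d (Z' n) (g n)"
      and good: "\<And>n. n \<ge> 3 \<Longrightarrow> good n \<in> sets (M n)"
      and sub: "\<And>n. n \<ge> 3 \<Longrightarrow> threshold d n \<ge> 0 \<Longrightarrow> space (M n) \<subseteq> good n \<union> (up \<epsilon> n \<union> low g Z' \<epsilon> n)"
    for \<epsilon> g Z' good
  proof (rule tendsto_sandwich)
    have low: "(\<lambda>n. measure (M n) (low g Z' \<epsilon> n)) \<longlonglongrightarrow> 0"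
      unfolding low_def N_def by (rule max_load_lower_tail[OF assms(1,2) \<epsilon> Z' g])
    show "(\<lambda>n. 1 - (measure (M n) (up \<epsilon> n) + measure (M n) (low g Z' \<epsilon> n))) \<longlonglongrightarrow> 1"
      using tendsto_diff[OF tendsto_const tendsto_add[OF up[OF \<epsilon>] low], of 1] by simp
    show "eventually (\<lambda>n. 1 - (measure (M n) (up \<epsilon> n) + measure (M n) (low g Z' \<epsilon> n)) \<le> measure (M n) (good n)) sequentially"
      using eventually_ge_at_top[of 3]
    proof eventually_elim
      case (elim n)
      interpret f: allocation_pools "M n" n d "Z n" by (rule assms(3)[OF elim])
      interpret g: allocation_pools "M n" n d "Z' n" by (rule Z'[OF elim])
      have "up \<epsilon> n \<in> sets (M n)" "low g Z' \<epsilon> n \<in> sets (M n)"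
        unfolding up_def low_def
        using f.measurable_max_load[OF f[OF elim]] g.measurable_max_load[OF g[OF elim]] by measurable
      note ev = this good[OF elim]
      have "0 \<le> threshold d n" by (simp add: threshold_def)
      have "1 = f.prob (space (M n))" by (simp add: f.prob_space)
      also have "\<dots> \<le> f.prob (good n \<union> (up \<epsilon> n \<union> low g Z' \<epsilon> n))"
        using sub[OF elim \<open>0 \<le> threshold d n\<close>] ev by (intro f.finite_measure_mono) auto
      also have "\<dots> \<le> f.prob (good n) + f.prob (up \<epsilon> n \<union> low g Z' \<epsilon> n)"
        using ev by (intro measure_Un_le) auto
      also have "f.prob (up \<epsilon> n \<union> low g Z' \<epsilon> n) \<le> f.prob (up \<epsilon> n) + f.prob (low g Z' \<epsilon> n)"
        using ev by (intro measure_Un_le) auto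
      finally show ?case by linarith
    qed
    show "eventually (\<lambda>n. measure (M n) (good n) \<le> 1) sequentially"
      using eventually_ge_at_top[of 3]
    proof eventually_elim
      case (elim n)
      interpret f: allocation_pools "M n" n d "Z n" by (rule assms(3)[OF elim])
      show ?case by (rule f.prob_le_1)
    qed
  qed simp
  show ?thesis
  proof (intro conjI allI impI)
    fix \<epsilon> :: real and g :: "nat \<Rightarrow> 'a decisions" and Z'
    assume \<epsilon>: "\<epsilon> > 0"
      and gZ: "\<forall>n\<ge>3. allocation_pools (M n) n d (Z' n) \<and> thinning_strategy (M n) n d (Z' n) (g n)"
    \<comment> \<open>Solves \<open>1 + \<delta> = (1 + \<epsilon>) (1 - \<delta>)\<close>, the case
      \<open>d = 1\<close> of \<open>coef\<close>; larger \<open>d\<close> only helps.\<close>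
    define \<delta> where "\<delta> = \<epsilon> / (2 + \<epsilon>)"
    have \<delta>: "\<delta> > 0" using \<epsilon> by (simp add: \<delta>_def)
    have Z': "allocation_pools (M n) n d (Z' n)" if "n \<ge> 3" for n using gZ that by simp
    have g: "allocation_pools.nonanticipating (M n) n d (Z' n) (g n)" if "n \<ge> 3" for n
      using gZ that by (intro allocation_pools.nonanticipating_strategy[OF Z' assms(1)]) auto
    have coef: "real d + \<delta> \<le> (1 + \<epsilon>) * (real d - \<delta>)"
    proof -
      have "\<delta> * (2 + \<epsilon>) = \<epsilon>" using \<epsilon> by (simp add: \<delta>_def)
      moreover have "\<epsilon> * 1 \<le> \<epsilon> * real d" using \<epsilon> assms(1) by (intro mult_left_mono) auto
      ultimately show ?thesis by (simp add: algebra_simps)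
    qed
    show "(\<lambda>n. measure (M n) {\<omega> \<in> space (M n). real (max_load n d (f n) (Z n) (N n) \<omega>)
        \<le> (1 + \<epsilon>) * real (max_load n d (g n) (Z' n) (N n) \<omega>)}) \<longlonglongrightarrow> 1"
    proof (rule whp[OF \<delta> Z' g])
      fix n :: nat assume n: "n \<ge> 3"
      interpret f: allocation_pools "M n" n d "Z n" by (rule assms(3)[OF n])
      interpret g: allocation_pools "M n" n d "Z' n" by (rule Z'[OF n])
      show "{\<omega> \<in> space (M n). real (max_load n d (f n) (Z n) (N n) \<omega>)
          \<le> (1 + \<epsilon>) * real (max_load n d (g n) (Z' n) (N n) \<omega>)} \<in> sets (M n)"
        using f.measurable_max_load[OF f[OF n]] g.measurable_max_load[OF g[OF n]] by measurable
      assume l: "threshold d n \<ge> 0"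
      have "X \<le> (1 + \<epsilon>) * Y" if "X \<le> (real d + \<delta>) * threshold d n" "(real d - \<delta>) * threshold d n \<le> Y" for X Y
      proof -
        have "(real d + \<delta>) * threshold d n \<le> (1 + \<epsilon>) * (real d - \<delta>) * threshold d n"
          by (intro mult_right_mono coef l)
        also have "\<dots> = (1 + \<epsilon>) * ((real d - \<delta>) * threshold d n)" by simp
        also have "\<dots> \<le> (1 + \<epsilon>) * Y" using that \<epsilon> by (intro mult_left_mono) auto
        finally show ?thesis using that by linarith
      qed
      note compare = this
      show "space (M n) \<subseteq> {\<omega> \<in> space (M n). real (max_load n d (f n) (Z n) (N n) \<omega>)
          \<le> (1 + \<epsilon>) * real (max_load n d (g n) (Z' n) (N n) \<omega>)} \<union> (up \<delta> n \<union> low g Z' \<delta> n)"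
      proof
        fix \<omega> assume \<omega>: "\<omega> \<in> space (M n)"
        have "real (max_load n d (f n) (Z n) (N n) \<omega>) \<le> (1 + \<epsilon>) * real (max_load n d (g n) (Z' n) (N n) \<omega>)"
          if "\<omega> \<notin> up \<delta> n" "\<omega> \<notin> low g Z' \<delta> n"
          using that \<omega> by (intro compare) (auto simp: up_def low_def)
        with \<omega> show "\<omega> \<in> {\<omega> \<in> space (M n). real (max_load n d (f n) (Z n) (N n) \<omega>)
          \<le> (1 + \<epsilon>) * real (max_load n d (g n) (Z' n) (N n) \<omega>)} \<union> (up \<delta> n \<union> low g Z' \<delta> n)"
          by blast
      qed
    qed
  next
    fix \<epsilon> :: real assume \<epsilon>: "\<epsilon> > 0"
    \<comment> \<open>The lower tail, valid for every nonanticipating strategy, is applied to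
      \<open>f\<close> itself.\<close>
    show "(\<lambda>n. measure (M n) {\<omega> \<in> space (M n).
            (real d - \<epsilon>) * threshold d n \<le> real (max_load n d (f n) (Z n) (N n) \<omega>) \<and>
            real (max_load n d (f n) (Z n) (N n) \<omega>) \<le> (real d + \<epsilon>) * threshold d n}) \<longlonglongrightarrow> 1"
    proof (rule whp[OF \<epsilon> assms(3) f])
      fix n :: nat assume n: "n \<ge> 3"
      interpret f: allocation_pools "M n" n d "Z n" by (rule assms(3)[OF n])
      show "{\<omega> \<in> space (M n). (real d - \<epsilon>) * threshold d n \<le> real (max_load n d (f n) (Z n) (N n) \<omega>) \<and>
          real (max_load n d (f n) (Z n) (N n) \<omega>) \<le> (real d + \<epsilon>) * threshold d n} \<in> sets (M n)"
        using f.measurable_max_load[OF f[OF n]] by measurable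
      show "space (M n) \<subseteq> {\<omega> \<in> space (M n).
          (real d - \<epsilon>) * threshold d n \<le> real (max_load n d (f n) (Z n) (N n) \<omega>) \<and>
          real (max_load n d (f n) (Z n) (N n) \<omega>) \<le> (real d + \<epsilon>) * threshold d n} \<union> (up \<epsilon> n \<union> low f Z \<epsilon> n)"
        unfolding up_def low_def by (auto simp: not_less)
    qed
  qed
qed

end
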